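(* Let $Z\subset\mathbb{P}^3_{\mathbb{C}}$ be a $(4,4)$ half grid. Then, up to a projective change of coordinates of $\mathbb{P}^3$, $Z$ is either A) (the anharmonic case) the set of the $16$ points $$\begin{array}{llll} (1:0:0:0), & (0:1:0:0), & (1:1:0:0), & (0:1:1:1),\\ (0:0:1:0), & (0:0:0:1), & (0:0:1:1), & (1:1:1:0),\\ (1:0:1:0), & (0:1:0:1), & (1:1:1:1), & (1:0:0:-1),\\ (1:0:\varepsilon:0), & (0:1:0:\varepsilon), & (1:1:\varepsilon:\varepsilon), & (1:\varepsilon:\varepsilon:\varepsilon-1), \end{array}$$ where $\varepsilon$ is a primitive root of unity of order six, or B) (the harmonic case) the set of the $16$ points $$\begin{array}{llll} (1:0:0:0), & (0:1:0:0), & (1:1:0:0), & (1:0:0:-1),\\ (0:0:1:0), & (0:0:0:1), & (0:0:1:1), & (0:1:1:0),\\ (1:0:1:0), & (0:1:0:1), & (1:1:1:1), & (1:1:1:-1),\\ (1:0:-1:0), & (0:1:0:-1), & (1:1:-1:-1), & (-1:1:1:1). \end{array}$$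
   Context: We work over $\mathbb{C}$. A finite set of points $Z\subset\mathbb{P}^3$ is geproci if its general projection (projection from a general point) to a hyperplane (plane) is a complete intersection. It is trivial if it is already contained in a plane; only nontrivial geproci sets are considered. For $a\le b$, a geproci set $Z$ is called $(a,b)$-geproci if the general projection is the set of intersection points of two plane curves of degrees $a$ and $b$ (equivalently, the ideal of the projection has exactly two generators, one of degree $a$ and one of degree $b$). An $(a,b)$ grid is the set of all $ab$ intersection points among lines in two sets $\{L_1,\dots,L_a\}$ and $\{M_1,\dots,M_b\}$ of lines in $\mathbb{P}^3$ such that lines from the same set are pairwise skew and any two lines from distinct sets intersect in a point. A nontrivial $(a,b)$-geproci set $Z\subset\mathbb{P}^3$ is an $(a,b)$ half grid if it is not a grid, but one of the two curves determining its general projection as a complete intersection can be taken to be a union of lines. *)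

theory Defs
  imports "HOL-Analysis.Analysis" "HOL-Library.Poly_Mapping"
begin

text \<open>
  The projective space with homogeneous coordinates indexed by \<open>'n\<close> is the set of one-dimensional
  subspaces of \<open>complex ^ 'n\<close>, so \<open>'n = 4\<close> gives projective 3-space and \<open>'n = 3\<close> the projective plane.
  Lines and planes are linear subspaces of dimension 2 and 3, and incidence is inclusion.
\<close>

definition proj_points :: "(complex ^ 'n) set set" where
  "proj_points = {vec.span {v} | v. v \<noteq> 0}"

definition proj_line :: "(complex ^ 'n) set \<Rightarrow> bool" where
  "proj_line L \<longleftrightarrow> vec.subspace L \<and> vec.dim L = 2"

definition proj_plane :: "(complex ^ 'n) set \<Rightarrow> bool" where
  "proj_plane H \<longleftrightarrow> vec.subspace H \<and> vec.dim H = 3"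

definition skew :: "(complex ^ 'n) set \<Rightarrow> (complex ^ 'n) set \<Rightarrow> bool" where
  "skew L M \<longleftrightarrow> L \<inter> M = {0}"

definition proj_image :: "complex ^ 'n ^ 'm \<Rightarrow> (complex ^ 'n) set set \<Rightarrow> (complex ^ 'm) set set" where
  "proj_image A Z = (\<lambda>p. (\<lambda>v. A *v v) ` p) ` Z"

definition proj_equivalent :: "(complex ^ 'n) set set \<Rightarrow> (complex ^ 'n) set set \<Rightarrow> bool" where
  "proj_equivalent Z W \<longleftrightarrow> (\<exists>T :: complex ^ 'n ^ 'n. invertible T \<and> proj_image T Z = W)"


text \<open>Polynomials in variables indexed by \<open>'n\<close>: a monomial is its finitely supported exponent vector.\<close>

type_synonym 'n cpoly = "('n \<Rightarrow>\<^sub>0 nat) \<Rightarrow>\<^sub>0 complex"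

definition poly_eval :: "'n::finite cpoly \<Rightarrow> complex ^ 'n \<Rightarrow> complex" where
  "poly_eval f v =
    (\<Sum>m\<in>Poly_Mapping.keys f. Poly_Mapping.lookup f m * (\<Prod>i\<in>UNIV. (v $ i) ^ Poly_Mapping.lookup m i))"

definition form :: "nat \<Rightarrow> 'n::finite cpoly \<Rightarrow> bool" where
  "form d f \<longleftrightarrow> f \<noteq> 0 \<and> (\<forall>m\<in>Poly_Mapping.keys f. (\<Sum>i\<in>UNIV. Poly_Mapping.lookup m i) = d)"

text \<open>
  A polynomial vanishes on all representatives of a point iff all its homogeneous components vanish
  at the point, so this is the homogeneous ideal of \<open>Y\<close>.
\<close>

definition vanishing_ideal :: "(complex ^ 'n) set set \<Rightarrow> 'n::finite cpoly set" where
  "vanishing_ideal Y = {f. \<forall>p\<in>Y. \<forall>v\<in>p. poly_eval f v = 0}"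

definition complete_intersection ::
  "nat \<Rightarrow> nat \<Rightarrow> (complex ^ 3) set set \<Rightarrow> 3 cpoly \<Rightarrow> 3 cpoly \<Rightarrow> bool" where
  "complete_intersection a b Y F G \<longleftrightarrow>
    form a F \<and> form b G \<and> vanishing_ideal Y = {A * F + B * G | A B. True}"

text \<open>The plane curve defined by \<open>F\<close> is a union of lines.\<close>

definition union_of_lines :: "3 cpoly \<Rightarrow> bool" where
  "union_of_lines F \<longleftrightarrow> (\<exists>(n::nat) l. (\<forall>i<n. form 1 (l i)) \<and> F = (\<Prod>i<n. l i))"


text \<open>
  Projection from \<open>P\<close> to a plane is given, in homogeneous coordinates on that plane, by a matrix
  with kernel \<open>P\<close>; two such matrices differ by a change of coordinates of the target plane.
  A general \<open>P\<close> is one outside the zero set of some fixed nonzero form.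
\<close>

definition general_projection ::
  "(complex ^ 4) set set \<Rightarrow> ((complex ^ 3) set set \<Rightarrow> bool) \<Rightarrow> bool" where
  "general_projection Z Q \<longleftrightarrow>
    (\<exists>d (h :: 4 cpoly). form d h \<and>
      (\<forall>P\<in>proj_points. (\<exists>v\<in>P. poly_eval h v \<noteq> 0) \<longrightarrow>
        (\<forall>A :: complex ^ 4 ^ 3. {v. A *v v = 0} = P \<longrightarrow> Q (proj_image A Z))))"

definition geproci :: "nat \<Rightarrow> nat \<Rightarrow> (complex ^ 4) set set \<Rightarrow> bool" where
  "geproci a b Z \<longleftrightarrow> 1 \<le> a \<and> a \<le> b \<and> finite Z \<and> Z \<subseteq> proj_points \<and>
    general_projection Z (\<lambda>Y. \<exists>F G. complete_intersection a b Y F G)"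

definition nontrivial :: "(complex ^ 4) set set \<Rightarrow> bool" where
  "nontrivial Z \<longleftrightarrow> \<not> (\<exists>H. proj_plane H \<and> (\<forall>p\<in>Z. p \<subseteq> H))"

definition grid :: "nat \<Rightarrow> nat \<Rightarrow> (complex ^ 4) set set \<Rightarrow> bool" where
  "grid a b Z \<longleftrightarrow>
    (\<exists>\<L> \<M>. finite \<L> \<and> card \<L> = a \<and> finite \<M> \<and> card \<M> = b \<and>
      (\<forall>L\<in>\<L>. proj_line L) \<and> (\<forall>M\<in>\<M>. proj_line M) \<and>
      (\<forall>L\<in>\<L>. \<forall>L'\<in>\<L>. L \<noteq> L' \<longrightarrow> skew L L') \<and>
      (\<forall>M\<in>\<M>. \<forall>M'\<in>\<M>. M \<noteq> M' \<longrightarrow> skew M M') \<and>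
      (\<forall>L\<in>\<L>. \<forall>M\<in>\<M>. L \<inter> M \<in> proj_points) \<and>
      Z = {L \<inter> M | L M. L \<in> \<L> \<and> M \<in> \<M>})"

definition half_grid :: "nat \<Rightarrow> nat \<Rightarrow> (complex ^ 4) set set \<Rightarrow> bool" where
  "half_grid a b Z \<longleftrightarrow> geproci a b Z \<and> nontrivial Z \<and> \<not> (\<exists>c d. grid c d Z) \<and>
    general_projection Z
      (\<lambda>Y. \<exists>F G. complete_intersection a b Y F G \<and> (union_of_lines F \<or> union_of_lines G))"


definition primitive_root_of_unity :: "nat \<Rightarrow> complex \<Rightarrow> bool" where
  "primitive_root_of_unity n z \<longleftrightarrow> z ^ n = 1 \<and> (\<forall>k. 0 < k \<and> k < n \<longrightarrow> z ^ k \<noteq> 1)"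

definition pt :: "complex \<Rightarrow> complex \<Rightarrow> complex \<Rightarrow> complex \<Rightarrow> (complex ^ 4) set" where
  "pt x y z w = vec.span {vector [x, y, z, w]}"

definition anharmonic_points :: "complex \<Rightarrow> (complex ^ 4) set set" where
  "anharmonic_points \<epsilon> =
    {pt 1 0 0 0, pt 0 1 0 0, pt 1 1 0 0, pt 0 1 1 1,
     pt 0 0 1 0, pt 0 0 0 1, pt 0 0 1 1, pt 1 1 1 0,
     pt 1 0 1 0, pt 0 1 0 1, pt 1 1 1 1, pt 1 0 0 (-1),
     pt 1 0 \<epsilon> 0, pt 0 1 0 \<epsilon>, pt 1 1 \<epsilon> \<epsilon>, pt 1 \<epsilon> \<epsilon> (\<epsilon> - 1)}"

definition harmonic_points :: "(complex ^ 4) set set" where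
  "harmonic_points =
    {pt 1 0 0 0, pt 0 1 0 0, pt 1 1 0 0, pt 1 0 0 (-1),
     pt 0 0 1 0, pt 0 0 0 1, pt 0 0 1 1, pt 0 1 1 0,
     pt 1 0 1 0, pt 0 1 0 1, pt 1 1 1 1, pt 1 1 1 (-1),
     pt 1 0 (-1) 0, pt 0 1 0 (-1), pt 1 1 (-1) (-1), pt (-1) 1 1 1}"

end

theory Submission
  imports Defs "HOL-Computational_Algebra.Fundamental_Theorem_Algebra"
begin

text \<open>
  Over a general point \<open>P\<close> the four lines of the projection carry four points of \<open>Z\<close> each, and three
  points of \<open>Z\<close> coplanar with a general \<open>P\<close> are collinear, so \<open>Z\<close> consists of four points on each of
  four lines \<open>L\<^sub>i\<close>. For every general \<open>P\<close> there is a quartic cone \<open>q\<close> with vertex \<open>P\<close> through \<open>Z\<close>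
  containing none of the lines. The cones for different vertices are proportional on each line, so
  \<open>q = c\<^sub>i f\<close> on \<open>L\<^sub>i\<close> for one fixed quartic form \<open>f\<close>.

  If \<open>P = a + b\<close> then \<open>q a = q b\<close>, because \<open>q\<close> is invariant under translation by \<open>P\<close>. Comparing such
  relations on two or three lines and eliminating the \<open>c\<^sub>i\<close> shows that the lines are pairwise skew and
  that the common transversals of any three of them match up their points of \<open>Z\<close>. In coordinates
  \<open>{(y, 0)}\<close>, \<open>{(0, y)}\<close>, \<open>{(y, y)}\<close>, \<open>{(y, M y)}\<close> of the lines, all four carry the same four points
  \<open>S\<close> of the projective line, and \<open>M\<close> and \<open>1 - M\<close> preserve \<open>S\<close>. If \<open>M\<close> is scalar, then \<open>Z\<close> is a
  grid. Otherwise \<open>M\<close> and \<open>1 - M\<close> induce different rotations of the projective line with the same two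
  fixed points, of order 3 (anharmonic case) or of order dividing 4 (harmonic case).
\<close>

section \<open>Polynomials as functions\<close>

text \<open>The ideal equality in \<open>complete_intersection\<close> enters as reducedness:
  testing it on forms that vanish at all projected points but one shows that \<open>F\<close> and
  \<open>G\<close> meet transversally. Hence each line of \<open>F\<close> carries exactly four
  points and no point lies on two lines. The cones can be compared on a line because a binary
  quartic with four distinct zeros is determined by them up to a factor.

  The obstacle is that the factors \<open>c i\<close> depend on the vertex in an unknown way, so
  only relations in which they cancel are useful. Such a relation is an identity of forms in the
  coordinates of the vertex. Valid for a general vertex, it holds for all arguments, in particular
  at zeros of \<open>f\<close>.

  Finiteness bounds the rotations: their orders divide the number of points of \<open>S\<close> off
  the two fixed points, which is 2, 3 or 4. With 2, both rotations would be the same involution.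
  With 3, the fourth point of \<open>S\<close> is a fixed point, which supplies the sixth root of
  unity. With 4, one of three maps derived from \<open>M\<close> is an involution, and reordering
  the lines turns it into \<open>M\<close>.\<close>

definition mono_eval :: "('n::finite \<Rightarrow>\<^sub>0 nat) \<Rightarrow> complex ^ 'n \<Rightarrow> complex" where
  "mono_eval m v = (\<Prod>i\<in>UNIV. (v $ i) ^ Poly_Mapping.lookup m i)"

lemma mono_eval_add: "mono_eval (m + n) v = mono_eval m v * mono_eval n v"
  by (simp add: mono_eval_def lookup_add power_add prod.distrib)

lemma poly_eval_superset:
  assumes "finite K" "Poly_Mapping.keys f \<subseteq> K"
  shows "poly_eval f v = (\<Sum>m\<in>K. Poly_Mapping.lookup f m * mono_eval m v)"
  unfolding poly_eval_def mono_eval_def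
  by (rule sum.mono_neutral_left) (use assms in \<open>auto simp: in_keys_iff\<close>)

lemma poly_eval_zero [simp]: "poly_eval 0 v = 0"
  by (simp add: poly_eval_def)

lemma poly_eval_add: "poly_eval (f + g) v = poly_eval f v + poly_eval g v"
proof -
  let ?K = "Poly_Mapping.keys f \<union> Poly_Mapping.keys g"
  have "Poly_Mapping.keys (f + g) \<subseteq> ?K" by (rule Poly_Mapping.keys_add)
  then show ?thesis
    by (simp add: poly_eval_superset[of ?K] lookup_add distrib_right sum.distrib)
qed

lemma poly_eval_single: "poly_eval (Poly_Mapping.single m c) v = c * mono_eval m v"
  by (subst poly_eval_superset[of "{m}"]) (auto simp: lookup_single)

lemma poly_eval_one [simp]: "poly_eval 1 v = 1"
  using poly_eval_single[of 0 1 v] by (simp add: mono_eval_def)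

lemma poly_eval_single_mult:
  "poly_eval (Poly_Mapping.single m c * g) v = c * mono_eval m v * poly_eval g v"
proof (induction g rule: update_induct)
  case const
  then show ?case by simp
next
  case (update f a b)
  have upd: "Poly_Mapping.update a b f = f + Poly_Mapping.single a b"
    using update by (intro poly_mapping_eqI) (auto simp: lookup_update lookup_add lookup_single in_keys_iff when_def)
  show ?case
    unfolding upd using update
    by (simp add: distrib_left poly_eval_add mult_single poly_eval_single mono_eval_add algebra_simps)
qed

lemma poly_eval_mult: "poly_eval (f * g) v = poly_eval f v * poly_eval g v"
proof (induction f rule: update_induct)
  case const
  then show ?case by simp
next
  case (update f a b)
  have upd: "Poly_Mapping.update a b f = f + Poly_Mapping.single a b"
    using update by (intro poly_mapping_eqI) (auto simp: lookup_update lookup_add lookup_single in_keys_iff when_def)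
  show ?case
    unfolding upd using update
    by (simp add: distrib_right poly_eval_add poly_eval_single_mult poly_eval_single)
qed

lemma poly_eval_prod: "poly_eval (\<Prod>i\<in>I. f i) v = (\<Prod>i\<in>I. poly_eval (f i) v)"
  by (induction I rule: infinite_finite_induct) (auto simp: poly_eval_mult)


inductive form_fun :: "nat \<Rightarrow> (complex ^ 'n \<Rightarrow> complex) \<Rightarrow> bool" where
  const: "form_fun 0 (\<lambda>_. c)"
| coord: "form_fun 1 (\<lambda>x. x $ i)"
| mult: "form_fun a f \<Longrightarrow> form_fun b g \<Longrightarrow> form_fun (a + b) (\<lambda>x. f x * g x)"
| add: "form_fun a f \<Longrightarrow> form_fun a g \<Longrightarrow> form_fun a (\<lambda>x. f x + g x)"

lemma form_fun_cmult: "form_fun d f \<Longrightarrow> form_fun d (\<lambda>x. c * f x)"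
  using form_fun.mult[OF form_fun.const] by fastforce

lemma form_fun_zero: "form_fun d (\<lambda>_. 0)"
proof (induction d)
  case 0
  show ?case by (rule form_fun.const)
next
  case (Suc d)
  from form_fun.mult[OF this form_fun.coord] show ?case by simp
qed

lemma form_fun_diff: "form_fun d f \<Longrightarrow> form_fun d g \<Longrightarrow> form_fun d (\<lambda>x. f x - g x)"
  using form_fun.add[OF _ form_fun_cmult[where c = "-1"], of d f g] by simp

lemma form_fun_sum:
  "(\<And>i. i \<in> I \<Longrightarrow> form_fun d (f i)) \<Longrightarrow> form_fun d (\<lambda>x. \<Sum>i\<in>I. f i x)"
  by (induction I rule: infinite_finite_induct) (auto intro: form_fun_zero form_fun.add)

lemma form_fun_prod:
  "(\<And>i. i \<in> I \<Longrightarrow> form_fun (d i) (f i)) \<Longrightarrow> form_fun (\<Sum>i\<in>I. d i) (\<lambda>x. \<Prod>i\<in>I. f i x)"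
  by (induction I rule: infinite_finite_induct) (auto intro: form_fun.const form_fun.mult)

lemma form_fun_power: "form_fun d f \<Longrightarrow> form_fun (k * d) (\<lambda>x. f x ^ k)"
  using form_fun_prod[of "{..<k}" "\<lambda>_. d" "\<lambda>_. f"] by simp

lemma form_fun_mono_eval: "form_fun (\<Sum>i\<in>UNIV. Poly_Mapping.lookup m i) (mono_eval m)"
  unfolding mono_eval_def[abs_def]
  by (rule form_fun_prod) (use form_fun_power[OF form_fun.coord] in fastforce)

lemma form_fun_poly_eval:
  assumes "form d F"
  shows "form_fun d (poly_eval F)"
proof -
  have "poly_eval F = (\<lambda>v. \<Sum>m\<in>Poly_Mapping.keys F. Poly_Mapping.lookup F m * mono_eval m v)"
    by (rule ext) (rule poly_eval_superset, auto)
  moreover have "form_fun d (\<lambda>v. Poly_Mapping.lookup F m * mono_eval m v)"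
    if "m \<in> Poly_Mapping.keys F" for m
    using assms that form_fun_mono_eval[of m] by (auto simp: form_def intro: form_fun_cmult)
  ultimately show ?thesis by (auto intro: form_fun_sum)
qed

text \<open>Ideal membership concerns \<open>cpoly\<close>; this turns a function built from linear
  forms back into a polynomial to which the ideal can be applied.\<close>

lemma form_fun_eq_poly_eval: "form_fun d f \<Longrightarrow> \<exists>F. f = poly_eval F"
proof (induction rule: form_fun.induct)
  case (const c)
  have "(\<lambda>_. c) = poly_eval (Poly_Mapping.single 0 c)"
    by (rule ext) (simp add: poly_eval_single mono_eval_def)
  then show ?case by blast
next
  case (coord i)
  have "(\<lambda>x. x $ i) = poly_eval (Poly_Mapping.single (Poly_Mapping.single i 1) 1)"
  proof
    fix x :: "complex ^ 'a"
    have "(\<Prod>j\<in>UNIV. x $ j ^ Poly_Mapping.lookup (Poly_Mapping.single i 1) j)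
        = (\<Prod>j\<in>UNIV. if j = i then x $ i else 1)"
      by (rule prod.cong) (auto simp: lookup_single when_def)
    then show "x $ i = poly_eval (Poly_Mapping.single (Poly_Mapping.single i 1) 1) x"
      by (simp add: poly_eval_single mono_eval_def)
  qed
  then show ?case by blast
next
  case (mult a f b g)
  then show ?case using poly_eval_mult by metis
next
  case (add a f g)
  then show ?case using poly_eval_add by metis
qed

definition lin :: "complex ^ 'n \<Rightarrow> complex ^ 'n \<Rightarrow> complex" where
  "lin a x = (\<Sum>i\<in>UNIV. a $ i * x $ i)"

lemma lin_add: "lin a (x + y) = lin a x + lin a y"
  by (simp add: lin_def distrib_left sum.distrib)

lemma lin_scale: "lin a (c *s x) = c * lin a x"
  by (simp add: lin_def sum_distrib_left mult.left_commute)

lemma lin_zero [simp]: "lin a 0 = 0"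
  by (simp add: lin_def)

lemma lin_diff: "lin a (x - y) = lin a x - lin a y"
  by (simp add: lin_def right_diff_distrib sum_subtractf)

lemma lin_axis: "lin (axis i 1) x = x $ i"
  by (simp add: lin_def axis_def if_distrib[of "\<lambda>x. x * _"] cong: if_cong)

lemma form_fun_lin: "form_fun 1 (lin a)"
  unfolding lin_def[abs_def] by (intro form_fun_sum form_fun_cmult form_fun.coord)

lemma form_fun_compose:
  fixes A :: "complex ^ 'n ^ 'm"
  shows "form_fun d f \<Longrightarrow> form_fun d (\<lambda>x. f (A *v x))"
proof (induction rule: form_fun.induct)
  case (coord i)
  show ?case
    using form_fun_lin[of "A $ i"] by (simp add: matrix_vector_mult_def lin_def[abs_def])
qed (auto intro: form_fun.intros)

lemma form_fun_scale: "form_fun d f \<Longrightarrow> f (c *s x) = c ^ d * f x"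
  by (induction rule: form_fun.induct) (auto simp: power_add algebra_simps)

lemma form_fun_at_0: "form_fun d f \<Longrightarrow> d > 0 \<Longrightarrow> f 0 = 0"
  using form_fun_scale[of d f 0 0] by (simp add: power_0_left split: if_splits)

text \<open>The coefficient at \<open>d\<close>, possibly above the degree of \<open>p\<close>, is
  the value of \<open>f\<close> at \<open>v\<close>, the point at infinity of the line. It decides
  whether a zero escapes to infinity.\<close>

lemma form_fun_on_line:
  "form_fun d f \<Longrightarrow> \<exists>p. degree p \<le> d \<and> coeff p d = f v \<and> (\<forall>t. f (u + t *s v) = poly p t)"
proof (induction rule: form_fun.induct)
  case (const c)
  show ?case by (rule exI[of _ "[:c:]"]) simp
next
  case (coord i)
  show ?case by (rule exI[of _ "[:u $ i, v $ i:]"]) simp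
next
  case (mult a f b g)
  then obtain p q where p: "degree p \<le> a" "coeff p a = f v" "\<forall>t. f (u + t *s v) = poly p t"
    and q: "degree q \<le> b" "coeff q b = g v" "\<forall>t. g (u + t *s v) = poly q t" by blast
  have "coeff (p * q) (a + b) = (\<Sum>i\<le>a + b. if i = a then coeff p a * coeff q b else 0)"
    unfolding coeff_mult
  proof (rule sum.cong)
    fix i assume "i \<in> {..a + b}"
    then show "coeff p i * coeff q (a + b - i) = (if i = a then coeff p a * coeff q b else 0)"
      using p(1) q(1) by (cases "i < a"; cases "i = a") (auto simp: coeff_eq_0)
  qed simp
  then have "coeff (p * q) (a + b) = f v * g v" using p q by simp
  moreover have "degree (p * q) \<le> a + b"
    using degree_mult_le[of p q] p q by simp
  ultimately show ?case using p q by (intro exI[of _ "p * q"]) auto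
next
  case (add a f g)
  then obtain p q where "degree p \<le> a" "coeff p a = f v" "\<forall>t. f (u + t *s v) = poly p t"
    "degree q \<le> a" "coeff q a = g v" "\<forall>t. g (u + t *s v) = poly q t" by blast
  then show ?case by (intro exI[of _ "p + q"]) (auto intro: degree_add_le)
qed

text \<open>\<open>l\<close> is the gradient of \<open>f\<close> at \<open>v\<close>, obtained from
  the product rule; one \<open>l\<close> serves all directions \<open>w\<close>.\<close>

lemma form_fun_derivative:
  fixes f :: "complex ^ 'n \<Rightarrow> complex"
  shows "form_fun d f \<Longrightarrow> \<exists>l. \<forall>w. ((\<lambda>t. f (v + t *s w)) has_field_derivative lin l w) (at 0)"
proof (induction rule: form_fun.induct)
  case (const c)
  show ?case by (rule exI[of _ 0]) (simp add: lin_def)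
next
  case (coord i)
  show ?case
    by (intro exI[of _ "axis i 1"]) (auto intro!: derivative_eq_intros simp: lin_axis)
next
  case (mult a f b g)
  then obtain k l where
    k: "\<And>w. ((\<lambda>t. f (v + t *s w)) has_field_derivative lin k w) (at 0)" and
    l: "\<And>w. ((\<lambda>t. g (v + t *s w)) has_field_derivative lin l w) (at 0)" by blast
  have "((\<lambda>t. f (v + t *s w) * g (v + t *s w)) has_field_derivative
      lin (g v *s k + f v *s l) w) (at 0)" for w
    by (rule DERIV_cong[OF DERIV_mult[OF k l]])
      (simp add: lin_def sum.distrib sum_distrib_right distrib_right, simp add: mult_ac)
  then show ?case by blast
next
  case (add a f g)
  then obtain k l where
    k: "\<And>w. ((\<lambda>t. f (v + t *s w)) has_field_derivative lin k w) (at 0)" and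
    l: "\<And>w. ((\<lambda>t. g (v + t *s w)) has_field_derivative lin l w) (at 0)" by blast
  have "((\<lambda>t. f (v + t *s w) + g (v + t *s w)) has_field_derivative lin (k + l) w) (at 0)" for w
    by (rule DERIV_cong[OF DERIV_add[OF k l]]) (simp add: lin_def sum.distrib distrib_right)
  then show ?case by blast
qed

text \<open>Both functions restrict to nonzero polynomials on the line joining \<open>x\<close> and \<open>y\<close>.\<close>

lemma form_fun_mult_nonzero:
  assumes "form_fun a f" "form_fun b g" "f x \<noteq> 0" "g y \<noteq> 0"
  shows "\<exists>z. f z \<noteq> 0 \<and> g z \<noteq> 0"
proof -
  obtain p where p: "\<And>t. f (x + t *s (y - x)) = poly p t"
    using form_fun_on_line[OF assms(1)] by metis
  obtain q where q: "\<And>t. g (x + t *s (y - x)) = poly q t"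
    using form_fun_on_line[OF assms(2)] by metis
  have "p \<noteq> 0" using p[of 0] assms(3) by auto
  moreover have "q \<noteq> 0" using q[of 1] assms(4) by auto
  ultimately have "finite ({t. poly p t = 0} \<union> {t. poly q t = 0})" by (simp add: poly_roots_finite)
  then obtain t where "t \<notin> {t. poly p t = 0} \<union> {t. poly q t = 0}"
    using ex_new_if_finite infinite_UNIV_char_0 by blast
  then show ?thesis using p q by (intro exI[of _ "x + t *s (y - x)"]) auto
qed

text \<open>The lowest digit is the residue modulo \<open>B\<close>; the others follow by induction.
  Exponent vectors will play the role of digit sequences.\<close>

lemma digit_expansion_inj:
  fixes e e' :: "nat \<Rightarrow> nat"
  assumes "\<And>j. j < n \<Longrightarrow> e j < B" "\<And>j. j < n \<Longrightarrow> e' j < B"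
    and "(\<Sum>j<n. e j * B ^ j) = (\<Sum>j<n. e' j * B ^ j)" "j < n"
  shows "e j = e' j"
  using assms
proof (induction n arbitrary: e e' j)
  case (Suc n)
  have expand: "(\<Sum>j<Suc n. d j * B ^ j) = d 0 + B * (\<Sum>j<n. d (Suc j) * B ^ j)" for d :: "nat \<Rightarrow> nat"
    by (simp only: sum.lessThan_Suc_shift) (simp add: sum_distrib_left mult_ac)
  have eq: "e 0 + B * (\<Sum>j<n. e (Suc j) * B ^ j) = e' 0 + B * (\<Sum>j<n. e' (Suc j) * B ^ j)"
    using Suc.prems(3) unfolding expand .
  have lt: "e 0 < B" "e' 0 < B" using Suc.prems by auto
  have e0: "e 0 = e' 0"
    using arg_cong[OF eq, of "\<lambda>x. x mod B"] lt by simp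
  then have "(\<Sum>j<n. e (Suc j) * B ^ j) = (\<Sum>j<n. e' (Suc j) * B ^ j)"
    using eq lt by simp
  then have "e (Suc k) = e' (Suc k)" if "k < n" for k
    using Suc.IH[of "\<lambda>j. e (Suc j)" "\<lambda>j. e' (Suc j)" k] Suc.prems that by auto
  then show ?case using e0 Suc.prems(4) by (cases j) auto
qed simp

text \<open>Kronecker's substitution \<open>v\<^sub>i = t ^ B ^ i\<close> separates the monomials.\<close>

lemma poly_eval_nonzero:
  fixes F :: "'n::finite cpoly"
  assumes "F \<noteq> 0"
  shows "\<exists>v. poly_eval F v \<noteq> 0"
proof (rule ccontr)
  assume "\<not> ?thesis"
  then have zero: "poly_eval F v = 0" for v by simp
  let ?K = "Poly_Mapping.keys F"
  obtain \<sigma> where \<sigma>: "bij_betw \<sigma> {..<CARD('n)} (UNIV :: 'n set)"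
    using ex_bij_betw_nat_finite[of "UNIV :: 'n set"] by (auto simp: atLeast0LessThan)
  \<comment> \<open>The base exceeds every exponent that occurs in \<open>F\<close>, so the
    exponents of a monomial are admissible digits.\<close>
  define B where "B = Suc (\<Sum>m\<in>?K. \<Sum>i\<in>UNIV. Poly_Mapping.lookup m i)"
  have B: "Poly_Mapping.lookup m i < B" if "m \<in> ?K" for m i
  proof -
    have "Poly_Mapping.lookup m i \<le> (\<Sum>i\<in>UNIV. Poly_Mapping.lookup m i)"
      by (rule member_le_sum) auto
    also have "\<dots> \<le> (\<Sum>m\<in>?K. \<Sum>i\<in>UNIV. Poly_Mapping.lookup m i)"
      by (rule member_le_sum[OF that]) auto
    finally show ?thesis by (simp add: B_def)
  qed
  define E where "E m = (\<Sum>j<CARD('n). Poly_Mapping.lookup m (\<sigma> j) * B ^ j)" for m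
  define w where "w t = (\<chi> i. t ^ (B ^ the_inv_into {..<CARD('n)} \<sigma> i))" for t :: complex
  have mono: "mono_eval m (w t) = t ^ E m" for m t
  proof -
    have "mono_eval m (w t) = (\<Prod>j<CARD('n). (w t $ \<sigma> j) ^ Poly_Mapping.lookup m (\<sigma> j))"
      unfolding mono_eval_def by (rule prod.reindex_bij_betw[OF \<sigma>, symmetric])
    also have "\<dots> = (\<Prod>j<CARD('n). t ^ (Poly_Mapping.lookup m (\<sigma> j) * B ^ j))"
    proof (rule prod.cong)
      fix j assume "j \<in> {..<CARD('n)}"
      then have "the_inv_into {..<CARD('n)} \<sigma> (\<sigma> j) = j"
        using \<sigma> by (simp add: bij_betw_def the_inv_into_f_f)
      then have "w t $ \<sigma> j = t ^ (B ^ j)" by (simp add: w_def)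
      then show "w t $ \<sigma> j ^ Poly_Mapping.lookup m (\<sigma> j) = t ^ (Poly_Mapping.lookup m (\<sigma> j) * B ^ j)"
        by (metis mult.commute power_mult)
    qed simp
    finally show ?thesis by (simp add: E_def power_sum)
  qed
  have inj: "inj_on E ?K"
  proof (rule inj_onI)
    fix m m' assume m: "m \<in> ?K" "m' \<in> ?K" "E m = E m'"
    have *: "Poly_Mapping.lookup m (\<sigma> j) = Poly_Mapping.lookup m' (\<sigma> j)" if "j < CARD('n)" for j
      using digit_expansion_inj[of "CARD('n)" "\<lambda>j. Poly_Mapping.lookup m (\<sigma> j)" B
          "\<lambda>j. Poly_Mapping.lookup m' (\<sigma> j)" j] m that B by (simp add: E_def)
    then have "Poly_Mapping.lookup m i = Poly_Mapping.lookup m' i" for i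
    proof -
      have "i \<in> \<sigma> ` {..<CARD('n)}" using \<sigma> by (simp add: bij_betw_def)
      then show ?thesis using * by auto
    qed
    then show "m = m'" by (simp add: poly_mapping_eqI)
  qed
  define p where "p = (\<Sum>m\<in>?K. monom (Poly_Mapping.lookup F m) (E m))"
  have "poly p t = poly_eval F (w t)" for t
    by (simp add: p_def poly_sum poly_monom poly_eval_superset[of ?K] mono)
  then have "\<forall>t. poly p t = 0" using zero by simp
  then have "p = 0" using poly_all_0_iff_0 by blast
  obtain m where m: "m \<in> ?K"
    using assms by (metis keys_eq_empty all_not_in_conv)
  have "coeff p (E m) = (\<Sum>k\<in>?K. if k = m then Poly_Mapping.lookup F k else 0)"
    unfolding p_def coeff_sum coeff_monom
    by (rule sum.cong) (use m inj in \<open>auto simp: inj_on_eq_iff\<close>)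
  then have "coeff p (E m) = Poly_Mapping.lookup F m" using m by simp
  then show False using \<open>p = 0\<close> m by (simp add: in_keys_iff)
qed

section \<open>Linear algebra and genericity\<close>

abbreviation point :: "complex ^ 'n \<Rightarrow> (complex ^ 'n) set" where
  "point x \<equiv> vec.span {x}"

lemma separating_functional:
  fixes W :: "(complex ^ 'n) set"
  assumes "vec.subspace W" "x \<notin> W"
  shows "\<exists>a. (\<forall>w\<in>W. lin a w = 0) \<and> lin a x = 1"
proof -
  obtain B where B: "B \<subseteq> W" "vec.independent B" "W \<subseteq> vec.span B"
    using vec.maximal_independent_subset by blast
  then have W: "W = vec.span B" using assms(1) by (simp add: vec.span_minimal subset_antisym)
  then have ind: "vec.independent (insert x B)"
    using assms(2) B(2) by (simp add: vec.independent_insert)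
  have "x \<notin> B" using assms(2) B(1) by blast
  \<comment> \<open>Linear extension is used for maps into \<open>complex ^ 'n\<close>; the
    functional is then one coordinate of such a map, and any index \<open>i\<close> will do.\<close>
  obtain i :: 'n where True by blast
  have "\<exists>g. Vector_Spaces.linear (*s) (*s) g \<and> (\<forall>y\<in>insert x B. g y = (if y = x then axis i 1 else 0 :: complex ^ 'n))"
    by (rule vec.linear_independent_extend[OF ind])
  then obtain g where g: "Vector_Spaces.linear (*s) (*s) g"
      "\<And>y. y \<in> insert x B \<Longrightarrow> g y = (if y = x then axis i 1 else 0)" by blast
  have eq: "lin (matrix g $ i) y = g y $ i" for y
  proof -
    have "lin (matrix g $ i) y = (matrix g *v y) $ i"
      by (simp add: matrix_vector_mult_def lin_def)
    also have "matrix g *v y = g y" by (rule matrix_works[OF g(1)])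
    finally show ?thesis .
  qed
  have "g w = 0" if "w \<in> W" for w
  proof (rule vec.linear_eq_0_on_span[OF g(1)])
    show "w \<in> vec.span B" using that W by simp
    show "g y = 0" if "y \<in> B" for y using g(2)[of y] that \<open>x \<notin> B\<close> by auto
  qed
  then show ?thesis using g(2)[of x] by (intro exI[of _ "matrix g $ i"]) (simp add: eq)
qed

text \<open>Unlike \<open>vec.independent {u, v}\<close>, this excludes \<open>u = v\<close>, since
  the set would collapse to a singleton.\<close>

definition indep2 :: "complex ^ 'n \<Rightarrow> complex ^ 'n \<Rightarrow> bool" where
  "indep2 u v \<longleftrightarrow> (\<forall>s t. s *s u + t *s v = 0 \<longrightarrow> s = 0 \<and> t = 0)"

lemma span_pair: "vec.span {u, v} = {s *s u + t *s v | s t. True}"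
proof (intro equalityI subsetI)
  fix x assume "x \<in> vec.span {u, v}"
  then obtain s t where "x - s *s u = t *s v"
    by (auto simp: vec.span_insert[of u] vec.span_singleton)
  then have "x = s *s u + t *s v" by (simp add: diff_eq_eq add.commute)
  then show "x \<in> {s *s u + t *s v | s t. True}" by blast
next
  fix x assume "x \<in> {s *s u + t *s v | s t. True}"
  then show "x \<in> vec.span {u, v}"
    by (auto intro!: vec.span_add vec.span_scale intro: vec.span_base)
qed

lemma span_eq_iff:
  fixes u v :: "complex ^ 'n"
  assumes "v \<noteq> 0"
  shows "point u = point v \<longleftrightarrow> (\<exists>c. c \<noteq> 0 \<and> u = c *s v)"
proof
  assume eq: "point u = point v"
  then have "u \<in> point v" "v \<in> point u"
    by (metis singletonI vec.span_base)+
  then obtain c where c: "u = c *s v" by (auto simp: vec.span_singleton)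
  obtain d where "v = d *s u" using \<open>v \<in> point u\<close> by (auto simp: vec.span_singleton)
  with c have "c \<noteq> 0" using assms by auto
  then show "\<exists>c. c \<noteq> 0 \<and> u = c *s v" using c by blast
next
  assume "\<exists>c. c \<noteq> 0 \<and> u = c *s v"
  then obtain c where c: "c \<noteq> 0" "u = c *s v" by blast
  then have "v = inverse c *s u" by simp
  then have "v \<in> point u" by (auto simp: vec.span_singleton)
  moreover have "u \<in> point v" using c by (auto simp: vec.span_singleton)
  ultimately show "point u = point v"
    by (intro subset_antisym vec.span_minimal) auto
qed

lemma span_scale_eq:
  fixes v :: "complex ^ 'n"
  assumes "c \<noteq> 0"
  shows "point (c *s v) = point v"
proof (cases "v = 0")
  case False
  then show ?thesis using span_eq_iff[of v "c *s v"] assms by blast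
qed simp

lemma indep2_iff:
  assumes "u \<noteq> 0"
  shows "indep2 u v \<longleftrightarrow> v \<notin> point u"
proof
  assume i: "indep2 u v"
  show "v \<notin> point u"
  proof
    assume "v \<in> point u"
    then obtain c where "v = c *s u" by (auto simp: vec.span_singleton)
    then have "c *s u + (-1) *s v = 0" by simp
    then have "(-1 :: complex) = 0" using i unfolding indep2_def by blast
    then show False by simp
  qed
next
  assume n: "v \<notin> point u"
  show "indep2 u v"
    unfolding indep2_def
  proof (intro allI impI)
    fix s t assume e: "s *s u + t *s v = 0"
    have "t = 0"
    proof (rule ccontr)
      assume t: "t \<noteq> 0"
      have "v = inverse t *s (t *s v)" using t by simp
      also have "t *s v = (- s) *s u" using e by (simp add: eq_neg_iff_add_eq_0 add.commute)
      finally have "v = (inverse t * - s) *s u" by simp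
      then show False using n by (simp only: vec.span_singleton) blast
    qed
    then show "s = 0 \<and> t = 0" using e assms by simp
  qed
qed

lemma indep2_commute: "indep2 u v \<longleftrightarrow> indep2 v u"
proof -
  have "indep2 y x" if "indep2 x y" for x y :: "complex ^ 'n"
    unfolding indep2_def
  proof (intro allI impI)
    fix s t assume "s *s y + t *s x = 0"
    then have "t *s x + s *s y = 0" by (simp only: add.commute)
    then show "s = 0 \<and> t = 0" using that unfolding indep2_def by blast
  qed
  then show ?thesis by blast
qed

lemma indep2_nonzero:
  assumes "indep2 u v"
  shows "u \<noteq> 0" "v \<noteq> 0"
  using assms[unfolded indep2_def, rule_format, of 1 0] assms[unfolded indep2_def, rule_format, of 0 1]
  by auto

lemma indep2_span_ne: "u \<noteq> 0 \<Longrightarrow> v \<noteq> 0 \<Longrightarrow> point u \<noteq> point v \<Longrightarrow> indep2 u v"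
proof (subst indep2_iff, assumption, rule notI)
  assume a: "u \<noteq> 0" "v \<noteq> 0" "point u \<noteq> point v" "v \<in> point u"
  then obtain c where c: "v = c *s u" by (auto simp: vec.span_singleton)
  then have "c \<noteq> 0" using a(2) by auto
  then show False using a(3) span_scale_eq[of c u] c by simp
qed

lemma indep2_add_nonzero:
  assumes "indep2 x y"
  shows "x + t *s y \<noteq> 0"
proof
  assume "x + t *s y = 0"
  then have "1 *s x + t *s y = 0" by simp
  then have "(1 :: complex) = 0" using assms unfolding indep2_def by blast
  then show False by simp
qed

lemma indep2_line_inj:
  assumes "indep2 x y" "x + s *s y = c *s (x + t *s y)"
  shows "s = t"
proof -
  have "(1 - c) *s x + (s - c * t) *s y = 0"
    using assms(2) by (simp add: vec_eq_iff) (simp add: algebra_simps)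
  then have "1 - c = 0 \<and> s - c * t = 0" using assms(1) unfolding indep2_def by blast
  then show ?thesis by simp
qed

lemma span_line_inj:
  assumes "indep2 x y" "point (x + s *s y) = point (x + t *s y)"
  shows "s = t"
proof -
  obtain c where "x + s *s y = c *s (x + t *s y)"
    using span_eq_iff[OF indep2_add_nonzero[OF assms(1)]] assms(2) by blast
  then show ?thesis by (rule indep2_line_inj[OF assms(1)])
qed

lemma indep2_independent:
  assumes "indep2 u v"
  shows "vec.independent {u, v}" "u \<noteq> v"
proof -
  have "u \<noteq> 0" "v \<notin> point u"
    using assms indep2_nonzero indep2_iff by blast+
  then have "vec.independent {v, u}"
    by (simp add: vec.independent_insert)
  then show "vec.independent {u, v}" by (simp add: insert_commute)
  show "u \<noteq> v" using \<open>v \<notin> point u\<close> vec.span_base by blast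
qed

lemma proj_line_span: "indep2 u v \<Longrightarrow> proj_line (vec.span {u, v})"
  using indep2_independent[of u v] by (simp add: proj_line_def vec.dim_eq_card_independent)

lemma proj_line_extend:
  assumes "proj_line L" "w \<in> L" "w \<noteq> 0"
  shows "\<exists>u. indep2 u w \<and> L = vec.span {u, w}"
proof -
  have L: "vec.subspace L" "vec.dim L = 2" using assms by (auto simp: proj_line_def)
  have "\<exists>u. u \<in> L \<and> u \<notin> point w"
  proof (rule ccontr)
    assume "\<not> ?thesis"
    then have "vec.dim L \<le> vec.dim (point w)" by (intro vec.dim_subset) auto
    also have "\<dots> \<le> 1" by (simp add: vec.dim_insert)
    finally show False using L by simp
  qed
  then obtain u where u: "u \<in> L" "u \<notin> point w" by blast
  have i: "indep2 u w" using u assms(3) indep2_iff indep2_commute by blast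
  have "vec.span {u, w} \<subseteq> L" using u assms L by (intro vec.span_minimal) auto
  moreover have "vec.dim (vec.span {u, w}) = vec.dim L"
    using proj_line_span[OF i] L by (simp add: proj_line_def)
  ultimately have "vec.span {u, w} = L"
    using L by (intro vec.subspace_dim_equal) auto
  then show ?thesis using i by blast
qed

lemma proj_line_obtain:
  assumes "proj_line L"
  obtains u v where "indep2 u v" "L = vec.span {u, v}"
proof -
  have "L \<noteq> {0}" using assms by (auto simp: proj_line_def)
  then obtain w where "w \<in> L" "w \<noteq> 0" using assms vec.subspace_0 by (fastforce simp: proj_line_def)
  then show ?thesis using proj_line_extend[OF assms] that by blast
qed

section \<open>Generic properties of vectors\<close>

definition generic :: "(complex ^ 'n \<Rightarrow> bool) \<Rightarrow> bool" where
  "generic Q \<longleftrightarrow> (\<exists>d h. form_fun d h \<and> (\<exists>v. h v \<noteq> 0) \<and> (\<forall>v. h v \<noteq> 0 \<longrightarrow> Q v))"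

lemma genericI: "form_fun d h \<Longrightarrow> h v \<noteq> 0 \<Longrightarrow> generic (\<lambda>v. h v \<noteq> 0)"
  unfolding generic_def by (intro exI[of _ d] exI[of _ h]) auto

lemma generic_mono: "generic Q \<Longrightarrow> (\<And>v. Q v \<Longrightarrow> R v) \<Longrightarrow> generic R"
  unfolding generic_def by (elim ex_forward) blast

text \<open>The product of the two witnessing forms is again nonzero somewhere, as both restrict to
  nonzero polynomials on a suitable line.\<close>

lemma generic_conj:
  assumes "generic Q" "generic R"
  shows "generic (\<lambda>v. Q v \<and> R v)"
proof -
  obtain a f where f: "form_fun a f" "\<exists>v. f v \<noteq> 0" "\<forall>v. f v \<noteq> 0 \<longrightarrow> Q v"
    using assms(1) unfolding generic_def by blast
  obtain b g where g: "form_fun b g" "\<exists>v. g v \<noteq> 0" "\<forall>v. g v \<noteq> 0 \<longrightarrow> R v"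
    using assms(2) unfolding generic_def by blast
  obtain z where "f z \<noteq> 0 \<and> g z \<noteq> 0" using form_fun_mult_nonzero f g by metis
  then have "\<exists>v. f v * g v \<noteq> 0" by auto
  then show ?thesis
    unfolding generic_def
    by (intro exI[of _ "a + b"] exI[of _ "\<lambda>v. f v * g v"]) (use form_fun.mult[OF f(1) g(1)] f(3) g(3) in auto)
qed

lemma generic_True: "generic (\<lambda>_. True)"
  unfolding generic_def
  by (intro exI[of _ 0] exI[of _ "\<lambda>_. 1"]) (simp add: form_fun.const)

lemma generic_ball:
  assumes "finite I" "\<And>i. i \<in> I \<Longrightarrow> generic (Q i)"
  shows "generic (\<lambda>v. \<forall>i\<in>I. Q i v)"
  using assms
proof (induction I rule: finite_induct)
  case empty
  show ?case by (simp add: generic_True)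
next
  case (insert i I)
  have "generic (\<lambda>v. Q i v \<and> (\<forall>i\<in>I. Q i v))"
    by (rule generic_conj) (use insert in auto)
  then show ?case by simp
qed

lemma generic_ex: "generic Q \<Longrightarrow> \<exists>v. Q v"
  unfolding generic_def by blast

lemma generic_not_in_subspace:
  assumes "vec.subspace W" "x \<notin> W"
  shows "generic (\<lambda>v. v \<notin> W)"
proof -
  obtain a where "\<forall>w\<in>W. lin a w = 0" "lin a x = 1"
    using separating_functional[OF assms] by blast
  then show ?thesis
    by (intro generic_mono[OF genericI[OF form_fun_lin, of a x]]) auto
qed

text \<open>Density principle: identities derived from a cone with general vertex become identities
  for all arguments.\<close>

lemma form_fun_generic_zero:
  assumes "form_fun d f" "generic (\<lambda>v. f v = 0)"
  shows "f x = 0"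
proof (rule ccontr)
  assume "f x \<noteq> 0"
  from generic_ex[OF generic_conj[OF genericI[OF assms(1) this] assms(2)]] show False
    by simp
qed

section \<open>Binary forms\<close>

definition zero_points :: "(complex ^ 'n \<Rightarrow> complex) \<Rightarrow> (complex ^ 'n) set \<Rightarrow> (complex ^ 'n) set set" where
  "zero_points q L = {point x | x. x \<in> L \<and> x \<noteq> 0 \<and> q x = 0}"

text \<open>The point \<open>w\<close> is put at infinity. As \<open>q w\<close> is nonzero, no zero
  is lost there and the degree does not drop, so projective zeros are exactly affine roots.\<close>

lemma form_fun_on_proj_line:
  assumes q: "form_fun d q" and "indep2 u w" and w: "q w \<noteq> 0" "d > 0"
  shows "\<exists>p. p \<noteq> 0 \<and> degree p = d \<and> (\<forall>t. q (u + t *s w) = poly p t) \<and>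
    bij_betw (\<lambda>t. point (u + t *s w)) {t. poly p t = 0} (zero_points q (vec.span {u, w}))"
proof -
  obtain p where p: "degree p \<le> d" "coeff p d = q w" "\<forall>t. q (u + t *s w) = poly p t"
    using form_fun_on_line[OF q] by metis
  have p0: "p \<noteq> 0" "degree p = d" using p w le_degree[of p d] by auto
  have ne: "u + t *s w \<noteq> 0" for t by (rule indep2_add_nonzero[OF assms(2)])
  have "inj_on (\<lambda>t. point (u + t *s w)) {t. poly p t = 0}"
    using span_line_inj[OF assms(2)] by (rule inj_onI)
  moreover have "(\<lambda>t. point (u + t *s w)) ` {t. poly p t = 0} = zero_points q (vec.span {u, w})"
  proof (intro equalityI subsetI)
    fix z assume "z \<in> (\<lambda>t. point (u + t *s w)) ` {t. poly p t = 0}"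
    then obtain t where t: "z = point (u + t *s w)" "poly p t = 0" by blast
    have "u + t *s w \<in> vec.span {u, w}" by (intro vec.span_add vec.span_scale vec.span_base) auto
    then show "z \<in> zero_points q (vec.span {u, w})" using t p ne unfolding zero_points_def by auto
  next
    fix z assume "z \<in> zero_points q (vec.span {u, w})"
    then obtain s t where z: "z = point (s *s u + t *s w)" "q (s *s u + t *s w) = 0"
      "s *s u + t *s w \<noteq> 0"
      by (auto simp: zero_points_def span_pair)
    have s: "s \<noteq> 0"
    proof
      assume "s = 0"
      then have "t ^ d * q w = 0" using z form_fun_scale[OF q, of t w] by simp
      then show False using z \<open>s = 0\<close> w by simp
    qed
    have eq: "s *s u + t *s w = s *s (u + (t / s) *s w)"
      using s by (simp add: vec_eq_iff distrib_left)
    then have "q (u + (t / s) *s w) = 0" using z(2) s unfolding eq form_fun_scale[OF q] by simp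
    moreover have "z = point (u + (t / s) *s w)" unfolding z(1) eq by (rule span_scale_eq[OF s])
    ultimately show "z \<in> (\<lambda>t. point (u + t *s w)) ` {t. poly p t = 0}" using p by auto
  qed
  ultimately have "bij_betw (\<lambda>t. point (u + t *s w)) {t. poly p t = 0} (zero_points q (vec.span {u, w}))"
    unfolding bij_betw_def ..
  then show ?thesis using p(3) p0 by (intro exI[of _ p]) simp
qed

lemma zero_points_bound:
  assumes "form_fun d q" "proj_line L" "w \<in> L" "q w \<noteq> 0" "d > 0"
  shows "finite (zero_points q L)" "card (zero_points q L) \<le> d"
proof -
  have "w \<noteq> 0" using form_fun_at_0 assms by blast
  then obtain u where u: "indep2 u w" "L = vec.span {u, w}" using proj_line_extend assms by blast
  obtain p where p: "p \<noteq> 0" "degree p = d"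
    "bij_betw (\<lambda>t. point (u + t *s w)) {t. poly p t = 0} (zero_points q L)"
    using form_fun_on_proj_line[OF assms(1) u(1) assms(4,5)] u(2) by blast
  show "finite (zero_points q L)" using bij_betw_finite[OF p(3)] poly_roots_finite[OF p(1)] by blast
  show "card (zero_points q L) \<le> d"
    using bij_betw_same_card[OF p(3)] card_poly_roots_bound[OF p(1)] p(2) by simp
qed

text \<open>Over the complex numbers a polynomial without multiple roots is a product of distinct
  linear factors.\<close>

lemma card_simple_roots:
  fixes p :: "complex poly"
  assumes "\<And>t. poly p t = 0 \<Longrightarrow> poly (pderiv p) t \<noteq> 0"
  shows "card {t. poly p t = 0} = degree p"
proof -
  have "rsquarefree p" using assms by (auto simp: rsquarefree_roots)
  then have eq: "smult (lead_coeff p) (\<Prod>z | poly p z = 0. [:-z, 1:]) = p"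
    by (rule complex_poly_decompose_rsquarefree)
  have "p \<noteq> 0" using assms by force
  then have "degree p = degree (\<Prod>z | poly p z = 0. [:-z, 1:])"
    by (subst eq[symmetric]) simp
  also have "\<dots> = card {t. poly p t = 0}" by (subst degree_prod_sum_eq) auto
  finally show ?thesis ..
qed

section \<open>Complete intersections containing a union of lines\<close>

text \<open>The degree is kept as an equation so that the induction goes through: in a product of
  degree 1 one factor has degree 0 and is constant.\<close>

lemma form_fun_1_lin: "form_fun d f \<Longrightarrow> d = 1 \<Longrightarrow> \<exists>a. f = lin a"
proof (induction rule: form_fun.induct)
  case (coord i)
  then show ?case by (intro exI[of _ "axis i 1"] ext) (simp add: lin_axis)
next
  case (mult a f b g)
  have const: "h x = h 0" if "form_fun 0 h" for h :: "complex ^ 'a \<Rightarrow> complex" and x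
    using form_fun_scale[OF that, of 0 x] by simp
  have smult: "(\<lambda>x. c * lin k x) = lin (c *s k)" for c and k :: "complex ^ 'a"
    by (simp add: fun_eq_iff lin_def sum_distrib_left mult.assoc)
  consider "a = 0" "b = 1" | "a = 1" "b = 0" using mult.prems by linarith
  then show ?case
  proof cases
    case 1
    then obtain k where k: "g = lin k" using mult.IH(2) by auto
    have "f x = f 0" for x using const[of f x] mult.hyps(1) 1(1) by simp
    then have "(\<lambda>x. f x * g x) = (\<lambda>x. f 0 * lin k x)" unfolding k by (intro ext) (rule arg_cong[of _ _ "\<lambda>c. c * _"])
    then show ?thesis unfolding smult by blast
  next
    case 2
    then obtain k where k: "f = lin k" using mult.IH(1) by auto
    have "g x = g 0" for x using const[of g x] mult.hyps(2) 2(2) by simp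
    then have "lin k x * g x = g 0 * lin k x" for x by (metis mult.commute)
    then have "(\<lambda>x. f x * g x) = (\<lambda>x. g 0 * lin k x)" unfolding k by (rule ext)
    then show ?thesis unfolding smult by blast
  qed
next
  case (add a f g)
  then obtain k l where "f = lin k" "g = lin l" by blast
  then have "(\<lambda>x. f x + g x) = lin (k + l)" by (simp add: fun_eq_iff lin_def distrib_right sum.distrib)
  then show ?case by blast
qed simp

lemma kernel_subspace: "vec.subspace {x. lin a x = 0}"
  unfolding vec.subspace_def by (auto simp: lin_add lin_scale)

lemma lin_nonzero:
  assumes "a \<noteq> 0"
  shows "\<exists>x. lin a x = 1"
proof -
  obtain i where i: "a $ i \<noteq> 0" using assms by (auto simp: vec_eq_iff)
  have "lin a (axis i 1) = a $ i"
    by (simp add: lin_def axis_def if_distrib[of "\<lambda>x. _ * x"] cong: if_cong)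
  then have "lin a (inverse (a $ i) *s axis i 1) = 1" using i by (simp add: lin_scale)
  then show ?thesis by blast
qed

lemma kernel_dim:
  fixes a :: "complex ^ 'n"
  assumes "a \<noteq> 0"
  shows "Suc (vec.dim {x. lin a x = 0}) = CARD('n)"
proof -
  let ?K = "{x. lin a x = 0}"
  obtain e where e: "lin a e = 1" using lin_nonzero assms by blast
  have "x \<in> vec.span (insert e ?K)" for x
  proof -
    have "x - lin a x *s e \<in> ?K" using e by (simp add: lin_diff lin_scale)
    then show ?thesis unfolding vec.span_insert by (blast intro: vec.span_base)
  qed
  then have "vec.dim (insert e ?K) = vec.dim (UNIV :: (complex ^ 'n) set)"
    by (metis UNIV_eq_I vec.dim_span)
  moreover have "e \<notin> vec.span ?K"
    using e vec.span_minimal[OF order_refl kernel_subspace[of a]] by auto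
  ultimately show ?thesis by (simp add: vec.dim_insert vec.dim_UNIV card_cart_basis)
qed

lemma kernel_proj_line:
  fixes a :: "complex ^ 3"
  shows "a \<noteq> 0 \<Longrightarrow> proj_line {x. lin a x = 0}"
  using kernel_dim[of a] kernel_subspace by (simp add: proj_line_def)

lemma proj_pointsE:
  assumes "p \<in> proj_points"
  obtains v where "v \<noteq> 0" "p = point v"
  using assms by (auto simp: proj_points_def)

lemma proj_point_eq_span:
  assumes "p \<in> proj_points" "x \<in> p" "x \<noteq> 0"
  shows "p = point x"
proof -
  obtain v where v: "v \<noteq> 0" "p = point v" using assms(1) by (rule proj_pointsE)
  then obtain c where "x = c *s v" using assms(2) by (auto simp: vec.span_singleton)
  then show ?thesis using v assms(3) span_scale_eq[of c v] by auto
qed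

text \<open>A product of linear forms, one through each other point of \<open>Y\<close> and none
  through \<open>x\<close>.\<close>

lemma separator_form:
  assumes "finite Y" "Y \<subseteq> proj_points" "x \<noteq> 0"
  shows "\<exists>d f. form_fun d f \<and> f x \<noteq> 0 \<and> (\<forall>p\<in>Y. p \<noteq> point x \<longrightarrow> (\<forall>v\<in>p. f v = 0))"
proof -
  let ?Y = "Y - {point x}"
  have "\<exists>a. (\<forall>v\<in>p. lin a v = 0) \<and> lin a x = 1" if "p \<in> ?Y" for p
  proof (rule separating_functional)
    show "vec.subspace p" using that assms(2) by (auto elim!: proj_pointsE)
    show "x \<notin> p" using that assms(2,3) proj_point_eq_span by blast
  qed
  then obtain a where a: "\<And>p. p \<in> ?Y \<Longrightarrow> (\<forall>v\<in>p. lin (a p) v = 0) \<and> lin (a p) x = 1" by metis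
  have "form_fun (\<Sum>p\<in>?Y. 1) (\<lambda>v. \<Prod>p\<in>?Y. lin (a p) v)"
    by (intro form_fun_prod form_fun_lin)
  moreover have "(\<Prod>p\<in>?Y. lin (a p) x) \<noteq> 0" using a assms(1) by simp
  moreover have "(\<Prod>p\<in>?Y. lin (a p) v) = 0" if "p \<in> Y" "p \<noteq> point x" "v \<in> p" for p v
    using that a[of p] assms(1) by (intro prod_zero) auto
  ultimately show ?thesis by blast
qed

text \<open>The cofactors in an ideal membership may be inhomogeneous, so they are differentiated
  monomial by monomial.\<close>

lemma poly_eval_differentiable:
  "\<exists>D. ((\<lambda>t. poly_eval A (v + t *s w)) has_field_derivative D) (at 0)"
proof -
  have "\<exists>D. ((\<lambda>t. mono_eval m (v + t *s w)) has_field_derivative D) (at 0)" for m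
    using form_fun_derivative[OF form_fun_mono_eval] by blast
  then obtain D where D: "\<And>m. ((\<lambda>t. mono_eval m (v + t *s w)) has_field_derivative D m) (at 0)" by metis
  have "((\<lambda>t. \<Sum>m\<in>Poly_Mapping.keys A. Poly_Mapping.lookup A m * mono_eval m (v + t *s w)) has_field_derivative
    (\<Sum>m\<in>Poly_Mapping.keys A. Poly_Mapping.lookup A m * D m)) (at 0)"
    by (intro DERIV_sum DERIV_cmult D)
  then show ?thesis by (auto simp: poly_eval_superset[of "Poly_Mapping.keys A" A])
qed

section \<open>Reducedness of a plane complete intersection of two quartics\<close>

locale plane_ci =
  fixes Y :: "(complex ^ 3) set set" and F G :: "3 cpoly"
  assumes fin: "finite Y" and pts: "Y \<subseteq> proj_points" and ci: "complete_intersection 4 4 Y F G"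
begin

lemma forms: "form_fun 4 (poly_eval F)" "form_fun 4 (poly_eval G)"
  using ci form_fun_poly_eval by (auto simp: complete_intersection_def)

lemma ideal_vanish: "p \<in> Y \<Longrightarrow> v \<in> p \<Longrightarrow> poly_eval F v = 0" "p \<in> Y \<Longrightarrow> v \<in> p \<Longrightarrow> poly_eval G v = 0"
proof -
  have "F = 1 * F + 0 * G" "G = 0 * F + 1 * G" by simp_all
  then have "F \<in> vanishing_ideal Y" "G \<in> vanishing_ideal Y"
    using ci unfolding complete_intersection_def by blast+
  then show "p \<in> Y \<Longrightarrow> v \<in> p \<Longrightarrow> poly_eval F v = 0" "p \<in> Y \<Longrightarrow> v \<in> p \<Longrightarrow> poly_eval G v = 0"
    by (auto simp: vanishing_ideal_def)
qed

lemma ideal_member: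
  assumes "form_fun d f" "\<And>p v. p \<in> Y \<Longrightarrow> v \<in> p \<Longrightarrow> f v = 0"
  obtains A B where "\<And>x. f x = poly_eval A x * poly_eval F x + poly_eval B x * poly_eval G x"
proof -
  obtain H where H: "f = poly_eval H" using form_fun_eq_poly_eval assms(1) by blast
  then have "H \<in> vanishing_ideal Y" using assms(2) by (auto simp: vanishing_ideal_def)
  then obtain A B where "H = A * F + B * G"
    using ci by (auto simp: complete_intersection_def)
  then show ?thesis using that H by (simp add: poly_eval_add poly_eval_mult)
qed

text \<open>Otherwise a form separating \<open>v\<close> from \<open>Y\<close> would lie in the
  ideal and hence vanish at \<open>v\<close>.\<close>

lemma common_zero:
  assumes "v \<noteq> 0" "poly_eval F v = 0" "poly_eval G v = 0"
  shows "point v \<in> Y"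
proof (rule ccontr)
  assume n: "point v \<notin> Y"
  obtain d f where f: "form_fun d f" "f v \<noteq> 0" "\<forall>p\<in>Y. p \<noteq> point v \<longrightarrow> (\<forall>v\<in>p. f v = 0)"
    using separator_form[OF fin pts assms(1)] by blast
  then obtain A B where "\<And>x. f x = poly_eval A x * poly_eval F x + poly_eval B x * poly_eval G x"
    using ideal_member[OF f(1)] n by metis
  then show False using f(2) assms by simp
qed

text \<open>The vanishing ideal contains a form with a simple zero at \<open>v\<close> along the
  line: a separator times a linear form through \<open>v\<close>. Since \<open>F\<close> is zero on
  the line, this form is a multiple of \<open>G\<close> there, so \<open>G\<close> cannot vanish
  doubly.\<close>

lemma transversal:
  assumes v: "v \<noteq> 0" "point v \<in> Y" and w: "indep2 v w"
    and F: "\<And>t. poly_eval F (v + t *s w) = 0"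
    and D: "((\<lambda>t. poly_eval G (v + t *s w)) has_field_derivative D) (at 0)"
  shows "D \<noteq> 0"
proof
  assume "D = 0"
  obtain d f where f: "form_fun d f" "f v \<noteq> 0" "\<forall>p\<in>Y. p \<noteq> point v \<longrightarrow> (\<forall>v\<in>p. f v = 0)"
    using separator_form[OF fin pts v(1)] by blast
  have "w \<notin> point v" using w v(1) indep2_iff by blast
  then obtain m where m: "\<forall>x\<in>point v. lin m x = 0" "lin m w = 1"
    using separating_functional[of "point v" w] by auto
  have "lin m x * f x = 0" if "p \<in> Y" "x \<in> p" for p x
    using f(3) m(1) that by (cases "p = point v") auto
  then obtain A B where AB: "\<And>x. lin m x * f x = poly_eval A x * poly_eval F x + poly_eval B x * poly_eval G x"
    using ideal_member[OF form_fun.mult[OF form_fun_lin f(1)]] by metis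
  have "lin m v = 0" using m(1) by (simp add: vec.span_base)
  then have eq: "t * f (v + t *s w) = poly_eval B (v + t *s w) * poly_eval G (v + t *s w)" for t
    using AB[of "v + t *s w"] F m(2) by (simp add: lin_add lin_scale)
  obtain f' where f': "((\<lambda>t. f (v + t *s w)) has_field_derivative f') (at 0)"
    using form_fun_derivative[OF f(1)] by blast
  obtain B' where B': "((\<lambda>t. poly_eval B (v + t *s w)) has_field_derivative B') (at 0)"
    using poly_eval_differentiable by blast
  \<comment> \<open>The same function is differentiated in two ways: the separator gives
    \<open>f v\<close>, which is nonzero, and the multiple of \<open>G\<close> gives 0.\<close>
  have "((\<lambda>t. t * f (v + t *s w)) has_field_derivative f v) (at 0)"
    using DERIV_mult[OF DERIV_ident f'] by simp
  moreover have "((\<lambda>t. t * f (v + t *s w)) has_field_derivative 0) (at 0)"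
    unfolding eq using DERIV_mult[OF B' D] \<open>D = 0\<close> ideal_vanish(2)[OF v(2), of v]
    by (simp add: vec.span_base)
  ultimately show False using f(2) DERIV_unique by blast
qed

lemma line_not_in_G:
  assumes "proj_line L" "\<And>x. x \<in> L \<Longrightarrow> poly_eval F x = 0"
  shows "\<exists>w\<in>L. poly_eval G w \<noteq> 0"
proof (rule ccontr)
  assume n: "\<not> ?thesis"
  obtain v w where vw: "indep2 v w" "L = vec.span {v, w}" using assms(1) by (rule proj_line_obtain)
  have L: "v + t *s w \<in> L" for t
    unfolding vw(2) by (intro vec.span_add vec.span_scale) (auto intro: vec.span_base)
  have v: "v \<noteq> 0" using vw(1) by (rule indep2_nonzero)
  have Y: "point v \<in> Y" using common_zero[OF v] assms(2) n L[of 0] by simp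
  have "((\<lambda>t. poly_eval G (v + t *s w)) has_field_derivative 0) (at 0)"
    using n L by simp
  then show False using transversal[OF v Y vw(1)] assms(2) L by blast
qed

text \<open>On a line in the curve \<open>F\<close>, the points of \<open>Y\<close> are the zeros of
  \<open>G\<close>. By \<open>transversal\<close> these are simple, so their number is the
  degree.\<close>

lemma card_on_line:
  assumes "proj_line L" "\<And>x. x \<in> L \<Longrightarrow> poly_eval F x = 0"
  shows "card {p \<in> Y. p \<subseteq> L} = 4"
proof -
  obtain w where w: "w \<in> L" "poly_eval G w \<noteq> 0" using line_not_in_G assms by blast
  then have "w \<noteq> 0" using form_fun_at_0[OF forms(2)] by auto
  then obtain u where u: "indep2 u w" "L = vec.span {u, w}"
    using proj_line_extend assms(1) w(1) by blast
  obtain p where p: "p \<noteq> 0" "degree p = 4" "\<forall>t. poly_eval G (u + t *s w) = poly p t"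
    "bij_betw (\<lambda>t. point (u + t *s w)) {t. poly p t = 0} (zero_points (poly_eval G) L)"
    using form_fun_on_proj_line[OF forms(2) u(1) w(2)] u(2) by auto
  have L: "u + t *s w \<in> L" for t
    unfolding u(2) by (intro vec.span_add vec.span_scale) (auto intro: vec.span_base)
  have "poly (pderiv p) t \<noteq> 0" if "poly p t = 0" for t
  proof (rule transversal)
    have i: "s *s (u + t *s w) + r *s w = s *s u + (s * t + r) *s w" for s r
      by (simp add: vec_eq_iff algebra_simps)
    show i: "indep2 (u + t *s w) w"
      using u(1) unfolding indep2_def i by fastforce
    then show ne: "u + t *s w \<noteq> 0" by (rule indep2_nonzero)
    show "point (u + t *s w) \<in> Y"
      using common_zero[OF ne] assms(2) L p(3) that by simp
    have s: "u + t *s w + s *s w = u + (t + s) *s w" for s by (simp add: vec_eq_iff algebra_simps)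
    show "poly_eval F (u + t *s w + s *s w) = 0" for s unfolding s using assms(2) L by blast
    have "((\<lambda>s. poly p (t + s)) has_field_derivative poly (pderiv p) t * 1) (at 0)"
      by (rule DERIV_chain2[of "poly p"]) (auto intro!: derivative_eq_intros poly_DERIV)
    then show "((\<lambda>s. poly_eval G (u + t *s w + s *s w)) has_field_derivative poly (pderiv p) t) (at 0)"
      unfolding s p(3)[rule_format] by simp
  qed
  then have "card {t. poly p t = 0} = 4" using card_simple_roots p(2) by metis
  then have "card (zero_points (poly_eval G) L) = 4" using bij_betw_same_card[OF p(4)] by simp
  also have "zero_points (poly_eval G) L = {p \<in> Y. p \<subseteq> L}"
  proof (intro equalityI subsetI)
    fix z assume "z \<in> zero_points (poly_eval G) L"
    then obtain x where x: "x \<in> L" "x \<noteq> 0" "poly_eval G x = 0" "z = point x"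
      by (auto simp: zero_points_def)
    then have "z \<in> Y" using common_zero assms(2) by blast
    moreover have "z \<subseteq> L"
      unfolding x(4) using x(1) assms(1) by (intro vec.span_minimal) (auto simp: proj_line_def)
    ultimately show "z \<in> {p \<in> Y. p \<subseteq> L}" by blast
  next
    fix z assume z: "z \<in> {p \<in> Y. p \<subseteq> L}"
    then obtain x where x: "x \<noteq> 0" "z = point x" using pts by (auto elim!: proj_pointsE)
    then have "x \<in> z" by (simp add: vec.span_base)
    then show "z \<in> zero_points (poly_eval G) L"
      using x z ideal_vanish(2) unfolding zero_points_def by blast
  qed
  finally show ?thesis .
qed

text \<open>A further component of \<open>F\<close> through \<open>v\<close> would make
  \<open>F\<close> singular there. The ideal would then contain no form with nonzero derivative at
  \<open>v\<close> that vanishes on the line, but \<open>lin a\<close> times a separator is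
  one.\<close>

lemma simple_on_line:
  assumes F: "\<And>x. poly_eval F x = lin a x * H x" and H: "form_fun d H" and a: "a \<noteq> 0"
    and v: "v \<noteq> 0" "point v \<in> Y" "lin a v = 0"
  shows "H v \<noteq> 0"
proof
  assume Hv: "H v = 0"
  obtain w where "indep2 w v" "{x. lin a x = 0} = vec.span {w, v}"
    using proj_line_extend[OF kernel_proj_line[OF a]] v by blast
  then have w: "indep2 v w" "lin a w = 0" using indep2_commute vec.span_base by blast+
  obtain e where e: "lin a e = 1" using lin_nonzero a by blast
  obtain k f where f: "form_fun k f" "f v \<noteq> 0" "\<forall>p\<in>Y. p \<noteq> point v \<longrightarrow> (\<forall>v\<in>p. f v = 0)"
    using separator_form[OF fin pts v(1)] by blast
  have "lin a x * f x = 0" if "p \<in> Y" "x \<in> p" for p x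
    using f(3) v(3) that by (cases "p = point v") (auto simp: vec.span_singleton lin_scale)
  then obtain A B where AB: "\<And>x. lin a x * f x = poly_eval A x * poly_eval F x + poly_eval B x * poly_eval G x"
    using ideal_member[OF form_fun.mult[OF form_fun_lin f(1)]] by metis
  have Gv: "poly_eval G v = 0" using ideal_vanish(2)[OF v(2), of v] by (simp add: vec.span_base)
  obtain B1 where B1: "((\<lambda>t. poly_eval B (v + t *s w)) has_field_derivative B1) (at 0)"
    using poly_eval_differentiable by blast
  obtain G1 where G1: "((\<lambda>t. poly_eval G (v + t *s w)) has_field_derivative G1) (at 0)"
    using poly_eval_differentiable by blast
  \<comment> \<open>On the line \<open>lin a = 0\<close> the membership relation becomes
    \<open>0 = B G\<close>. The zero of \<open>G\<close> at \<open>v\<close> is simple in this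
    direction, so \<open>B\<close> vanishes at \<open>v\<close>; the rest of the proof
    differentiates in the direction \<open>e\<close> leaving the line.\<close>
  have "0 = poly_eval B (v + t *s w) * poly_eval G (v + t *s w)" for t
    using AB[of "v + t *s w"] v(3) w(2) by (simp add: F lin_add lin_scale)
  note zero = this[symmetric]
  have "((\<lambda>t. 0) has_field_derivative poly_eval B v * G1) (at 0)"
    using DERIV_mult[OF B1 G1] unfolding zero using Gv by (simp add: mult.commute)
  then have "poly_eval B v * G1 = 0" by (metis DERIV_const DERIV_unique)
  moreover have "G1 \<noteq> 0"
    using transversal[OF v(1,2) w(1) _ G1] v(3) w(2) by (simp add: F lin_add lin_scale)
  ultimately have Bv: "poly_eval B v = 0" by simp
  have eq: "t * f (v + t *s e) = t * (poly_eval A (v + t *s e) * H (v + t *s e))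
      + poly_eval B (v + t *s e) * poly_eval G (v + t *s e)" for t
    using AB[of "v + t *s e"] v(3) e by (simp add: F lin_add lin_scale)
  obtain f' where f': "((\<lambda>t. f (v + t *s e)) has_field_derivative f') (at 0)"
    using form_fun_derivative[OF f(1)] by blast
  obtain H' where H': "((\<lambda>t. H (v + t *s e)) has_field_derivative H') (at 0)"
    using form_fun_derivative[OF H] by blast
  obtain A' where A': "((\<lambda>t. poly_eval A (v + t *s e)) has_field_derivative A') (at 0)"
    using poly_eval_differentiable by blast
  obtain B' where B': "((\<lambda>t. poly_eval B (v + t *s e)) has_field_derivative B') (at 0)"
    using poly_eval_differentiable by blast
  obtain G' where G': "((\<lambda>t. poly_eval G (v + t *s e)) has_field_derivative G') (at 0)"
    using poly_eval_differentiable by blast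
  have "((\<lambda>t. t * f (v + t *s e)) has_field_derivative f v) (at 0)"
    using DERIV_mult[OF DERIV_ident f'] by simp
  moreover have "((\<lambda>t. t * f (v + t *s e)) has_field_derivative 0) (at 0)"
    unfolding eq
    using DERIV_add[OF DERIV_mult[OF DERIV_ident DERIV_mult[OF A' H']] DERIV_mult[OF B' G']] Hv Bv Gv by simp
  ultimately show False using f(2) DERIV_unique by blast
qed

lemma lines:
  assumes "union_of_lines F"
  shows "\<exists>a :: nat \<Rightarrow> complex ^ 3.
    (\<forall>i<4. a i \<noteq> 0 \<and> card {p \<in> Y. p \<subseteq> {x. lin (a i) x = 0}} = 4) \<and>
    (\<forall>p\<in>Y. \<exists>i<4. p \<subseteq> {x. lin (a i) x = 0}) \<and>
    (\<forall>p\<in>Y. \<forall>i<4. \<forall>j<4. p \<subseteq> {x. lin (a i) x = 0} \<longrightarrow> p \<subseteq> {x. lin (a j) x = 0} \<longrightarrow> i = j)"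
proof -
  obtain n :: nat and l where l: "\<And>i. i < n \<Longrightarrow> form 1 (l i)" and Fl: "F = (\<Prod>i<n. l i)"
    using assms unfolding union_of_lines_def by blast
  have "\<exists>a. poly_eval (l i) = lin a" if "i < n" for i
    using form_fun_1_lin[OF form_fun_poly_eval[OF l[OF that]]] by simp
  then obtain a where a: "\<And>i. i < n \<Longrightarrow> poly_eval (l i) = lin (a i)" by metis
  have F: "poly_eval F x = (\<Prod>i<n. lin (a i) x)" for x
    unfolding Fl poly_eval_prod using a by simp
  have "F \<noteq> 0" using ci by (auto simp: complete_intersection_def form_def)
  then obtain v where v: "poly_eval F v \<noteq> 0" using poly_eval_nonzero by blast
  have "form_fun n (poly_eval F)"
    using form_fun_prod[of "{..<n}" "\<lambda>_. 1" "\<lambda>i. lin (a i)", OF form_fun_lin]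
    by (simp add: F[abs_def])
  \<comment> \<open>The number of linear factors is found by comparing the two degrees under scaling
    by 2.\<close>
  then have "2 ^ n * poly_eval F v = 2 ^ 4 * poly_eval F v"
    using form_fun_scale[of _ "poly_eval F" 2 v] forms(1) by metis
  then have "(2 :: complex) ^ n = 2 ^ 4" using v by simp
  then have "cmod (2 ^ n) = cmod (2 ^ 4)" by simp
  then have "(2 :: real) ^ n = 2 ^ 4" by (simp add: norm_power)
  then have n: "n = 4" by (rule power_inject_exp[THEN iffD1, rotated]) simp
  have a0: "a i \<noteq> 0" if "i < 4" for i
  proof
    assume "a i = 0"
    then have "lin (a i) v = 0" by (simp add: lin_def)
    then have "poly_eval F v = 0" unfolding F using that n by (intro prod_zero) auto
    then show False using v by simp
  qed
  define H where "H i x = (\<Prod>j\<in>{..<4} - {i}. lin (a j) x)" for i x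
  have FH: "poly_eval F x = lin (a i) x * H i x" if "i < 4" for i x
    unfolding F H_def n using that by (subst prod.remove[of _ i]) auto
  have Hf: "form_fun (\<Sum>j\<in>{..<4} - {i}. 1) (H i)" for i
    unfolding H_def[abs_def] by (intro form_fun_prod form_fun_lin)
  have 1: "card {p \<in> Y. p \<subseteq> {x. lin (a i) x = 0}} = 4" if "i < 4" for i
    using card_on_line[OF kernel_proj_line[OF a0[OF that]]] FH[OF that] by simp
  have 2: "\<exists>i<4. p \<subseteq> {x. lin (a i) x = 0}" if p: "p \<in> Y" for p
  proof -
    obtain x where x: "p = point x" using p pts by (auto elim!: proj_pointsE)
    then have "poly_eval F x = 0" using ideal_vanish(1)[OF p] by (simp add: vec.span_base)
    then obtain i where "i < 4" "lin (a i) x = 0" unfolding F n by auto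
    then show ?thesis unfolding x by (intro exI[of _ i]) (auto simp: vec.span_singleton lin_scale)
  qed
  have 3: "i = j" if p: "p \<in> Y" "p \<subseteq> {x. lin (a i) x = 0}" "p \<subseteq> {x. lin (a j) x = 0}" and ij: "i < 4" "j < 4" for p i j
  proof (rule ccontr)
    assume "i \<noteq> j"
    obtain x where x: "p = point x" "x \<noteq> 0" using p pts by (auto elim!: proj_pointsE)
    then have "x \<in> p" by (simp add: vec.span_base)
    then have z: "lin (a i) x = 0" "lin (a j) x = 0" using p by auto
    then have "H i x = 0" unfolding H_def using ij \<open>i \<noteq> j\<close> by (intro prod_zero) auto
    then show False using simple_on_line[OF FH[OF ij(1)] Hf a0[OF ij(1)] x(2)] p(1) x(1) z(1) by blast
  qed
  show ?thesis by (intro exI[of _ a]) (use a0 1 2 3 in blast)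
qed

end

section \<open>Lifting the lines from a general projection\<close>

lemma matrix_line_image:
  fixes A :: "complex ^ 'n ^ 'm"
  shows "(\<lambda>v. A *v v) ` point x = point (A *v x)"
  by (auto simp: vec.span_singleton image_image vector_scalar_commute)

lemma matrix_vector_mult_combination:
  fixes A :: "complex ^ 'n ^ 'm"
  shows "A *v (s *s x + t *s y) = s *s (A *v x) + t *s (A *v y)"
  by (simp add: matrix_vector_right_distrib vector_scalar_commute)

lemma vector_4:
  "(vector [x, y, z, w] :: 'a::zero ^ 4) $ 1 = x" "(vector [x, y, z, w] :: 'a ^ 4) $ 2 = y"
  "(vector [x, y, z, w] :: 'a ^ 4) $ 3 = z" "(vector [x, y, z, w] :: 'a ^ 4) $ 4 = w"
  by (simp_all add: vector_def)

text \<open>The rows are the minors of \<open>v\<close> against \<open>P\<close> that involve the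
  first coordinate. A nonzero first coordinate is itself a generic condition.\<close>

lemma projection_matrix_exists:
  fixes P :: "complex ^ 4"
  assumes "P $ 1 \<noteq> 0"
  shows "\<exists>A :: complex ^ 4 ^ 3. {v. A *v v = 0} = point P"
proof -
  define A :: "complex ^ 4 ^ 3" where "A = vector [vector [P $ 2, - P $ 1, 0, 0],
    vector [P $ 3, 0, - P $ 1, 0], vector [P $ 4, 0, 0, - P $ 1]]"
  have A: "A *v v = 0 \<longleftrightarrow> P $ 2 * v $ 1 = P $ 1 * v $ 2 \<and> P $ 3 * v $ 1 = P $ 1 * v $ 3
      \<and> P $ 4 * v $ 1 = P $ 1 * v $ 4" for v
    by (simp add: A_def vec_eq_iff forall_3 matrix_vector_mult_def sum_4 vector_4)
  have "A *v v = 0 \<longleftrightarrow> (\<exists>c. v = c *s P)" for v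
  proof
    assume "A *v v = 0"
    then have "v = (v $ 1 / P $ 1) *s P"
      unfolding A using assms by (simp add: vec_eq_iff forall_4 field_simps)
    then show "\<exists>c. v = c *s P" by blast
  next
    assume "\<exists>c. v = c *s P"
    then show "A *v v = 0" unfolding A by (auto simp: mult_ac)
  qed
  then show ?thesis by (intro exI[of _ A]) (auto simp: vec.span_singleton)
qed

lemma complete_intersection_commute:
  "complete_intersection a b Y F G \<Longrightarrow> complete_intersection b a Y G F"
  unfolding complete_intersection_def by (auto; metis add.commute)

lemma line_through_points:
  assumes "proj_line L" "x \<in> L" "y \<in> L" "indep2 x y"
  shows "L = vec.span {x, y}"
proof -
  have "vec.span {x, y} \<subseteq> L" using assms by (intro vec.span_minimal) (auto simp: proj_line_def)
  moreover have "vec.dim (vec.span {x, y}) = vec.dim L"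
    using proj_line_span[OF assms(4)] assms(1) by (simp add: proj_line_def)
  ultimately show ?thesis
    using assms(1) by (intro vec.subspace_dim_equal[symmetric]) (auto simp: proj_line_def)
qed

lemma two_points:
  assumes "S \<subseteq> proj_points" "2 \<le> card S"
  obtains x y :: "complex ^ 'n" where "indep2 x y" "point x \<in> S" "point y \<in> S"
proof -
  have "\<not> card S \<le> Suc 0" "finite S" using assms(2) by (auto intro: card_ge_0_finite)
  then obtain p q where pq: "p \<in> S" "q \<in> S" "p \<noteq> q" using card_le_Suc0_iff_eq by blast
  obtain x where x: "x \<noteq> 0" "p = point x" using pq assms(1) by (auto elim!: proj_pointsE)
  obtain y where y: "y \<noteq> 0" "q = point y" using pq assms(1) by (auto elim!: proj_pointsE)
  show ?thesis using that[of x y] indep2_span_ne[OF x(1) y(1)] x y pq by simp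
qed

lemma two_points_on_line:
  assumes "Z \<subseteq> proj_points" "proj_line L" "2 \<le> card {p \<in> Z. p \<subseteq> L}"
  obtains x y where "indep2 x y" "L = vec.span {x, y}" "point x \<in> Z" "point y \<in> Z"
proof -
  have "{p \<in> Z. p \<subseteq> L} \<subseteq> proj_points" using assms(1) by blast
  then obtain x y where xy: "indep2 x y" "point x \<in> {p \<in> Z. p \<subseteq> L}" "point y \<in> {p \<in> Z. p \<subseteq> L}"
    using two_points assms(3) by blast
  then have "x \<in> L" "y \<in> L" by (auto intro: vec.span_base)
  then have "L = vec.span {x, y}" using line_through_points[OF assms(2) _ _ xy(1)] by blast
  then show ?thesis using that xy by blast
qed

text \<open>The points \<open>p\<close>, \<open>q\<close>, \<open>r\<close> in
  \<open>general\<close> may coincide, so \<open>P\<close> also avoids the points of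
  \<open>Z\<close> and the lines joining two of them.\<close>

locale projection =
  fixes Z :: "(complex ^ 4) set set" and P :: "complex ^ 4" and A :: "complex ^ 4 ^ 3" and F G :: "3 cpoly"
  assumes Z_fin: "finite Z" and Z_pts: "Z \<subseteq> proj_points"
    and ker: "{v. A *v v = 0} = point P"
    and ci: "complete_intersection 4 4 (proj_image A Z) F G"
    and ul: "union_of_lines F"
    and general: "\<And>p q r. p \<in> Z \<Longrightarrow> q \<in> Z \<Longrightarrow> r \<in> Z \<Longrightarrow> P \<notin> vec.span (p \<union> q \<union> r)"
begin

lemma P_not_in_span:
  assumes "point x \<in> Z" "point y \<in> Z" "point z \<in> Z"
  shows "P \<notin> vec.span {x, y, z}"
proof -
  have "vec.span {x, y, z} \<subseteq> vec.span (point x \<union> point y \<union> point z)"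
    by (intro vec.span_mono) (auto intro: vec.span_base)
  then show ?thesis using general[OF assms] by blast
qed

lemma image_eqD:
  assumes "A *v x = c *s (A *v y)" "P \<notin> vec.span {x, y}"
  shows "x = c *s y"
proof -
  have "A *v (1 *s x + (- c) *s y) = 0"
    unfolding matrix_vector_mult_combination using assms(1) by simp
  then have "x - c *s y \<in> point P" using ker by auto
  then obtain k where k: "x - c *s y = k *s P" by (auto simp: vec.span_singleton)
  have "k = 0"
  proof (rule ccontr)
    assume "k \<noteq> 0"
    then have "P = inverse k *s (x - c *s y)" unfolding k by simp
    moreover have "inverse k *s (x - c *s y) \<in> vec.span {x, y}"
      by (intro vec.span_scale vec.span_diff) (auto intro: vec.span_base)
    ultimately show False using assms(2) by simp
  qed
  then show ?thesis using k by simp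
qed

lemma image_nonzero:
  assumes "A *v x = 0" "P \<notin> point x"
  shows "x = 0"
  using image_eqD[of x 0 x] assms by simp

lemma image_points: "proj_image A Z \<subseteq> proj_points"
proof
  fix y assume "y \<in> proj_image A Z"
  then obtain p where p: "p \<in> Z" "y = (\<lambda>v. A *v v) ` p" by (auto simp: proj_image_def)
  then obtain x where x: "x \<noteq> 0" "p = point x" using Z_pts by (auto elim!: proj_pointsE)
  then have "A *v x \<noteq> 0" using image_nonzero[of x] P_not_in_span[of x x x] p(1) by auto
  moreover have "y = point (A *v x)" unfolding p x by (rule matrix_line_image)
  ultimately show "y \<in> proj_points" by (auto simp: proj_points_def)
qed

lemma image_inj: "inj_on (\<lambda>p. (\<lambda>v. A *v v) ` p) Z"
proof (rule inj_onI)
  fix p q assume pq: "p \<in> Z" "q \<in> Z" "(\<lambda>v. A *v v) ` p = (\<lambda>v. A *v v) ` q"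
  obtain x where x: "x \<noteq> 0" "p = point x" using pq Z_pts by (auto elim!: proj_pointsE)
  obtain y where y: "y \<noteq> 0" "q = point y" using pq Z_pts by (auto elim!: proj_pointsE)
  have "point (A *v x) = point (A *v y)"
    using pq(3) unfolding x y matrix_line_image .
  then have "A *v x \<in> point (A *v y)" by (metis singletonI vec.span_base)
  then obtain c where c: "A *v x = c *s (A *v y)" by (auto simp: vec.span_singleton)
  then have "x = c *s y" using image_eqD P_not_in_span[of x y y] pq x y by simp
  then show "p = q" using x y span_scale_eq[of c y] by auto
qed

sublocale plane_ci "proj_image A Z" F G
proof
  show "finite (proj_image A Z)" using Z_fin by (simp add: proj_image_def)
qed (rule image_points, rule ci)

lemma lifted_lines:
  "\<exists>L. (\<forall>i<4. proj_line (L i) \<and> card {p \<in> Z. p \<subseteq> L i} = 4) \<and> (\<forall>p\<in>Z. \<exists>i<4::nat. p \<subseteq> L i) \<and>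
    (\<forall>p\<in>Z. \<forall>i<4. \<forall>j<4. p \<subseteq> L i \<longrightarrow> p \<subseteq> L j \<longrightarrow> i = j)"
proof -
  from lines[OF ul] obtain a :: "nat \<Rightarrow> complex ^ 3" where
    a: "\<forall>i<4. a i \<noteq> 0 \<and> card {p \<in> proj_image A Z. p \<subseteq> {x. lin (a i) x = 0}} = 4"
      "\<forall>p\<in>proj_image A Z. \<exists>i<4. p \<subseteq> {x. lin (a i) x = 0}"
      "\<forall>p\<in>proj_image A Z. \<forall>i<4. \<forall>j<4. p \<subseteq> {x. lin (a i) x = 0} \<longrightarrow> p \<subseteq> {x. lin (a j) x = 0} \<longrightarrow> i = j"
    by (elim exE conjE)
  have "\<exists>b. (\<lambda>x. lin (a i) (A *v x)) = lin b" for i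
    using form_fun_1_lin[OF form_fun_compose[OF form_fun_lin]] by blast
  then obtain b where "\<And>i. (\<lambda>x. lin (a i) (A *v x)) = lin (b i)" by metis
  then have b: "lin (a i) (A *v x) = lin (b i) x" for i x by (rule fun_cong)
  define K where "K i = {x. lin (b i) x = 0}" for i
  have sub: "(\<lambda>v. A *v v) ` p \<subseteq> {x. lin (a i) x = 0} \<longleftrightarrow> p \<subseteq> K i" for p i
    by (auto simp: K_def b)
  have card: "card {p \<in> Z. p \<subseteq> K i} = 4" if "i < 4" for i
  proof -
    have "{p \<in> proj_image A Z. p \<subseteq> {x. lin (a i) x = 0}} = (\<lambda>p. (\<lambda>v. A *v v) ` p) ` {p \<in> Z. p \<subseteq> K i}"
      unfolding proj_image_def sub[symmetric] by blast
    moreover have "inj_on (\<lambda>p. (\<lambda>v. A *v v) ` p) {p \<in> Z. p \<subseteq> K i}"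
      using image_inj by (rule inj_on_subset) auto
    ultimately show ?thesis using a(1)[rule_format, OF that] by (simp add: card_image)
  qed
  have cover: "\<exists>i<4. p \<subseteq> K i" if "p \<in> Z" for p
    using bspec[OF a(2), of "(\<lambda>v. A *v v) ` p"] that unfolding sub proj_image_def by blast
  have unique: "i = j" if "p \<in> Z" "i < 4" "j < 4" "p \<subseteq> K i" "p \<subseteq> K j" for p i j
    using bspec[OF a(3), of "(\<lambda>v. A *v v) ` p"] that unfolding sub proj_image_def by blast
  have P: "P \<in> K i" for i
  proof -
    have "A *v P = 0" using ker by (auto intro: vec.span_base)
    then show ?thesis by (simp add: K_def b[symmetric])
  qed
  \<comment> \<open>A zero functional would put all of \<open>Z\<close> on the \<open>i\<close>-th
    line, although the points of another line lie on that one only.\<close>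
  have b0: "b i \<noteq> 0" if "i < 4" for i
  proof
    assume "b i = 0"
    then have K: "K i = UNIV" by (auto simp: K_def lin_def)
    define j :: nat where "j = (if i = 0 then 1 else 0)"
    have j: "j < 4" "j \<noteq> i" by (auto simp: j_def)
    have "{p \<in> Z. p \<subseteq> K j} \<noteq> {}" using card[OF j(1)] by (metis card.empty zero_neq_numeral)
    then show False using unique[OF _ that j(1)] K j(2) by auto
  qed
  have "\<exists>L. proj_line L \<and> {p \<in> Z. p \<subseteq> L} = {p \<in> Z. p \<subseteq> K i}" if i: "i < 4" for i
  proof -
    have "{p \<in> Z. p \<subseteq> K i} \<subseteq> proj_points" using Z_pts by blast
    then obtain x y where xy: "indep2 x y" "point x \<in> {p \<in> Z. p \<subseteq> K i}" "point y \<in> {p \<in> Z. p \<subseteq> K i}"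
      by (rule two_points) (use card[OF i] in simp_all)
    then have xyK: "x \<in> K i" "y \<in> K i" by (auto intro: vec.span_base)
    have sK: "vec.subspace (K i)" unfolding K_def by (rule kernel_subspace)
    \<comment> \<open>A third point off the line \<open>x y\<close> would span with it a plane
      missing \<open>P\<close>; together with \<open>P\<close> this gives four independent vectors
      in the three-dimensional \<open>K i\<close>.\<close>
    have "r \<subseteq> vec.span {x, y}" if r: "r \<in> Z" "r \<subseteq> K i" for r
    proof (rule ccontr)
      assume nr: "\<not> r \<subseteq> vec.span {x, y}"
      obtain z where z: "z \<noteq> 0" "r = point z" using r Z_pts by (auto elim!: proj_pointsE)
      have zK: "z \<in> K i" using r z by (auto intro: vec.span_base)
      have "z \<notin> vec.span {x, y}"
        using nr vec.span_minimal[of "{z}" "vec.span {x, y}"] unfolding z by auto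
      then have z': "z \<notin> {x, y}" "vec.independent {z, x, y}"
        using indep2_independent[OF xy(1)] vec.span_superset[of "{x, y}"]
        by (blast, simp add: vec.independent_insert)
      have P': "P \<notin> vec.span {z, x, y}" using P_not_in_span[of z x y] xy r z by simp
      then have "P \<notin> {z, x, y}" using vec.span_superset[of "{z, x, y}"] by blast
      then have "vec.independent {P, z, x, y}" "card {P, z, x, y} = 4"
        using z' P' indep2_independent[OF xy(1)] by (simp_all add: vec.independent_insert)
      moreover have "{P, z, x, y} \<subseteq> K i" using P zK xyK by simp
      ultimately have "4 \<le> vec.dim (K i)" using vec.independent_card_le_dim by metis
      then show False using kernel_dim[OF b0[OF i]] by (simp add: K_def)
    qed
    moreover have "vec.span {x, y} \<subseteq> K i" using xyK sK by (intro vec.span_minimal) auto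
    ultimately have "{p \<in> Z. p \<subseteq> vec.span {x, y}} = {p \<in> Z. p \<subseteq> K i}" by blast
    then show ?thesis using proj_line_span[OF xy(1)] by blast
  qed
  then have "\<forall>i\<in>{..<4}. \<exists>L. proj_line L \<and> {p \<in> Z. p \<subseteq> L} = {p \<in> Z. p \<subseteq> K i}" by simp
  from bchoice[OF this] obtain L where
    L: "\<forall>i\<in>{..<4}. proj_line (L i) \<and> {p \<in> Z. p \<subseteq> L i} = {p \<in> Z. p \<subseteq> K i}" ..
  have LK: "p \<subseteq> L i \<longleftrightarrow> p \<subseteq> K i" if "i < 4" "p \<in> Z" for p i using bspec[OF L, of i] that by blast
  have "\<forall>i<4. proj_line (L i) \<and> card {p \<in> Z. p \<subseteq> L i} = 4" using L card by simp
  moreover have "\<forall>p\<in>Z. \<exists>i<4. p \<subseteq> L i"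
  proof
    fix p assume p: "p \<in> Z"
    obtain i where "i < 4" "p \<subseteq> K i" using cover[OF p] by (elim exE conjE)
    then show "\<exists>i<4. p \<subseteq> L i" using LK[OF _ p] by (intro exI[of _ i]) simp
  qed
  moreover have "\<forall>p\<in>Z. \<forall>i<4. \<forall>j<4. p \<subseteq> L i \<longrightarrow> p \<subseteq> L j \<longrightarrow> i = j"
    by (intro ballI allI impI) (rule unique, simp_all add: LK)
  ultimately show ?thesis by blast
qed

text \<open>If both pulled-back quartics vanished on the line, its infinitely many image points
  would all belong to the finite projected set.\<close>

lemma point_outside_zeros:
  assumes "point x \<in> Z" "point y \<in> Z" "indep2 x y"
  shows "\<exists>v\<in>vec.span {x, y}. poly_eval F (A *v v) \<noteq> 0 \<or> poly_eval G (A *v v) \<noteq> 0"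
proof (rule ccontr)
  assume n: "\<not> ?thesis"
  have P: "P \<notin> vec.span {x, y}" using P_not_in_span[of x y y] assms by simp
  have s: "x + t *s y \<in> vec.span {x, y}" for t
    by (intro vec.span_add vec.span_scale) (auto intro: vec.span_base)
  have ne: "A *v (x + t *s y) \<noteq> 0" for t
  proof
    assume "A *v (x + t *s y) = 0"
    moreover have "P \<notin> point (x + t *s y)"
      using P vec.span_minimal[of "{x + t *s y}" "vec.span {x, y}"] s by auto
    ultimately show False using image_nonzero[of "x + t *s y"] indep2_add_nonzero[OF assms(3)] by blast
  qed
  have "inj (\<lambda>t. point (A *v (x + t *s y)))"
  proof (rule injI)
    fix s t assume "point (A *v (x + s *s y)) = point (A *v (x + t *s y))"
    then obtain c where "A *v (x + s *s y) = c *s (A *v (x + t *s y))"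
      using span_eq_iff[OF ne] by blast
    moreover have "P \<notin> vec.span {x + s *s y, x + t *s y}"
      using P vec.span_minimal[of "{x + s *s y, x + t *s y}" "vec.span {x, y}"] s by auto
    ultimately show "s = t" by (intro indep2_line_inj[OF assms(3)] image_eqD)
  qed
  moreover have "range (\<lambda>t. point (A *v (x + t *s y))) \<subseteq> proj_image A Z"
    using common_zero[OF ne] n s by blast
  ultimately have "finite (UNIV :: complex set)"
    using finite_imageD finite_subset[OF _ fin] by blast
  then show False using infinite_UNIV_char_0 by blast
qed

text \<open>\<open>F\<close> pulled back is a union of planes and may contain some of the lines, so
  a general member of the pencil spanned by \<open>F\<close> and \<open>G\<close> is taken.\<close>

lemma quartic_cone:
  assumes L: "\<And>i. i < 4 \<Longrightarrow> proj_line (L i) \<and> card {p \<in> Z. p \<subseteq> L i} = 4"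
  shows "\<exists>q. form_fun 4 q \<and> (\<forall>x c. q (x + c *s P) = q x) \<and> (\<forall>p\<in>Z. \<forall>x\<in>p. q x = 0) \<and>
    (\<forall>i<4::nat. \<exists>x\<in>L i. q x \<noteq> 0)"
proof -
  have "\<exists>v\<in>L i. poly_eval F (A *v v) \<noteq> 0 \<or> poly_eval G (A *v v) \<noteq> 0" if i: "i < 4" for i
  proof -
    obtain x y where "indep2 x y" "L i = vec.span {x, y}" "point x \<in> Z" "point y \<in> Z"
      by (rule two_points_on_line[OF Z_pts, of "L i"]) (use L[OF i] in simp_all)
    then show ?thesis using point_outside_zeros by simp
  qed
  then obtain v where v: "\<And>i. i < 4 \<Longrightarrow> v i \<in> L i"
    "\<And>i. i < 4 \<Longrightarrow> poly_eval F (A *v v i) \<noteq> 0 \<or> poly_eval G (A *v v i) \<noteq> 0" by metis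
  \<comment> \<open>At \<open>v i\<close> the two quartics do not both vanish, so each line rules
    out at most one value of \<open>c\<close>.\<close>
  have "finite {c. poly_eval F (A *v v i) + c * poly_eval G (A *v v i) = 0}" if "i < 4" for i
  proof (cases "poly_eval G (A *v v i) = 0")
    case True
    then show ?thesis using v(2)[OF that] by simp
  next
    case False
    then have "{c. poly_eval F (A *v v i) + c * poly_eval G (A *v v i) = 0}
        \<subseteq> {- poly_eval F (A *v v i) / poly_eval G (A *v v i)}"
      by (auto simp: field_simps add_eq_0_iff)
    then show ?thesis by (rule finite_subset) simp
  qed
  then have "finite (\<Union>i<4. {c. poly_eval F (A *v v i) + c * poly_eval G (A *v v i) = 0})" by blast
  then obtain c where c: "c \<notin> (\<Union>i<4. {c. poly_eval F (A *v v i) + c * poly_eval G (A *v v i) = 0})"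
    using ex_new_if_finite infinite_UNIV_char_0 by blast
  define q where "q x = poly_eval F (A *v x) + c * poly_eval G (A *v x)" for x
  have "A *v P = 0" using ker by (auto intro: vec.span_base)
  then have inv: "A *v (x + k *s P) = A *v x" for x k
    using matrix_vector_mult_combination[of A 1 x k P] by simp
  have "form_fun 4 q"
    unfolding q_def[abs_def] by (intro form_fun.add form_fun_cmult form_fun_compose forms)
  moreover have "q (x + k *s P) = q x" for x k by (simp add: q_def inv)
  moreover have "q x = 0" if "p \<in> Z" "x \<in> p" for p x
    using ideal_vanish[of "(\<lambda>v. A *v v) ` p" "A *v x"] that by (auto simp: q_def proj_image_def)
  moreover have "q (v i) \<noteq> 0" if "i < 4" for i using c that by (auto simp: q_def)
  ultimately show ?thesis using v(1) by (intro exI[of _ q]) blast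
qed

end


text \<open>Matching the values at one point \<open>w\<close> gives the difference
  \<open>q - c f\<close> one zero more than its degree permits.\<close>

lemma proportional_on_line:
  assumes f: "form_fun d f" and q: "form_fun d q" and L: "proj_line L" and d: "d > 0"
    and card: "card (zero_points f L) = d" and sub: "zero_points f L \<subseteq> zero_points q L"
    and nz: "\<exists>x\<in>L. f x \<noteq> 0" "\<exists>x\<in>L. q x \<noteq> 0"
  shows "\<exists>c. c \<noteq> 0 \<and> (\<forall>x\<in>L. q x = c * f x)"
proof -
  obtain w where w: "w \<in> L" "f w \<noteq> 0" using nz(1) by blast
  have w0: "w \<noteq> 0" using form_fun_at_0[OF f d] w(2) by auto
  define c where "c = q w / f w"
  define k where "k x = q x - c * f x" for x
  have k: "form_fun d k" unfolding k_def[abs_def] by (intro form_fun_diff form_fun_cmult f q)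
  have "k y = 0" if y: "y \<in> L" for y
  proof (rule ccontr)
    assume ky: "k y \<noteq> 0"
    have "zero_points f L \<subseteq> zero_points k L"
    proof
      fix p assume p: "p \<in> zero_points f L"
      then obtain x where x: "p = point x" "x \<in> L" "x \<noteq> 0" "f x = 0" by (auto simp: zero_points_def)
      obtain y where y: "p = point y" "y \<noteq> 0" "q y = 0" using p sub by (auto simp: zero_points_def)
      then obtain a where "x = a *s y" using x(1) span_eq_iff[OF y(2), of x] by auto
      then have "q x = 0" using form_fun_scale[OF q, of a y] y(3) by simp
      then show "p \<in> zero_points k L" using x by (auto simp: zero_points_def k_def)
    qed
    moreover have "point w \<in> zero_points k L"
      using w w0 by (auto simp: zero_points_def k_def c_def)
    ultimately have "insert (point w) (zero_points f L) \<subseteq> zero_points k L" by blast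
    then have "card (insert (point w) (zero_points f L)) \<le> d"
      using order_trans[OF card_mono[OF zero_points_bound(1)[OF k L y ky d]] zero_points_bound(2)[OF k L y ky d]]
      by blast
    moreover have "point w \<notin> zero_points f L"
    proof
      assume "point w \<in> zero_points f L"
      then obtain x where x: "point w = point x" "x \<noteq> 0" "f x = 0" by (auto simp: zero_points_def)
      then obtain a where "w = a *s x" using span_eq_iff[OF x(2), of w] by auto
      then show False using form_fun_scale[OF f, of a x] x(3) w(2) by simp
    qed
    moreover have "finite (zero_points f L)" by (rule card_ge_0_finite) (simp add: card d)
    ultimately show False using card by simp
  qed
  then have eq: "q x = c * f x" if "x \<in> L" for x using that by (simp add: k_def)
  moreover have "c \<noteq> 0" using eq nz(2) by auto
  ultimately show ?thesis by blast
qed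

text \<open>All that is retained of the half grid: \<open>Z\<close> appears only as the zeros of
  \<open>f\<close> on the lines. \<open>common\<close> expresses that no point of \<open>Z\<close>
  lies on two lines, and it is what equates the scalars of intersecting lines.\<close>

locale quartic_lines =
  fixes f :: "complex ^ 4 \<Rightarrow> complex" and L :: "nat \<Rightarrow> (complex ^ 4) set"
  assumes form: "form_fun 4 f"
    and line: "i < 4 \<Longrightarrow> proj_line (L i)"
    and card_zeros: "i < 4 \<Longrightarrow> card (zero_points f (L i)) = 4"
    and nonzero: "i < 4 \<Longrightarrow> \<exists>x\<in>L i. f x \<noteq> 0"
    and common: "i < 4 \<Longrightarrow> j < 4 \<Longrightarrow> i \<noteq> j \<Longrightarrow> x \<in> L i \<Longrightarrow> x \<in> L j \<Longrightarrow> x \<noteq> 0 \<Longrightarrow> f x \<noteq> 0"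
    and cone: "generic (\<lambda>P. \<exists>q. form_fun 4 q \<and> (\<forall>x c. q (x + c *s P) = q x) \<and>
      (\<forall>i<4. \<exists>c. c \<noteq> 0 \<and> (\<forall>x\<in>L i. q x = c * f x)))"

lemma half_grid_quartic_lines:
  assumes hg: "half_grid 4 4 Z"
  shows "\<exists>f L. quartic_lines f L \<and> Z = (\<Union>i<4. zero_points f (L i))"
proof -
  have Z: "finite Z" "Z \<subseteq> proj_points" using hg by (auto simp: half_grid_def geproci_def)
  obtain d h where h: "form d h" "\<forall>P\<in>proj_points. (\<exists>v\<in>P. poly_eval h v \<noteq> 0) \<longrightarrow>
      (\<forall>A :: complex ^ 4 ^ 3. {v. A *v v = 0} = P \<longrightarrow>
        (\<exists>F G. complete_intersection 4 4 (proj_image A Z) F G \<and> (union_of_lines F \<or> union_of_lines G)))"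
    using hg unfolding half_grid_def general_projection_def by blast
  have ul: "\<exists>F G. complete_intersection 4 4 (proj_image A Z) F G \<and> union_of_lines F"
    if "poly_eval h P \<noteq> 0" "P \<noteq> 0" "{v. A *v v = 0} = point P" for A :: "complex ^ 4 ^ 3" and P
  proof -
    have "point P \<in> proj_points" "P \<in> point P"
      using that(2) by (auto simp: proj_points_def vec.span_base)
    then have "\<exists>F G. complete_intersection 4 4 (proj_image A Z) F G \<and> (union_of_lines F \<or> union_of_lines G)"
      using h(2) that(1,3) by blast
    \<comment> \<open>Both degrees are 4, so the curve made of lines may be called
      \<open>F\<close>.\<close>
    then show ?thesis using complete_intersection_commute by blast
  qed
  define W where "W t = vec.span (fst t \<union> fst (snd t) \<union> snd (snd t))" for t :: "(complex ^ 4) set \<times> (complex ^ 4) set \<times> (complex ^ 4) set"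
  have span: "generic (\<lambda>P. P \<notin> W t)" if t0: "t \<in> Z \<times> Z \<times> Z" for t
  proof -
    obtain p q r where t: "t = (p, q, r)" "p \<in> Z" "q \<in> Z" "r \<in> Z" using t0 by (cases t) auto
    have ex: "\<exists>x. p = point x" if "p \<in> Z" for p using that Z(2) by (auto elim!: proj_pointsE)
    obtain x y z where xyz: "p = point x" "q = point y" "r = point z"
      using ex[OF t(2)] ex[OF t(3)] ex[OF t(4)] by (elim exE)
    have "p \<subseteq> vec.span {x, y, z}" "q \<subseteq> vec.span {x, y, z}" "r \<subseteq> vec.span {x, y, z}"
      unfolding xyz by (intro vec.span_mono; simp)+
    then have "vec.span (p \<union> q \<union> r) \<subseteq> vec.span {x, y, z}" by (intro vec.span_minimal) auto
    then have "vec.dim (vec.span (p \<union> q \<union> r)) \<le> vec.dim (vec.span {x, y, z})" by (rule vec.dim_subset)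
    also have "\<dots> \<le> card {x, y, z}" by (simp only: vec.dim_span) (rule vec.dim_le_card', simp)
    also have "\<dots> \<le> 3" by (simp add: card_insert_if)
    finally have dim: "vec.dim (vec.span (p \<union> q \<union> r)) \<le> 3" .
    have "vec.span (p \<union> q \<union> r) \<noteq> UNIV"
    proof
      assume "vec.span (p \<union> q \<union> r) = UNIV"
      from dim[unfolded this] show False by (simp add: vec.dim_UNIV card_cart_basis)
    qed
    then show ?thesis unfolding t W_def using generic_not_in_subspace[OF vec.subspace_span] by auto
  qed
  have "generic (\<lambda>P :: complex ^ 4. poly_eval h P \<noteq> 0)"
    using poly_eval_nonzero[of h] h(1) genericI[OF form_fun_poly_eval[OF h(1)]] by (auto simp: form_def)
  moreover have "generic (\<lambda>P :: complex ^ 4. P $ 1 \<noteq> 0)"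
    by (rule genericI[OF form_fun.coord[of 1], where v = "axis 1 1"]) (simp add: axis_def)
  moreover have "generic (\<lambda>P. \<forall>t\<in>Z \<times> Z \<times> Z. P \<notin> W t)"
    using Z(1) span by (intro generic_ball) auto
  ultimately have "generic (\<lambda>P. poly_eval h P \<noteq> 0 \<and> P $ 1 \<noteq> 0 \<and>
      (\<forall>t\<in>Z \<times> Z \<times> Z. P \<notin> W t))"
    by (intro generic_conj)
  then have gen: "generic (\<lambda>P. \<exists>A F G. projection Z P A F G)"
  proof (rule generic_mono)
    fix P :: "complex ^ 4"
    assume P: "poly_eval h P \<noteq> 0 \<and> P $ 1 \<noteq> 0 \<and>
      (\<forall>t\<in>Z \<times> Z \<times> Z. P \<notin> W t)"
    obtain A :: "complex ^ 4 ^ 3" where A: "{v. A *v v = 0} = point P"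
      using projection_matrix_exists P by blast
    have "P \<noteq> 0" using P by auto
    then obtain F G where "complete_intersection 4 4 (proj_image A Z) F G" "union_of_lines F"
      using ul P A by blast
    moreover have "P \<notin> vec.span (p \<union> q \<union> r)" if "p \<in> Z" "q \<in> Z" "r \<in> Z" for p q r
      using P that by (auto simp: W_def)
    ultimately show "\<exists>A F G. projection Z P A F G" using Z A unfolding projection_def by blast
  qed
  \<comment> \<open>One fixed vertex \<open>P0\<close> supplies both the lines and the reference
    quartic \<open>f\<close>; the cones of all other general vertices are compared with it.\<close>
  then obtain P0 A0 F0 G0 where "projection Z P0 A0 F0 G0" using generic_ex by blast
  then interpret P0: projection Z P0 A0 F0 G0 .
  obtain L where L: "\<forall>i<4. proj_line (L i) \<and> card {p \<in> Z. p \<subseteq> L i} = 4" "\<forall>p\<in>Z. \<exists>i<4::nat. p \<subseteq> L i"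
    "\<forall>p\<in>Z. \<forall>i<4. \<forall>j<4. p \<subseteq> L i \<longrightarrow> p \<subseteq> L j \<longrightarrow> i = j"
    using P0.lifted_lines by blast
  have Lcard: "proj_line (L i) \<and> card {p \<in> Z. p \<subseteq> L i} = 4" if "i < 4" for i using L(1) that by blast
  have sub: "{p \<in> Z. p \<subseteq> L i} \<subseteq> zero_points q (L i)" if "\<forall>p\<in>Z. \<forall>x\<in>p. q x = 0" for q i
  proof
    fix p assume p: "p \<in> {p \<in> Z. p \<subseteq> L i}"
    then obtain x where "x \<noteq> 0" "p = point x" using Z(2) by (auto elim!: proj_pointsE)
    moreover from this have "x \<in> p" by (simp add: vec.span_base)
    ultimately show "p \<in> zero_points q (L i)" using p that unfolding zero_points_def by blast
  qed
  obtain f where f: "form_fun 4 f" "\<forall>p\<in>Z. \<forall>x\<in>p. f x = 0" "\<forall>i<4. \<exists>x\<in>L i. f x \<noteq> 0"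
    using P0.quartic_cone[of L] Lcard by blast
  have zeros: "zero_points f (L i) = {p \<in> Z. p \<subseteq> L i}" if i: "i < 4" for i
  proof -
    obtain w where w: "w \<in> L i" "f w \<noteq> 0" using f(3) i by blast
    have "finite (zero_points f (L i))" "card (zero_points f (L i)) \<le> 4"
      using zero_points_bound[OF f(1) _ w] Lcard[OF i] by auto
    then have "{p \<in> Z. p \<subseteq> L i} = zero_points f (L i)"
      using card_mono[OF _ sub[OF f(2)], of i] Lcard[OF i]
      by (intro card_subset_eq sub[OF f(2)]) auto
    then show ?thesis ..
  qed
  have "quartic_lines f L"
  proof
    show "form_fun 4 f" by (rule f(1))
    show "proj_line (L i)" if "i < 4" for i using Lcard that by blast
    show "card (zero_points f (L i)) = 4" if "i < 4" for i using Lcard zeros that by simp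
    show "\<exists>x\<in>L i. f x \<noteq> 0" if "i < 4" for i using f(3) that by blast
    show "f x \<noteq> 0" if ij: "i < 4" "j < 4" "i \<noteq> j" and x: "x \<in> L i" "x \<in> L j" "x \<noteq> 0" for i j x
    proof
      assume "f x = 0"
      then have "point x \<in> zero_points f (L i)" "point x \<in> zero_points f (L j)"
        using x by (auto simp: zero_points_def)
      then have z: "point x \<in> Z" "point x \<subseteq> L i" "point x \<subseteq> L j"
        unfolding zeros[OF ij(1)] zeros[OF ij(2)] by simp_all
      show False using L(3)[rule_format, OF z(1) ij(1,2) z(2,3)] ij(3) by simp
    qed
    show "generic (\<lambda>P. \<exists>q. form_fun 4 q \<and> (\<forall>x c. q (x + c *s P) = q x) \<and>
      (\<forall>i<4. \<exists>c. c \<noteq> 0 \<and> (\<forall>x\<in>L i. q x = c * f x)))"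
    proof (rule generic_mono[OF gen])
      fix P assume "\<exists>A F G. projection Z P A F G"
      then obtain A F G where "projection Z P A F G" by blast
      then interpret projection Z P A F G .
      obtain q where q: "form_fun 4 q" "\<forall>x c. q (x + c *s P) = q x" "\<forall>p\<in>Z. \<forall>x\<in>p. q x = 0"
        "\<forall>i<4. \<exists>x\<in>L i. q x \<noteq> 0"
        using quartic_cone[of L] Lcard by blast
      have "\<exists>c. c \<noteq> 0 \<and> (\<forall>x\<in>L i. q x = c * f x)" if i: "i < 4" for i
      proof (rule proportional_on_line[OF f(1) q(1)])
        show "proj_line (L i)" "card (zero_points f (L i)) = 4" using Lcard[OF i] zeros[OF i] by auto
        show "zero_points f (L i) \<subseteq> zero_points q (L i)" unfolding zeros[OF i] by (rule sub[OF q(3)])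
        show "\<exists>x\<in>L i. f x \<noteq> 0" "\<exists>x\<in>L i. q x \<noteq> 0" using f(3) q(4) i by blast+
      qed simp
      then show "\<exists>q. form_fun 4 q \<and> (\<forall>x c. q (x + c *s P) = q x) \<and>
          (\<forall>i<4. \<exists>c. c \<noteq> 0 \<and> (\<forall>x\<in>L i. q x = c * f x))"
        using q(1,2) by blast
    qed
  qed
  moreover have "Z = (\<Union>i<4. zero_points f (L i))" using zeros L(2) by auto
  ultimately show ?thesis by blast
qed

section \<open>The four lines are pairwise skew\<close>

definition linear_coords :: "(complex ^ 'm \<Rightarrow> complex ^ 'n) \<Rightarrow> bool" where
  "linear_coords g \<longleftrightarrow> (\<forall>i. form_fun 1 (\<lambda>s. g s $ i))"

lemma linear_coords_scale:
  assumes "form_fun 1 h"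
  shows "linear_coords (\<lambda>s. h s *s e)"
proof -
  have "form_fun 1 (\<lambda>s. (h s *s e) $ i)" for i
    using form_fun_cmult[OF assms, of "e $ i"] by (simp only: vector_smult_component mult.commute)
  then show ?thesis by (simp only: linear_coords_def simp_thms)
qed

lemma linear_coords_add:
  "linear_coords g \<Longrightarrow> linear_coords h \<Longrightarrow> linear_coords (\<lambda>s. g s + h s)"
  unfolding linear_coords_def vector_add_component by (intro allI form_fun.add; erule spec)

text \<open>Stated coordinatewise so that arguments such as \<open>s $ 1 *s e1 + s $ 2 *s e2\<close>
  are recognized as homogeneous without writing their matrices.\<close>

lemma form_fun_subst:
  fixes g :: "complex ^ 'm \<Rightarrow> complex ^ 'n"
  assumes "linear_coords g"
  shows "form_fun d f \<Longrightarrow> form_fun d (\<lambda>s. f (g s))"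
proof (induction rule: form_fun.induct)
  case (coord i)
  show ?case using assms unfolding linear_coords_def ..
qed (auto intro: form_fun.intros)

definition indep4 :: "complex ^ 4 \<Rightarrow> complex ^ 4 \<Rightarrow> complex ^ 4 \<Rightarrow> complex ^ 4 \<Rightarrow> bool" where
  "indep4 u v w x \<longleftrightarrow> (\<forall>a b c d. a *s u + b *s v + c *s w + d *s x = 0 \<longrightarrow> a = 0 \<and> b = 0 \<and> c = 0 \<and> d = 0)"

lemma indep4_matrix:
  assumes "indep4 e1 e2 e3 e4"
  obtains T B :: "complex ^ 4 ^ 4" where "T ** B = mat 1" "B ** T = mat 1"
    "\<And>s. T *v s = s $ 1 *s e1 + s $ 2 *s e2 + s $ 3 *s e3 + s $ 4 *s e4"
proof -
  define T :: "complex ^ 4 ^ 4" where "T = (\<chi> i j. (vector [e1, e2, e3, e4] :: complex ^ 4 ^ 4) $ j $ i)"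
  have T: "T *v s = s $ 1 *s e1 + s $ 2 *s e2 + s $ 3 *s e3 + s $ 4 *s e4" for s
    by (simp add: T_def vec_eq_iff matrix_vector_mult_def sum_4 vector_4 mult.commute)
  have "s = 0" if "T *v s = 0" for s
    using assms[unfolded indep4_def, rule_format, OF that[unfolded T]] by (simp add: vec_eq_iff forall_4)
  then have "\<exists>B. B ** T = mat 1" by (simp add: matrix_left_invertible_ker)
  then obtain B where B: "B ** T = mat 1" ..
  then have "T ** B = mat 1" by (simp only: matrix_left_right_inverse)
  then show ?thesis using that[OF _ B T] by simp
qed

text \<open>Makes the coordinates of a general vertex in an adapted basis the free variables of the
  identities. Invertibility of the base change keeps the witnessing form nonzero.\<close>

lemma generic_coords:
  assumes "indep4 e1 e2 e3 e4" "generic Q"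
  shows "generic (\<lambda>s :: complex ^ 4. Q (s $ 1 *s e1 + s $ 2 *s e2 + s $ 3 *s e3 + s $ 4 *s e4))"
proof -
  obtain T B :: "complex ^ 4 ^ 4" where T: "T ** B = mat 1"
    "\<And>s. T *v s = s $ 1 *s e1 + s $ 2 *s e2 + s $ 3 *s e3 + s $ 4 *s e4"
    using indep4_matrix[OF assms(1)] by blast
  obtain d h v where h: "form_fun d h" "h v \<noteq> 0" "\<forall>v. h v \<noteq> 0 \<longrightarrow> Q v"
    using assms(2) unfolding generic_def by blast
  have "T *v (B *v v) = v" using T(1) by (simp add: matrix_vector_mul_assoc)
  then have "h (T *v (B *v v)) \<noteq> 0" using h(2) by simp
  from genericI[OF form_fun_compose[OF h(1)] this]
  show ?thesis by (rule generic_mono) (use h(3) T(2) in auto)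
qed

lemma indep4_skew:
  assumes "indep2 a b" "indep2 c d" "vec.span {a, b} \<inter> vec.span {c, d} = {0}"
  shows "indep4 a b c d"
  unfolding indep4_def
proof (intro allI impI)
  fix p q r s assume z: "p *s a + q *s b + r *s c + s *s d = 0"
  have eq: "p *s a + q *s b = (- r) *s c + (- s) *s d"
  proof -
    have "p *s a + q *s b = (p *s a + q *s b + r *s c + s *s d) + ((- r) *s c + (- s) *s d)"
      by (simp add: vec_eq_iff)
    then show ?thesis unfolding z by simp
  qed
  have "p *s a + q *s b \<in> vec.span {a, b}" unfolding span_pair by blast
  moreover have "p *s a + q *s b \<in> vec.span {c, d}" unfolding eq unfolding span_pair by blast
  ultimately have e1: "p *s a + q *s b = 0" using assms(3) by blast
  then have e2: "r *s c + s *s d = 0" using z by (simp add: add.assoc)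
  show "p = 0 \<and> q = 0 \<and> r = 0 \<and> s = 0"
    using assms(1,2) e1 e2 unfolding indep2_def by blast
qed

text \<open>The point at infinity \<open>v\<close> is covered as well, since \<open>f v\<close> is
  the leading coefficient of the vanishing restriction.\<close>

lemma form_fun_vanish_on_line:
  assumes f: "form_fun d f" and "d > 0" and z: "\<And>t. f (u + t *s v) = 0" and x: "x \<in> vec.span {u, v}"
  shows "f x = 0"
proof -
  obtain p where p: "coeff p d = f v" "\<forall>t. f (u + t *s v) = poly p t"
    using form_fun_on_line[OF f] by metis
  have "\<forall>t. poly p t = 0" using p(2) z by simp
  then have "p = 0" using poly_all_0_iff_0 by blast
  then have v: "f v = 0" using p(1) by simp
  obtain s t where x: "x = s *s u + t *s v" using x unfolding span_pair by blast
  show ?thesis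
  proof (cases "s = 0")
    case True
    then show ?thesis using x v form_fun_scale[OF f, of t v] by simp
  next
    case False
    then have eq: "x = s *s (u + (t / s) *s v)" by (simp add: x vec_eq_iff distrib_left)
    show ?thesis unfolding eq form_fun_scale[OF f] by (simp add: z)
  qed
qed

context quartic_lines
begin

lemma cone_coefficients:
  "generic (\<lambda>P. \<exists>q c. form_fun 4 q \<and> (\<forall>x k. q (x + k *s P) = q x) \<and>
    (\<forall>i<4. c i \<noteq> 0 \<and> (\<forall>x\<in>L i. q x = c i * f x)))"
proof (rule generic_mono[OF cone])
  fix P
  assume "\<exists>q. form_fun 4 q \<and> (\<forall>x c. q (x + c *s P) = q x) \<and> (\<forall>i<4. \<exists>c. c \<noteq> 0 \<and> (\<forall>x\<in>L i. q x = c * f x))"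
  then obtain q where q: "form_fun 4 q" "\<forall>x c. q (x + c *s P) = q x"
    "\<forall>i\<in>{..<4}. \<exists>c. c \<noteq> 0 \<and> (\<forall>x\<in>L i. q x = c * f x)" by auto
  from bchoice[OF q(3)] obtain c where c: "\<forall>i\<in>{..<4}. c i \<noteq> 0 \<and> (\<forall>x\<in>L i. q x = c i * f x)" ..
  show "\<exists>q c. form_fun 4 q \<and> (\<forall>x k. q (x + k *s P) = q x) \<and>
      (\<forall>i<4. c i \<noteq> 0 \<and> (\<forall>x\<in>L i. q x = c i * f x))"
    by (rule exI[of _ q], rule exI[of _ c]) (use q c in simp)
qed

text \<open>Translation by the vertex carries \<open>a\<close> to \<open>- b\<close>, and a form of
  degree 4 is even.\<close>

lemma cone_swap:
  assumes "form_fun 4 q" "\<forall>x k. q (x + k *s P) = q x" "P = a + b"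
  shows "q a = q b"
proof -
  have "q a = q (a + (-1) *s P)" by (rule assms(2)[rule_format, symmetric])
  also have "a + (-1) *s P = (-1) *s b" by (simp add: assms(3) vec_eq_iff)
  also have "q ((-1) *s b) = q b" using form_fun_scale[OF assms(1), of "-1" b] by simp
  finally show ?thesis .
qed

lemma zero_on_line:
  assumes "i < 4"
  shows "\<exists>x\<in>L i. x \<noteq> 0 \<and> f x = 0"
proof -
  have "zero_points f (L i) \<noteq> {}" using card_zeros[OF assms] by (metis card.empty zero_neq_numeral)
  then show ?thesis by (auto simp: zero_points_def)
qed

lemma zero_off_point:
  assumes "i < 4"
  shows "\<exists>x\<in>L i. f x = 0 \<and> x \<notin> point r"
proof (rule ccontr)
  assume n: "\<not> ?thesis"
  have "zero_points f (L i) \<subseteq> {point r}"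
  proof
    fix p assume "p \<in> zero_points f (L i)"
    then obtain x where x: "x \<in> L i" "x \<noteq> 0" "f x = 0" "p = point x" by (auto simp: zero_points_def)
    then obtain c where c: "x = c *s r" using n by (auto simp: vec.span_singleton)
    then have "c \<noteq> 0" using x(2) by auto
    then show "p \<in> {point r}" unfolding x(4) c using span_scale_eq by simp
  qed
  then have "card (zero_points f (L i)) \<le> card {point r}" by (intro card_mono) auto
  then show False using card_zeros[OF assms] by simp
qed

lemma not_subset:
  assumes "i < 4" "j < 4" "i \<noteq> j"
  shows "\<not> L i \<subseteq> L j"
  using zero_on_line[OF assms(1)] common[OF assms] by blast

lemma subspace: "i < 4 \<Longrightarrow> vec.subspace (L i)"
  using line by (simp add: proj_line_def)

lemma span_subset: "i < 4 \<Longrightarrow> S \<subseteq> L i \<Longrightarrow> vec.span S \<subseteq> L i"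
  using subspace by (intro vec.span_minimal)

lemma skew_commute: "skew M N \<longleftrightarrow> skew N M"
  by (auto simp: skew_def)

lemma not_skewE:
  assumes "\<not> skew (L i) (L j)" "i < 4" "j < 4"
  obtains x where "x \<in> L i" "x \<in> L j" "x \<noteq> 0"
  using assms subspace vec.subspace_0 unfolding skew_def by blast

lemma coefficient_eq:
  assumes "x \<in> L i" "x \<in> L j" "x \<noteq> 0" "i < 4" "j < 4" "i \<noteq> j"
    and "\<forall>i<4. c i \<noteq> 0 \<and> (\<forall>x\<in>L i. q x = c i * f x)"
  shows "c i = c j"
proof -
  have "c i * f x = c j * f x" using assms by metis
  then show ?thesis using common[OF assms(4-6,1-3)] by simp
qed

text \<open>The two intersection points force \<open>c i = c j = c k\<close>. Decomposing a general
  vertex along the skew pair then gives \<open>f a = f b\<close> for all \<open>a\<close> on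
  \<open>L i\<close> and \<open>b\<close> on \<open>L k\<close>, which is absurd for a zero and a
  nonzero value.\<close>

lemma not_chain:
  assumes ijk: "i < 4" "j < 4" "k < 4" "i \<noteq> j" "j \<noteq> k"
    and ij: "\<not> skew (L i) (L j)" and jk: "\<not> skew (L j) (L k)" and ik: "skew (L i) (L k)"
  shows False
proof -
  obtain x where x: "x \<in> L i" "x \<in> L j" "x \<noteq> 0" using not_skewE ij ijk by blast
  obtain y where y: "y \<in> L j" "y \<in> L k" "y \<noteq> 0" using not_skewE jk ijk by blast
  obtain e1 e2 where e: "indep2 e1 e2" "L i = vec.span {e1, e2}" using line[OF ijk(1)] proj_line_obtain by blast
  obtain e3 e4 where e': "indep2 e3 e4" "L k = vec.span {e3, e4}" using line[OF ijk(3)] proj_line_obtain by blast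
  have ind: "indep4 e1 e2 e3 e4" using indep4_skew[OF e(1) e'(1)] ik e(2) e'(2) by (simp add: skew_def)
  let ?D = "\<lambda>s :: complex ^ 4. f (s $ 1 *s e1 + s $ 2 *s e2) - f (s $ 3 *s e3 + s $ 4 *s e4)"
  have zero: "?D s = 0" for s
  proof (rule form_fun_generic_zero[where f = ?D])
    show "form_fun 4 ?D"
      by (intro form_fun_diff form_fun_subst[OF _ form] linear_coords_add linear_coords_scale form_fun.coord)
    show "generic (\<lambda>s. ?D s = 0)"
    proof (rule generic_mono[OF generic_coords[OF ind cone_coefficients]], elim exE conjE)
      fix s :: "complex ^ 4" and q c
      assume q: "form_fun 4 q"
        "\<forall>x k. q (x + k *s (s $ 1 *s e1 + s $ 2 *s e2 + s $ 3 *s e3 + s $ 4 *s e4)) = q x"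
        and c: "\<forall>i<4. c i \<noteq> 0 \<and> (\<forall>x\<in>L i. q x = c i * f x)"
      have "q (s $ 1 *s e1 + s $ 2 *s e2) = q (s $ 3 *s e3 + s $ 4 *s e4)"
        by (rule cone_swap[OF q]) (simp add: add.assoc)
      moreover have "s $ 1 *s e1 + s $ 2 *s e2 \<in> L i" "s $ 3 *s e3 + s $ 4 *s e4 \<in> L k"
        unfolding e(2) e'(2) span_pair by blast+
      moreover have "c i = c j" "c j = c k"
        using coefficient_eq[OF x _ _ _ c] coefficient_eq[OF y _ _ _ c] ijk by auto
      ultimately show "?D s = 0" using c ijk by auto
    qed
  qed
  obtain v where v: "v \<in> L i" "f v = 0" using zero_on_line[OF ijk(1)] by blast
  obtain w where w: "w \<in> L k" "f w \<noteq> 0" using nonzero[OF ijk(3)] by blast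
  obtain s t where st: "v = s *s e1 + t *s e2" using v(1) unfolding e(2) span_pair by blast
  obtain s' t' where st': "w = s' *s e3 + t' *s e4" using w(1) unfolding e'(2) span_pair by blast
  show False using zero[of "vector [s, t, s', t']"] v(2) w(2) st st' by (simp add: vector_4)
qed

text \<open>Here \<open>c i = c j\<close>, and a general vertex decomposes both along
  \<open>L i\<close>, \<open>L k\<close> and along \<open>L j\<close>, \<open>L k\<close>. The
  quotient of the two relations is free of unknown scalars.\<close>

lemma not_pair:
  assumes ijk: "i < 4" "j < 4" "k < 4" "i \<noteq> j"
    and ij: "\<not> skew (L i) (L j)" and jk: "skew (L j) (L k)" and ik: "skew (L i) (L k)"
  shows False
proof -
  obtain x0 where x0: "x0 \<in> L i" "x0 \<in> L j" "x0 \<noteq> 0" using not_skewE ij ijk by blast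
  obtain u0 where u0: "indep2 u0 x0" "L i = vec.span {u0, x0}" using proj_line_extend[OF line] x0 ijk by blast
  obtain v where v: "indep2 v x0" "L j = vec.span {v, x0}" using proj_line_extend[OF line] x0 ijk by blast
  obtain g h where gh: "indep2 g h" "L k = vec.span {g, h}" using line[OF ijk(3)] proj_line_obtain by blast
  have "indep4 u0 x0 g h" using indep4_skew[OF u0(1) gh(1)] ik u0(2) gh(2) by (simp add: skew_def)
  then obtain T B :: "complex ^ 4 ^ 4" where T: "T ** B = mat 1"
    "\<And>s. T *v s = s $ 1 *s u0 + s $ 2 *s x0 + s $ 3 *s g + s $ 4 *s h"
    using indep4_matrix by blast
  \<comment> \<open>\<open>v\<close> on \<open>L j\<close> is split as \<open>u + R\<close> with
    \<open>u\<close> on \<open>L i\<close> and \<open>R\<close> on \<open>L k\<close>;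
    \<open>R\<close> is the shift on \<open>L k\<close> when one decomposition of the vertex is
    exchanged for the other.\<close>
  define s where "s = B *v v"
  define u where "u = s $ 1 *s u0 + s $ 2 *s x0"
  define R where "R = s $ 3 *s g + s $ 4 *s h"
  have "T *v s = v" unfolding s_def using T(1) by (simp add: matrix_vector_mul_assoc)
  then have vuR: "v = u + R" unfolding T(2) u_def R_def by (simp add: add.assoc)
  have u: "u \<in> L i" and R: "R \<in> L k" unfolding u0(2) gh(2) u_def R_def span_pair by blast+
  have vj: "v \<in> L j" unfolding v(2) by (simp add: vec.span_base)
  have R0: "R \<noteq> 0"
  proof
    assume "R = 0"
    then have "L j \<subseteq> L i" unfolding v(2) using u x0(1) vuR ijk by (intro span_subset) auto
    then show False using not_subset[of j i] ijk by simp
  qed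
  have uO: "indep2 u x0"
  proof (rule ccontr)
    assume "\<not> indep2 u x0"
    then have "u \<in> point x0" using indep2_iff[OF x0(3)] indep2_commute by blast
    then obtain a where a: "u = a *s x0" by (auto simp: vec.span_singleton)
    have "v - u \<in> L j" unfolding a using vj x0(2) subspace[OF ijk(2)]
      by (intro vec.subspace_diff vec.subspace_scale)
    then have "R \<in> L j" unfolding vuR by simp
    then show False using R R0 jk unfolding skew_def by blast
  qed
  have Li: "L i = vec.span {u, x0}" using line_through_points[OF line[OF ijk(1)] u x0(1) uO] .
  obtain w where w: "indep2 w R" "L k = vec.span {w, R}" using proj_line_extend[OF line] R R0 ijk by blast
  have ind: "indep4 u x0 w R" using indep4_skew[OF uO w(1)] ik Li w(2) by (simp add: skew_def)
  \<comment> \<open>The vertex \<open>s1 u + s2 x0 + s3 w + s4 R\<close> equals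
    \<open>s1 v + s2 x0 + s3 w + (s4 - s1) R\<close>; \<open>?D\<close> is the cross product of the
    two resulting equations.\<close>
  let ?D = "\<lambda>s :: complex ^ 4. f (s $ 1 *s u + s $ 2 *s x0) * f (s $ 3 *s w + (s $ 4 - s $ 1) *s R)
      - f (s $ 3 *s w + s $ 4 *s R) * f (s $ 1 *s v + s $ 2 *s x0)"
  have zero: "?D s = 0" for s
  proof (rule form_fun_generic_zero[where f = ?D])
    show "form_fun (4 + 4) ?D"
      by (intro form_fun_diff form_fun.mult form_fun_subst[OF _ form] linear_coords_add linear_coords_scale
          form_fun.coord)
    show "generic (\<lambda>s. ?D s = 0)"
    proof (rule generic_mono[OF generic_coords[OF ind cone_coefficients]], elim exE conjE)
      fix s :: "complex ^ 4" and q c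
      assume q: "form_fun 4 q"
        "\<forall>x k. q (x + k *s (s $ 1 *s u + s $ 2 *s x0 + s $ 3 *s w + s $ 4 *s R)) = q x"
        and c: "\<forall>i<4. c i \<noteq> 0 \<and> (\<forall>x\<in>L i. q x = c i * f x)"
      have 1: "q (s $ 1 *s u + s $ 2 *s x0) = q (s $ 3 *s w + s $ 4 *s R)"
        by (rule cone_swap[OF q]) (simp add: add.assoc)
      have 2: "q (s $ 1 *s v + s $ 2 *s x0) = q (s $ 3 *s w + (s $ 4 - s $ 1) *s R)"
        by (rule cone_swap[OF q]) (simp add: vuR vec_eq_iff algebra_simps)
      have 3: "s $ 1 *s u + s $ 2 *s x0 \<in> L i" "s $ 1 *s v + s $ 2 *s x0 \<in> L j"
        "s $ 3 *s w + s $ 4 *s R \<in> L k" "s $ 3 *s w + (s $ 4 - s $ 1) *s R \<in> L k"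
        unfolding Li v(2) w(2) span_pair by blast+
      have cij: "c i = c j" using coefficient_eq[OF x0 ijk(1,2,4) c] .
      have "c i * f (s $ 1 *s u + s $ 2 *s x0) = c k * f (s $ 3 *s w + s $ 4 *s R)"
        "c i * f (s $ 1 *s v + s $ 2 *s x0) = c k * f (s $ 3 *s w + (s $ 4 - s $ 1) *s R)"
        using 1 2 3 c ijk cij by auto
      then have "(c i * c k) * ?D s = 0" by algebra
      then show "?D s = 0" using c ijk by simp
    qed
  qed
  obtain z where z: "z \<in> L k" "f z = 0" "z \<notin> point R" using zero_off_point[OF ijk(3)] by blast
  obtain t r where tr: "z = t *s w + r *s R" using z(1) unfolding w(2) span_pair by blast
  have t0: "t \<noteq> 0"
  proof
    assume "t = 0"
    then show False using z(3) tr by (auto simp: vec.span_singleton)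
  qed
  have prod: "f (a *s u + b *s x0) * f (t *s w + (r - a) *s R) = 0" for a b
    using zero[of "vector [a, b, t, r]"] z(2) tr by (simp add: vector_4)
  \<comment> \<open>Otherwise \<open>f\<close> vanishes at \<open>a u + b x0\<close> for every
    \<open>b\<close>, hence at the limit point \<open>x0\<close>, which \<open>common\<close>
    forbids.\<close>
  have "f (t *s w + (r - a) *s R) = 0" for a
  proof (rule ccontr)
    assume "f (t *s w + (r - a) *s R) \<noteq> 0"
    then have "f (a *s u + b *s x0) = 0" for b using prod[of a b] by simp
    then have "f x0 = 0"
      using form_fun_vanish_on_line[OF form, of "a *s u" x0 x0] by (simp add: vec.span_base)
    then show False using common[OF ijk(1,2,4) x0] by simp
  qed
  from this[of "r - b" for b] have "f (t *s w + b *s R) = 0" for b by simp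
  then have van: "x \<in> vec.span {t *s w, R} \<Longrightarrow> f x = 0" for x
    using form_fun_vanish_on_line[OF form, of "t *s w" R x] by simp
  obtain x where x: "x \<in> L k" "f x \<noteq> 0" using nonzero[OF ijk(3)] by blast
  obtain a b where "x = a *s w + b *s R" using x(1) unfolding w(2) span_pair by blast
  then have "x = (a / t) *s (t *s w) + b *s R" using t0 by (simp add: vec_eq_iff)
  then have "x \<in> vec.span {t *s w, R}" unfolding span_pair by blast
  then show False using van x(2) by blast
qed

text \<open>By \<open>not_chain\<close> and \<open>not_pair\<close>, a line meeting one other line
  meets every line, so a single intersection propagates to all pairs.\<close>

lemma meets_all:
  assumes ij: "i < 4" "j < 4" "i \<noteq> j" "\<not> skew (L i) (L j)" and ab: "a < 4" "b < 4" "a \<noteq> b"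
  shows "\<not> skew (L a) (L b)"
proof -
  have step: "\<not> skew (L p) (L r)"
    if "p < 4" "q < 4" "r < 4" "p \<noteq> q" "q \<noteq> r" "\<not> skew (L p) (L q)" for p q r
    using that not_chain[of p q r] not_pair[of p q r] by blast
  have ia: "\<not> skew (L i) (L c)" if "c < 4" "c \<noteq> i" for c
    using ij step[of i j c] that by (cases "c = j") auto
  show ?thesis
  proof (cases "a = i")
    case True
    then show ?thesis using ia ab by auto
  next
    case False
    then have ai: "\<not> skew (L a) (L i)" using ia ab skew_commute by blast
    then show ?thesis using step[of a i b] False ij ab by (cases "b = i") auto
  qed
qed

text \<open>The first polar of the cone \<open>q\<close> at a common point \<open>x0\<close> of the lines is determined by \<open>f\<close> up to
  a scalar, but it has to pass through the general vertex \<open>P\<close>.\<close>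

lemma not_concurrent:
  assumes ijk: "i < 4" "j < 4" "k < 4" "i \<noteq> j" "i \<noteq> k"
    and x0: "x0 \<noteq> 0" "x0 \<in> L i" "x0 \<in> L j" "x0 \<in> L k"
    and uvw: "u \<in> L i" "v \<in> L j" "w \<in> L k" and ind: "indep4 x0 u v w"
  shows False
proof -
  obtain l where l: "\<And>x. ((\<lambda>t. f (x0 + t *s x)) has_field_derivative lin l x) (at 0)"
    using form_fun_derivative[OF form] by blast
  have "lin l x = 0" for x
  proof (rule form_fun_generic_zero[OF form_fun_lin generic_mono[OF cone_coefficients]], elim exE conjE)
    fix P q c
    assume q: "form_fun 4 q" "\<forall>x k. q (x + k *s P) = q x"
      and c: "\<forall>i<4. c i \<noteq> 0 \<and> (\<forall>x\<in>L i. q x = c i * f x)"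
    have cc: "c j = c i" "c k = c i"
      using coefficient_eq[OF _ _ x0(1) _ _ _ c, of i j] coefficient_eq[OF _ _ x0(1) _ _ _ c, of i k] x0 ijk by simp_all
    obtain m where m: "\<And>x. ((\<lambda>t. q (x0 + t *s x)) has_field_derivative lin m x) (at 0)"
      using form_fun_derivative[OF q(1)] by blast
    \<comment> \<open>Each line through \<open>x0\<close> stays in itself when moved in its own
      direction, so there the derivatives of \<open>q\<close> and \<open>f\<close> are compared with
      the common scalar; three such lines span the space.\<close>
    have on: "lin m x = c i * lin l x" if x: "x \<in> L a" "x0 \<in> L a" and a: "a < 4" "c a = c i" for a x
    proof -
      have "x0 + t *s x \<in> L a" for t
        using x subspace[OF a(1)] by (intro vec.subspace_add vec.subspace_scale)
      then have "(\<lambda>t. q (x0 + t *s x)) = (\<lambda>t. c i * f (x0 + t *s x))" using c a by (metis (no_types))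
      then have "((\<lambda>t. q (x0 + t *s x)) has_field_derivative c i * lin l x) (at 0)"
        using DERIV_cmult[OF l] by simp
      then show ?thesis using DERIV_unique m by blast
    qed
    obtain T B :: "complex ^ 4 ^ 4" where T: "T ** B = mat 1"
      "\<And>s. T *v s = s $ 1 *s x0 + s $ 2 *s u + s $ 3 *s v + s $ 4 *s w"
      using indep4_matrix[OF ind] by blast
    have "P = T *v (B *v P)" using T(1) by (simp add: matrix_vector_mul_assoc)
    then obtain s :: "complex ^ 4" where P: "P = s $ 1 *s x0 + s $ 2 *s u + s $ 3 *s v + s $ 4 *s w"
      unfolding T(2) by blast
    have "lin m x0 = c i * lin l x0" "lin m u = c i * lin l u" "lin m v = c i * lin l v" "lin m w = c i * lin l w"
      using on[of x0 i] on[of u i] on[of v j] on[of w k] x0 uvw ijk cc by simp_all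
    then have "lin m P = c i * lin l P" unfolding P by (simp add: lin_add lin_scale algebra_simps)
    moreover have "lin m P = 0"
      using m[of P] q(2) DERIV_unique[OF DERIV_const m[of P, unfolded q(2)[rule_format]]] by simp
    ultimately show "lin l P = 0" using c ijk by simp
  qed
  \<comment> \<open>Euler's relation: the derivative of a quartic form at \<open>x0\<close> in the
    direction \<open>x0\<close> is \<open>4 * f x0\<close>.\<close>
  moreover have "((\<lambda>t. f (x0 + t *s x0)) has_field_derivative 4 * f x0) (at 0)"
  proof -
    have "x0 + t *s x0 = (1 + t) *s x0" for t by (simp add: vec_eq_iff distrib_right)
    then have "(\<lambda>t. f (x0 + t *s x0)) = (\<lambda>t. (1 + t) ^ 4 * f x0)"
      by (simp only: form_fun_scale[OF form])
    then show ?thesis by (auto intro!: derivative_eq_intros)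
  qed
  ultimately have "4 * f x0 = 0" using l[of x0] DERIV_unique by fastforce
  then show False using common[OF ijk(1,2,4) x0(2,3,1)] by simp
qed

text \<open>If two lines met, all would meet pairwise. A line outside the plane of
  \<open>L i\<close> and \<open>L j\<close> can meet both only in their common point, and three
  concurrent independent lines are excluded by \<open>not_concurrent\<close>.\<close>

lemma lines_skew:
  assumes nonplanar: "\<not> (\<exists>H. proj_plane H \<and> (\<forall>i<4. L i \<subseteq> H))" and ij: "i < 4" "j < 4" "i \<noteq> j"
  shows "skew (L i) (L j)"
proof (rule ccontr)
  assume n: "\<not> skew (L i) (L j)"
  have meet: "\<not> skew (L a) (L b)" if "a < 4" "b < 4" "a \<noteq> b" for a b using meets_all[OF ij n that] .
  obtain x0 where x0: "x0 \<in> L i" "x0 \<in> L j" "x0 \<noteq> 0" using not_skewE n ij by blast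
  obtain u where u: "indep2 u x0" "L i = vec.span {u, x0}" using proj_line_extend[OF line] x0 ij by blast
  obtain v where v: "indep2 v x0" "L j = vec.span {v, x0}" using proj_line_extend[OF line] x0 ij by blast
  have uL: "u \<in> L i" "v \<in> L j" unfolding u(2) v(2) by (simp_all add: vec.span_base)
  have vi: "v \<notin> L i"
  proof
    assume "v \<in> L i"
    then have "L j \<subseteq> L i" unfolding v(2) using x0(1) ij by (intro span_subset) auto
    then show False using not_subset[of j i] ij by simp
  qed
  let ?H = "vec.span {v, u, x0}"
  have "vec.independent {v, u, x0}" "v \<notin> {u, x0}"
    using indep2_independent[OF u(1)] vi vec.span_superset[of "{u, x0}"] unfolding u(2)
    by (simp add: vec.independent_insert, blast)
  then have "proj_plane ?H"
    using indep2_independent(2)[OF u(1)] by (simp add: proj_plane_def vec.dim_eq_card_independent)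
  then obtain k where k: "k < 4" "\<not> L k \<subseteq> ?H" using nonplanar by blast
  have sub: "L i \<subseteq> ?H" "L j \<subseteq> ?H" unfolding u(2) v(2) by (intro vec.span_mono; blast)+
  then have ki: "k \<noteq> i" "k \<noteq> j" using k by auto
  obtain x where x: "x \<in> L k" "x \<in> L i" "x \<noteq> 0" using not_skewE meet[OF k(1) ij(1) ki(1)] k(1) ij by blast
  obtain y where y: "y \<in> L k" "y \<in> L j" "y \<noteq> 0" using not_skewE meet[OF k(1) ij(2) ki(2)] k(1) ij by blast
  have "\<not> indep2 x y"
  proof
    assume "indep2 x y"
    then have "L k = vec.span {x, y}" using line_through_points[OF line[OF k(1)] x(1) y(1)] by blast
    moreover have "vec.span {x, y} \<subseteq> ?H" using x(2) y(2) sub by (intro vec.span_minimal) auto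
    ultimately have "L k \<subseteq> ?H" by simp
    then show False using k(2) by blast
  qed
  then obtain a where a: "y = a *s x" using indep2_iff[OF x(3)] by (auto simp: vec.span_singleton)
  then have yi: "y \<in> L i" using x(2) subspace[OF ij(1)] vec.subspace_scale by blast
  have "\<not> indep2 x0 y"
  proof
    assume i: "indep2 x0 y"
    have "L i = vec.span {x0, y}" "L j = vec.span {x0, y}"
      using line_through_points[OF line] i x0 y yi ij by blast+
    then show False using vi uL by blast
  qed
  then obtain b where b: "y = b *s x0" using indep2_iff[OF x0(3)] by (auto simp: vec.span_singleton)
  then have "b \<noteq> 0" using y(3) by auto
  then have "x0 = inverse b *s y" unfolding b by simp
  then have Ok: "x0 \<in> L k" using y(1) subspace[OF k(1)] vec.subspace_scale by blast
  obtain w where w: "indep2 w x0" "L k = vec.span {w, x0}" using proj_line_extend[OF line[OF k(1)] Ok x0(3)] by blast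
  have wk: "w \<in> L k" unfolding w(2) by (simp add: vec.span_base)
  have wH: "w \<notin> ?H"
  proof
    assume "w \<in> ?H"
    moreover have "x0 \<in> ?H" by (simp add: vec.span_base)
    ultimately have "L k \<subseteq> ?H" unfolding w(2) by (intro vec.span_minimal) auto
    then show False using k(2) by blast
  qed
  have "indep4 x0 u v w"
    unfolding indep4_def
  proof (intro allI impI)
    fix p q r s assume z: "p *s x0 + q *s u + r *s v + s *s w = 0"
    have "s = 0"
    proof (rule ccontr)
      assume s: "s \<noteq> 0"
      have "s *s w = - (p *s x0 + q *s u + r *s v)"
        using add_diff_cancel_left'[of "p *s x0 + q *s u + r *s v" "s *s w"] unfolding z by simp
      then have "w = inverse s *s (- (p *s x0 + q *s u + r *s v))"
        using s by (metis left_inverse vec.scale_one vec.scale_scale)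
      moreover have "inverse s *s (- (p *s x0 + q *s u + r *s v)) \<in> ?H"
        by (intro vec.span_scale vec.span_neg vec.span_add) (auto intro: vec.span_base)
      ultimately show False using wH by simp
    qed
    then have z': "p *s x0 + q *s u + r *s v = 0" using z by simp
    have "r = 0"
    proof (rule ccontr)
      assume r: "r \<noteq> 0"
      have "r *s v = - (p *s x0 + q *s u)"
        using add_diff_cancel_left'[of "p *s x0 + q *s u" "r *s v"] unfolding z' by simp
      then have "v = inverse r *s (- (p *s x0 + q *s u))"
        using r by (metis left_inverse vec.scale_one vec.scale_scale)
      moreover have "inverse r *s (- (p *s x0 + q *s u)) \<in> L i"
        unfolding u(2) by (intro vec.span_scale vec.span_neg vec.span_add) (auto intro: vec.span_base)
      ultimately show False using vi by simp
    qed
    then have "q *s u + p *s x0 = 0" using z \<open>s = 0\<close> by (simp add: add.commute)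
    then have "q = 0 \<and> p = 0" using u(1) unfolding indep2_def by blast
    then show "p = 0 \<and> q = 0 \<and> r = 0 \<and> s = 0" using \<open>s = 0\<close> \<open>r = 0\<close> by blast
  qed
  then show False using not_concurrent[OF ij(1,2) k(1) ij(3) _ x0(3,1,2) Ok uL wk] ki by simp
qed

end

section \<open>Coordinates adapted to the four lines\<close>

lemma matrix_vector_mult_columns:
  fixes A :: "complex ^ 2 ^ 'm"
  shows "A *v y = y $ 1 *s column 1 A + y $ 2 *s column 2 A"
  by (simp add: vec_eq_iff matrix_vector_mult_def sum_2 column_def mult.commute)

lemma matrix_minus_mult: "(- A) *v y = - (A *v y)" for A :: "complex ^ 'n ^ 'm"
  by (simp add: vec_eq_iff matrix_vector_mult_def sum_negf)

lemma column_matrix_exists: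
  fixes a b :: "complex ^ 'm"
  shows "\<exists>A :: complex ^ 2 ^ 'm. \<forall>y. A *v y = y $ 1 *s a + y $ 2 *s b"
proof (intro exI allI)
  fix y :: "complex ^ 2"
  show "(\<chi> i j. if j = 1 then a $ i else b $ i) *v y = y $ 1 *s a + y $ 2 *s b"
    by (simp add: vec_eq_iff matrix_vector_mult_def sum_2 mult.commute)
qed

lemma line_parametrization:
  fixes A :: "complex ^ 2 ^ 4"
  assumes "proj_line L" "\<And>y. A *v y \<in> L" "\<And>y. A *v y = 0 \<Longrightarrow> y = 0"
  shows "L = range (\<lambda>y. A *v y)"
proof -
  have "indep2 (column 1 A) (column 2 A)"
    unfolding indep2_def
  proof (intro allI impI)
    fix s t assume "s *s column 1 A + t *s column 2 A = 0"
    then have "A *v vector [s, t] = 0" by (simp add: matrix_vector_mult_columns)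
    then have "vector [s, t] = (0 :: complex ^ 2)" by (rule assms(3))
    then show "s = 0 \<and> t = 0" by (simp add: vec_eq_iff forall_2)
  qed
  moreover have "column 1 A \<in> L" "column 2 A \<in> L"
    using assms(2)[of "axis 1 1"] assms(2)[of "axis 2 1"]
    by (simp_all add: matrix_vector_mult_columns axis_def)
  ultimately have L: "L = vec.span {column 1 A, column 2 A}" using line_through_points[OF assms(1)] by blast
  show ?thesis
  proof (intro equalityI subsetI)
    fix x assume "x \<in> L"
    then obtain s t where "x = s *s column 1 A + t *s column 2 A" unfolding L span_pair by blast
    then have "x = A *v vector [s, t]" by (simp add: matrix_vector_mult_columns)
    then show "x \<in> range (\<lambda>y. A *v y)" by blast
  next
    fix x assume "x \<in> range (\<lambda>y. A *v y)"
    then show "x \<in> L" using assms(2) by blast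
  qed
qed

context quartic_lines
begin

lemma even: "f (- x) = f x"
  using form_fun_scale[OF form, of "-1" x] by simp

text \<open>Write the general vertex as \<open>E1 a + E2 b\<close>. Translation by the vertex identifies \<open>E1 a\<close> with \<open>- E2 b\<close>,
  \<open>E1 (a - b)\<close> with \<open>E3 b\<close> and \<open>E2 (b - a)\<close> with \<open>E3 a\<close>, and the three unknown scalars cancel in the product.\<close>

lemma transfer:
  fixes E1 E2 E3 :: "complex ^ 2 ^ 4"
  assumes ijk: "i < 4" "j < 4" "k < 4"
    and on: "\<And>y. E1 *v y \<in> L i" "\<And>y. E2 *v y \<in> L j" "\<And>y. E3 *v y \<in> L k"
    and sum: "\<And>y. E1 *v y + E2 *v y + E3 *v y = 0"
    and inj: "\<And>y w. E1 *v y + E2 *v w = 0 \<Longrightarrow> y = 0 \<and> w = 0"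
    and a: "f (E3 *v a) = 0"
  shows "f (E1 *v a) = 0"
proof (rule ccontr)
  assume fa: "f (E1 *v a) \<noteq> 0"
  have E3: "E3 *v y = - (E1 *v y) - E2 *v y" for y
    using sum[of y] by (metis add_diff_cancel_left' diff_0 diff_diff_add)
  have ind: "indep4 (column 1 E1) (column 2 E1) (column 1 E2) (column 2 E2)"
    unfolding indep4_def
  proof (intro allI impI)
    fix p q r s
    assume "p *s column 1 E1 + q *s column 2 E1 + r *s column 1 E2 + s *s column 2 E2 = 0"
    then have "E1 *v vector [p, q] + E2 *v vector [r, s] = 0"
      by (simp add: matrix_vector_mult_columns add.assoc)
    then have "vector [p, q] = (0 :: complex ^ 2) \<and> vector [r, s] = (0 :: complex ^ 2)" by (rule inj)
    then show "p = 0 \<and> q = 0 \<and> r = 0 \<and> s = 0" by (simp add: vec_eq_iff forall_2)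
  qed
  let ?D = "\<lambda>s :: complex ^ 4.
      f (s $ 1 *s column 1 E1 + s $ 2 *s column 2 E1) * f (s $ 3 *s column 1 E3 + s $ 4 *s column 2 E3)
        * f ((s $ 3 - s $ 1) *s column 1 E2 + (s $ 4 - s $ 2) *s column 2 E2)
      - f (s $ 3 *s column 1 E2 + s $ 4 *s column 2 E2)
        * f ((s $ 1 - s $ 3) *s column 1 E1 + (s $ 2 - s $ 4) *s column 2 E1)
        * f (s $ 1 *s column 1 E3 + s $ 2 *s column 2 E3)"
  have zero: "?D s = 0" for s
  proof (rule form_fun_generic_zero[where f = ?D])
    show "form_fun (4 + 4 + 4) ?D"
      by (intro form_fun_diff form_fun.mult form_fun_subst[OF _ form] linear_coords_add linear_coords_scale
          form_fun.coord)
    show "generic (\<lambda>s. ?D s = 0)"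
    proof (rule generic_mono[OF generic_coords[OF ind cone_coefficients]], elim exE conjE)
      fix s :: "complex ^ 4" and q c
      let ?P = "s $ 1 *s column 1 E1 + s $ 2 *s column 2 E1 + s $ 3 *s column 1 E2 + s $ 4 *s column 2 E2"
      assume q: "form_fun 4 q" "\<forall>x k. q (x + k *s ?P) = q x"
        and c: "\<forall>i<4. c i \<noteq> 0 \<and> (\<forall>x\<in>L i. q x = c i * f x)"
      define y w :: "complex ^ 2" where "y = vector [s $ 1, s $ 2]" and "w = vector [s $ 3, s $ 4]"
      have P: "?P = E1 *v y + E2 *v w"
        by (simp add: y_def w_def matrix_vector_mult_columns add.assoc)
      have 1: "q (E1 *v y) = q (E2 *v w)"
        by (rule cone_swap[OF q P])
      have 2: "q (E1 *v (y - w)) = q (- (E3 *v w))"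
        by (rule cone_swap[OF q]) (simp add: P E3 matrix_vector_mult_diff_distrib)
      have 3: "q (E2 *v (w - y)) = q (- (E3 *v y))"
        by (rule cone_swap[OF q]) (simp add: P E3 matrix_vector_mult_diff_distrib)
      have even_q: "q (- x) = q x" for x using form_fun_scale[OF q(1), of "-1" x] by simp
      have c0: "c i \<noteq> 0" "c j \<noteq> 0" "c k \<noteq> 0" using c ijk by auto
      have on': "q (E1 *v z) = c i * f (E1 *v z)" "q (E2 *v z) = c j * f (E2 *v z)"
        "q (E3 *v z) = c k * f (E3 *v z)" for z
        using c ijk on by blast+
      have "c i * f (E1 *v y) = c j * f (E2 *v w)" "c i * f (E1 *v (y - w)) = c k * f (E3 *v w)"
        "c j * f (E2 *v (w - y)) = c k * f (E3 *v y)"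
        using 1 2 3 unfolding even_q on' by simp_all
      then have "(c i * c j * c k) * (f (E1 *v y) * f (E3 *v w) * f (E2 *v (w - y))
          - f (E2 *v w) * f (E1 *v (y - w)) * f (E3 *v y)) = 0" by algebra
      then have "f (E1 *v y) * f (E3 *v w) * f (E2 *v (w - y))
          - f (E2 *v w) * f (E1 *v (y - w)) * f (E3 *v y) = 0" using c0 by simp
      then show "?D s = 0" by (simp add: y_def w_def matrix_vector_mult_columns)
    qed
  qed
  have id: "f (E1 *v y) * f (E3 *v w) * f (E2 *v (w - y)) = f (E2 *v w) * f (E1 *v (y - w)) * f (E3 *v y)" for y w
    using zero[of "vector [y $ 1, y $ 2, w $ 1, w $ 2]"] by (simp add: vector_4 matrix_vector_mult_columns)
  have ker2: "y = 0" if "E2 *v y = 0" for y using inj[of 0 y] that by simp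
  have ker3: "y = 0" if "E3 *v y = 0" for y using inj[of y y] sum[of y] that by simp
  \<comment> \<open>With \<open>y = t a\<close> the right side of \<open>id\<close> is zero. It
    remains to choose \<open>b\<close> and a nonzero \<open>t\<close> for which the two other
    factors on the left do not vanish.\<close>
  obtain b1 where b1: "f (E3 *v b1) \<noteq> 0"
    using nonzero[OF ijk(3)] line_parametrization[OF line[OF ijk(3)] on(3) ker3] by auto
  obtain b2 where b2: "f (E2 *v b2) \<noteq> 0"
    using nonzero[OF ijk(2)] line_parametrization[OF line[OF ijk(2)] on(2) ker2] by auto
  obtain b where b: "f (E3 *v b) \<noteq> 0" "f (E2 *v b) \<noteq> 0"
    using form_fun_mult_nonzero[OF form_fun_compose[OF form] form_fun_compose[OF form] b1 b2] by blast
  obtain p where p: "\<forall>t. f (E2 *v b + t *s (E2 *v (- a))) = poly p t"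
    using form_fun_on_line[OF form] by metis
  have p': "poly p t = f (E2 *v (b - t *s a))" for t
    unfolding p[rule_format, symmetric]
    by (simp add: matrix_vector_mult_diff_distrib vector_scalar_commute vec.linear_neg)
  have "p \<noteq> 0" using p'[of 0] b(2) by auto
  then have "finite (insert 0 {t. poly p t = 0})" by (simp add: poly_roots_finite)
  then obtain t where t: "t \<notin> insert 0 {t. poly p t = 0}"
    using ex_new_if_finite infinite_UNIV_char_0 by blast
  have "f (E3 *v (t *s a)) = 0" using a form_fun_scale[OF form] by (simp add: vector_scalar_commute)
  moreover have "f (E1 *v (t *s a)) \<noteq> 0"
    using fa t form_fun_scale[OF form] by (simp add: vector_scalar_commute)
  ultimately show False using id[of "t *s a" b] b(1) t p'[of t] by simp
qed

text \<open>The assumptions are symmetric under rotating the three lines, so \<open>transfer\<close>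
  yields a cycle of three implications.\<close>

lemma transfer_iff:
  fixes E1 E2 E3 :: "complex ^ 2 ^ 4"
  assumes ijk: "i < 4" "j < 4" "k < 4"
    and on: "\<And>y. E1 *v y \<in> L i" "\<And>y. E2 *v y \<in> L j" "\<And>y. E3 *v y \<in> L k"
    and sum: "\<And>y. E1 *v y + E2 *v y + E3 *v y = 0"
    and inj: "\<And>y w. E1 *v y + E2 *v w = 0 \<Longrightarrow> y = 0 \<and> w = 0"
  shows "f (E1 *v a) = 0 \<longleftrightarrow> f (E3 *v a) = 0" "f (E2 *v a) = 0 \<longleftrightarrow> f (E3 *v a) = 0"
proof -
  have E3: "E3 *v y = - (E1 *v y) - E2 *v y" for y
    using sum[of y] by (metis add_diff_cancel_left' diff_0 diff_diff_add)
  have inj1: "y = 0 \<and> w = 0" if "E3 *v y + E1 *v w = 0" for y w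
  proof -
    have "E1 *v (w - y) + E2 *v (- y) = 0"
      using that by (simp add: E3 matrix_vector_mult_diff_distrib vec.linear_neg algebra_simps)
    from inj[OF this] show ?thesis by simp
  qed
  have inj2: "y = 0 \<and> w = 0" if "E2 *v y + E3 *v w = 0" for y w
  proof -
    have "E1 *v (- w) + E2 *v (y - w) = 0"
      using that by (simp add: E3 matrix_vector_mult_diff_distrib vec.linear_neg algebra_simps)
    from inj[OF this] show ?thesis by simp
  qed
  have s1: "E3 *v y + E1 *v y + E2 *v y = 0" and s2: "E2 *v y + E3 *v y + E1 *v y = 0" for y
    using sum[of y] by (simp_all add: add_ac)
  have 1: "f (E3 *v a) = 0 \<Longrightarrow> f (E1 *v a) = 0"
    by (rule transfer[OF ijk on sum inj])
  have 2: "f (E2 *v a) = 0 \<Longrightarrow> f (E3 *v a) = 0"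
    by (rule transfer[OF ijk(3,1,2) on(3,1,2) s1 inj1])
  have 3: "f (E1 *v a) = 0 \<Longrightarrow> f (E2 *v a) = 0"
    by (rule transfer[OF ijk(2,3,1) on(2,3,1) s2 inj2])
  show "f (E1 *v a) = 0 \<longleftrightarrow> f (E3 *v a) = 0" "f (E2 *v a) = 0 \<longleftrightarrow> f (E3 *v a) = 0"
    using 1 2 3 by blast+
qed

lemma coordinates:
  assumes sk: "\<forall>i<4. \<forall>j<4. i \<noteq> j \<longrightarrow> skew (L i) (L j)"
  shows "\<exists>(E1 :: complex ^ 2 ^ 4) (E2 :: complex ^ 2 ^ 4) (M :: complex ^ 2 ^ 2).
    (\<forall>y w. E1 *v y + E2 *v w = 0 \<longrightarrow> y = 0 \<and> w = 0) \<and>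
    (\<forall>y. M *v y = 0 \<longrightarrow> y = 0) \<and> (\<forall>y. M *v y = y \<longrightarrow> y = 0) \<and>
    L 0 = range (\<lambda>y. E1 *v y) \<and> L 1 = range (\<lambda>y. E2 *v y) \<and>
    L 2 = range (\<lambda>y. E1 *v y + E2 *v y) \<and> L 3 = range (\<lambda>y. E1 *v y + E2 *v (M *v y))"
proof -
  have meet: "x = 0" if "x \<in> L i" "x \<in> L j" "i < 4" "j < 4" "i \<noteq> j" for x i j
    using sk[rule_format, OF that(3-5)] that(1,2) by (auto simp: skew_def)
  obtain e1 e2 where e: "indep2 e1 e2" "L 0 = vec.span {e1, e2}" using line[of 0] proj_line_obtain by auto
  obtain e3 e4 where e': "indep2 e3 e4" "L 1 = vec.span {e3, e4}" using line[of 1] proj_line_obtain by auto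
  have "indep4 e1 e2 e3 e4" using indep4_skew[OF e(1) e'(1)] sk[rule_format, of 0 1] e(2) e'(2) by (simp add: skew_def)
  then obtain T B :: "complex ^ 4 ^ 4" where T: "T ** B = mat 1"
    "\<And>s. T *v s = s $ 1 *s e1 + s $ 2 *s e2 + s $ 3 *s e3 + s $ 4 *s e4"
    using indep4_matrix by blast
  have dec: "\<exists>a b. a \<in> L 0 \<and> b \<in> L 1 \<and> x = a + b" for x
  proof -
    define s where "s = B *v x"
    have "x = T *v s" unfolding s_def using T(1) by (simp add: matrix_vector_mul_assoc)
    then have "x = (s $ 1 *s e1 + s $ 2 *s e2) + (s $ 3 *s e3 + s $ 4 *s e4)" unfolding T(2) by (simp add: add.assoc)
    moreover have "s $ 1 *s e1 + s $ 2 *s e2 \<in> L 0" "s $ 3 *s e3 + s $ 4 *s e4 \<in> L 1"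
      unfolding e(2) e'(2) span_pair by blast+
    ultimately show ?thesis by blast
  qed
  have closed: "s *s a + t *s b \<in> L i" if "a \<in> L i" "b \<in> L i" "i < 4" for a b s t i
    using that subspace by (intro vec.subspace_add vec.subspace_scale)
  obtain g1 g2 where g: "indep2 g1 g2" "L 2 = vec.span {g1, g2}" using line[of 2] proj_line_obtain by auto
  then have g2: "g1 \<in> L 2" "g2 \<in> L 2" by (simp_all add: vec.span_base)
  obtain a1 b1 where ab1: "a1 \<in> L 0" "b1 \<in> L 1" "g1 = a1 + b1" using dec by blast
  obtain a2 b2 where ab2: "a2 \<in> L 0" "b2 \<in> L 1" "g2 = a2 + b2" using dec by blast
  \<comment> \<open>The columns are the components of a basis of \<open>L 2\<close>, which makes
    \<open>L 2\<close> the diagonal.\<close>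
  obtain E1 :: "complex ^ 2 ^ 4" where E1: "\<And>y. E1 *v y = y $ 1 *s a1 + y $ 2 *s a2"
    using column_matrix_exists by metis
  obtain E2 :: "complex ^ 2 ^ 4" where E2: "\<And>y. E2 *v y = y $ 1 *s b1 + y $ 2 *s b2"
    using column_matrix_exists by metis
  have on: "E1 *v y \<in> L 0" "E2 *v y \<in> L 1" "E1 *v y + E2 *v y \<in> L 2" for y
  proof -
    show "E1 *v y \<in> L 0" "E2 *v y \<in> L 1" unfolding E1 E2 using closed ab1 ab2 by auto
    have "E1 *v y + E2 *v y = y $ 1 *s g1 + y $ 2 *s g2"
      unfolding E1 E2 ab1 ab2 by (simp add: vec_eq_iff algebra_simps)
    then show "E1 *v y + E2 *v y \<in> L 2" using closed g2 by auto
  qed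
  have g0: "y = 0" if "E1 *v y + E2 *v y = 0" for y
  proof -
    have "y $ 1 *s g1 + y $ 2 *s g2 = 0"
      using that unfolding E1 E2 ab1 ab2 by (simp add: vec_eq_iff algebra_simps)
    then have "y $ 1 = 0 \<and> y $ 2 = 0" using g(1) unfolding indep2_def by blast
    then show ?thesis by (simp add: vec_eq_iff forall_2)
  qed
  have a0: "y = 0" if "E1 *v y = 0" for y
  proof (rule g0)
    have "E2 *v y \<in> L 2" using on(3)[of y] that by simp
    then have "E2 *v y = 0" using meet[of _ 1 2] on(2) by simp
    then show "E1 *v y + E2 *v y = 0" using that by simp
  qed
  have b0: "y = 0" if "E2 *v y = 0" for y
  proof (rule g0)
    have "E1 *v y \<in> L 2" using on(3)[of y] that by simp
    then have "E1 *v y = 0" using meet[of _ 0 2] on(1) by simp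
    then show "E1 *v y + E2 *v y = 0" using that by simp
  qed
  have inj: "y = 0 \<and> w = 0" if "E1 *v y + E2 *v w = 0" for y w
  proof -
    have "E1 *v y = E2 *v (- w)" using that by (simp add: eq_neg_iff_add_eq_0 vec.linear_neg)
    then have "E1 *v y = 0" using meet[of "E1 *v y" 0 1] on(1)[of y] on(2)[of "- w"] by simp
    then show ?thesis using that a0 b0 by simp
  qed
  have L0: "L 0 = range (\<lambda>y. E1 *v y)" using line_parametrization[OF line[of 0] on(1) a0] by simp
  have L1: "L 1 = range (\<lambda>y. E2 *v y)" using line_parametrization[OF line[of 1] on(2) b0] by simp
  have L2: "L 2 = range (\<lambda>y. E1 *v y + E2 *v y)"
    using line_parametrization[OF line[of 2], of "E1 + E2"] on(3) g0
    by (simp add: matrix_vector_mult_add_rdistrib)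
  obtain h1 h2 where h: "indep2 h1 h2" "L 3 = vec.span {h1, h2}" using line[of 3] proj_line_obtain by auto
  then have h3: "h1 \<in> L 3" "h2 \<in> L 3" by (simp_all add: vec.span_base)
  obtain y1 w1 where yw1: "h1 = E1 *v y1 + E2 *v w1" using dec[of h1] unfolding L0 L1 by blast
  obtain y2 w2 where yw2: "h2 = E1 *v y2 + E2 *v w2" using dec[of h2] unfolding L0 L1 by blast
  obtain Y :: "complex ^ 2 ^ 2" where Y: "\<And>y. Y *v y = y $ 1 *s y1 + y $ 2 *s y2"
    using column_matrix_exists by metis
  obtain W :: "complex ^ 2 ^ 2" where W: "\<And>y. W *v y = y $ 1 *s w1 + y $ 2 *s w2"
    using column_matrix_exists by metis
  have YW: "E1 *v (Y *v s) + E2 *v (W *v s) = s $ 1 *s h1 + s $ 2 *s h2" for s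
    unfolding Y W matrix_vector_mult_combination yw1 yw2 by (simp add: vec_eq_iff algebra_simps)
  \<comment> \<open>\<open>L 3\<close> misses \<open>L 1\<close>, so it projects isomorphically to
    the first summand and is a graph.\<close>
  have "s = 0" if "Y *v s = 0" for s
  proof -
    have eq: "E2 *v (W *v s) = s $ 1 *s h1 + s $ 2 *s h2" using YW[of s] that by simp
    then have "E2 *v (W *v s) \<in> L 3" using closed h3 by auto
    then have "E2 *v (W *v s) = 0" using meet[of _ 1 3] on(2) by simp
    then have "s $ 1 = 0 \<and> s $ 2 = 0" using h(1) eq unfolding indep2_def by metis
    then show ?thesis by (simp add: vec_eq_iff forall_2)
  qed
  then have "\<exists>B. B ** Y = mat 1" by (simp add: matrix_left_invertible_ker)
  then obtain V where "V ** Y = mat 1" ..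
  then have YV: "Y ** V = mat 1" by (simp only: matrix_left_right_inverse)
  define M where "M = W ** V"
  have on3: "E1 *v y + E2 *v (M *v y) \<in> L 3" for y
  proof -
    have "y = Y *v (V *v y)" "M *v y = W *v (V *v y)"
      using YV by (simp_all add: M_def matrix_vector_mul_assoc)
    then have "E1 *v y + E2 *v (M *v y) = (V *v y) $ 1 *s h1 + (V *v y) $ 2 *s h2" using YW by metis
    then show ?thesis using closed h3 by auto
  qed
  have M0: "y = 0" if "M *v y = 0" for y
  proof -
    have "E1 *v y \<in> L 3" using on3[of y] that by simp
    then show ?thesis using meet[of _ 0 3] on(1) a0 by simp
  qed
  have M1: "y = 0" if "M *v y = y" for y
  proof -
    have "E1 *v y + E2 *v y \<in> L 3" using on3[of y] that by simp
    then show ?thesis using meet[of _ 2 3] on(3) g0 by simp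
  qed
  have L3: "L 3 = range (\<lambda>y. E1 *v y + E2 *v (M *v y))"
  proof -
    have m: "(E1 + E2 ** M) *v y = E1 *v y + E2 *v (M *v y)" for y
      by (simp add: matrix_vector_mult_add_rdistrib matrix_vector_mul_assoc)
    have 0: "y = 0" if "E1 *v y + E2 *v (M *v y) = 0" for y using inj[OF that] by blast
    show ?thesis using line_parametrization[OF line[of 3], of "E1 + E2 ** M", unfolded m, OF _ on3 0] by simp
  qed
  show ?thesis
    by (rule exI[of _ E1], rule exI[of _ E2], rule exI[of _ M]) (use inj M0 M1 L0 L1 L2 L3 in simp)
qed

end

text \<open>\<open>Z\<close> lies on the lines \<open>{E1 y}\<close>, \<open>{E2 y}\<close>, \<open>{E1 y + E2 y}\<close>, \<open>{E1 y + E2 (M y)}\<close>, and in each of these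
  parametrizations it consists of the same four directions \<open>y \<in> S\<close>.\<close>

definition frame :: "(complex ^ 4) set set \<Rightarrow> (complex ^ 2) set \<Rightarrow> complex ^ 2 ^ 4 \<Rightarrow> complex ^ 2 ^ 4 \<Rightarrow> complex ^ 2 ^ 2 \<Rightarrow> bool" where
  "frame Z S E1 E2 M \<longleftrightarrow>
    (\<forall>y w. E1 *v y + E2 *v w = 0 \<longrightarrow> y = 0 \<and> w = 0) \<and>
    (\<forall>y. M *v y = 0 \<longrightarrow> y = 0) \<and> (\<forall>y. M *v y = y \<longrightarrow> y = 0) \<and>
    (\<forall>y c. c \<noteq> 0 \<longrightarrow> (c *s y \<in> S \<longleftrightarrow> y \<in> S)) \<and> 0 \<notin> S \<and>
    card (point ` S) = 4 \<and>
    (\<forall>y. M *v y \<in> S \<longleftrightarrow> y \<in> S) \<and> (\<forall>y. y - M *v y \<in> S \<longleftrightarrow> y \<in> S) \<and>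
    Z = (\<lambda>y. point (E1 *v y)) ` S \<union> (\<lambda>y. point (E2 *v y)) ` S \<union>
      (\<lambda>y. point (E1 *v y + E2 *v y)) ` S \<union> (\<lambda>y. point (E1 *v y + E2 *v (M *v y))) ` S"

lemma matrix_span_inj:
  fixes A :: "complex ^ 'n ^ 'm"
  assumes "\<And>y. A *v y = 0 \<Longrightarrow> y = 0"
  shows "point (A *v y) = point (A *v w) \<longleftrightarrow> point y = point w"
proof
  have inj: "inj (\<lambda>v. A *v v)" using assms by (simp add: vec.inj_iff_eq_0)
  assume "point (A *v y) = point (A *v w)"
  then have "(\<lambda>v. A *v v) ` point y = (\<lambda>v. A *v v) ` point w" unfolding matrix_line_image .
  then show "point y = point w" using inj by (simp add: inj_image_eq_iff)
next
  assume "point y = point w"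
  then show "point (A *v y) = point (A *v w)" by (simp add: matrix_line_image[symmetric])
qed

lemma (in quartic_lines) frame_exists:
  assumes nonplanar: "\<not> (\<exists>H. proj_plane H \<and> (\<forall>i<4. L i \<subseteq> H))"
  shows "\<exists>S E1 E2 M. frame (\<Union>i<4. zero_points f (L i)) S E1 E2 M"
proof -
  obtain E1 E2 :: "complex ^ 2 ^ 4" and M :: "complex ^ 2 ^ 2" where
    inj: "\<forall>y w. E1 *v y + E2 *v w = 0 \<longrightarrow> y = 0 \<and> w = 0" and
    M: "\<forall>y. M *v y = 0 \<longrightarrow> y = 0" "\<forall>y. M *v y = y \<longrightarrow> y = 0" and
    L: "L 0 = range (\<lambda>y. E1 *v y)" "L 1 = range (\<lambda>y. E2 *v y)"
    "L 2 = range (\<lambda>y. E1 *v y + E2 *v y)" "L 3 = range (\<lambda>y. E1 *v y + E2 *v (M *v y))"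
  proof -
    have "\<forall>i<4. \<forall>j<4. i \<noteq> j \<longrightarrow> skew (L i) (L j)" using lines_skew[OF nonplanar] by simp
    from coordinates[OF this] show ?thesis using that by (elim exE conjE)
  qed
  define S where "S = {y. y \<noteq> 0 \<and> f (E1 *v y) = 0}"
  have a0: "E1 *v y = 0 \<Longrightarrow> y = 0" for y using inj[rule_format, of y 0] by simp
  have mm: "(E1 + E2) *v y = E1 *v y + E2 *v y" "(E1 + E2 ** M) *v y = E1 *v y + E2 *v (M *v y)"
    "(E1 - E1 ** M) *v y = E1 *v (y - M *v y)" "(E2 ** M) *v y = E2 *v (M *v y)"
    "((E1 + E2) ** M) *v y = E1 *v (M *v y) + E2 *v (M *v y)"
    "(- (E1 + E2)) *v y = - (E1 *v y + E2 *v y)" "(- (E1 + E2 ** M)) *v y = - (E1 *v y + E2 *v (M *v y))" for y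
    unfolding matrix_minus_mult matrix_vector_mult_add_rdistrib matrix_vector_mult_diff_rdistrib
      matrix_vector_mult_diff_distrib matrix_vector_mul_assoc[symmetric] by simp_all
  have neg: "- x \<in> L i" if "x \<in> L i" "i < 4" for x i
    using that subspace by (intro vec.subspace_neg)
  have on: "E1 *v y \<in> L 0" "E2 *v y \<in> L 1" "E1 *v y + E2 *v y \<in> L 2" "E1 *v y + E2 *v (M *v y) \<in> L 3" for y
    unfolding L by blast+
  have 012: "f (E1 *v y) = 0 \<longleftrightarrow> f (E1 *v y + E2 *v y) = 0" "f (E2 *v y) = 0 \<longleftrightarrow> f (E1 *v y + E2 *v y) = 0" for y
  proof -
    have p: "(- (E1 + E2)) *v y \<in> L 2" for y unfolding mm by (rule neg[OF on(3)]) simp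
    have z: "E1 *v y + E2 *v y + (- (E1 + E2)) *v y = 0" for y unfolding mm by simp
    show "f (E1 *v y) = 0 \<longleftrightarrow> f (E1 *v y + E2 *v y) = 0" "f (E2 *v y) = 0 \<longleftrightarrow> f (E1 *v y + E2 *v y) = 0"
      using transfer_iff[where i = 0 and j = 1 and k = 2, OF _ _ _ on(1,2) p z inj[rule_format], of y]
      unfolding mm even by simp_all
  qed
  have 013: "f (E1 *v y) = 0 \<longleftrightarrow> f (E1 *v y + E2 *v (M *v y)) = 0"
    "f (E2 *v (M *v y)) = 0 \<longleftrightarrow> f (E1 *v y + E2 *v (M *v y)) = 0" for y
  proof -
    have p: "(- (E1 + E2 ** M)) *v y \<in> L 3" for y unfolding mm by (rule neg[OF on(4)]) simp
    have o: "(E2 ** M) *v y \<in> L 1" for y unfolding mm by (rule on)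
    have z: "E1 *v y + (E2 ** M) *v y + (- (E1 + E2 ** M)) *v y = 0" for y unfolding mm by simp
    have i: "y = 0 \<and> w = 0" if "E1 *v y + (E2 ** M) *v w = 0" for y w
      using inj[rule_format, of y "M *v w"] that M(1) unfolding mm by blast
    show "f (E1 *v y) = 0 \<longleftrightarrow> f (E1 *v y + E2 *v (M *v y)) = 0"
      "f (E2 *v (M *v y)) = 0 \<longleftrightarrow> f (E1 *v y + E2 *v (M *v y)) = 0"
      using transfer_iff[where i = 0 and j = 1 and k = 3, OF _ _ _ on(1) o p z i, of y]
      unfolding mm even by simp_all
  qed
  have 023: "f (E1 *v (y - M *v y)) = 0 \<longleftrightarrow> f (E1 *v y + E2 *v (M *v y)) = 0" for y
  proof -
    have "f ((E1 - E1 ** M) *v y) = 0 \<longleftrightarrow> f ((- (E1 + E2 ** M)) *v y) = 0"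
    proof (rule transfer_iff(1)[of 0 2 3])
      show "(E1 - E1 ** M) *v y \<in> L 0" "((E1 + E2) ** M) *v y \<in> L 2" "(- (E1 + E2 ** M)) *v y \<in> L 3" for y
        unfolding mm by (rule on, rule on, rule neg[OF on(4)], simp)
      show "(E1 - E1 ** M) *v y + ((E1 + E2) ** M) *v y + (- (E1 + E2 ** M)) *v y = 0" for y
        unfolding mm by (simp add: matrix_vector_mult_diff_distrib)
      show "y = 0 \<and> w = 0" if "(E1 - E1 ** M) *v y + ((E1 + E2) ** M) *v w = 0" for y w
      proof -
        have "E1 *v (y - M *v y + M *v w) + E2 *v (M *v w) = 0"
          using that unfolding mm by (simp add: matrix_vector_right_distrib add.assoc)
        then have "y - M *v y + M *v w = 0" "M *v w = 0" using inj by blast+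
        then show ?thesis using M by simp
      qed
    qed simp_all
    then show ?thesis unfolding mm even .
  qed
  have SM: "M *v y \<in> S \<longleftrightarrow> y \<in> S" for y
    using 012[of "M *v y"] 013[of y] M(1) by (auto simp: S_def)
  have SN: "y - M *v y \<in> S \<longleftrightarrow> y \<in> S" for y
    using 023[of y] 013[of y] M(2)[rule_format, of y] by (auto simp: S_def)
  have Sc: "c *s y \<in> S \<longleftrightarrow> y \<in> S" if "c \<noteq> 0" for c y
    using that form_fun_scale[OF form] by (simp add: S_def vector_scalar_commute)
  have zp: "zero_points f (range (\<lambda>y. A *v y)) = (\<lambda>y. point (A *v y)) ` {y. y \<noteq> 0 \<and> f (A *v y) = 0}"
    if "\<And>y. A *v y = 0 \<Longrightarrow> y = 0" for A :: "complex ^ 2 ^ 4"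
    unfolding zero_points_def using that by (auto; metis matrix_vector_mult_0_right)
  have z0: "zero_points f (L 0) = (\<lambda>y. point (E1 *v y)) ` S"
    unfolding L S_def by (rule zp[OF a0])
  have z1: "zero_points f (L 1) = (\<lambda>y. point (E2 *v y)) ` S"
    unfolding L S_def using zp[of E2] inj[rule_format, of 0] 012 by simp
  have z2: "zero_points f (L 2) = (\<lambda>y. point (E1 *v y + E2 *v y)) ` S"
    unfolding L S_def using zp[of "E1 + E2"] inj 012 by (simp add: mm)
  have z3: "zero_points f (L 3) = (\<lambda>y. point (E1 *v y + E2 *v (M *v y))) ` S"
    unfolding L S_def using zp[of "E1 + E2 ** M"] inj 013 by (simp add: mm)
  have "inj_on (\<lambda>p. (\<lambda>v. E1 *v v) ` p) (point ` S)"
    by (rule inj_onI) (auto simp: matrix_line_image matrix_span_inj[OF a0])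
  moreover have "(\<lambda>p. (\<lambda>v. E1 *v v) ` p) ` point ` S = zero_points f (L 0)"
    unfolding z0 by (simp add: image_image matrix_line_image)
  ultimately have card: "card (point ` S) = 4" using card_zeros[of 0] card_image by fastforce
  have "(\<Union>i<4. zero_points f (L i)) = zero_points f (L 0) \<union> zero_points f (L 1) \<union> zero_points f (L 2) \<union> zero_points f (L 3)"
    by (auto simp: eval_nat_numeral lessThan_Suc)
  then have "frame (\<Union>i<4. zero_points f (L i)) S E1 E2 M"
    unfolding frame_def z0 z1 z2 z3
    by (intro conjI) (use inj M Sc SM SN card S_def in \<open>blast | simp add: S_def\<close>)+
  then show ?thesis by blast
qed

text \<open>Maps with the same fibres have images of the same size; this counts the transversals by
  their directions.\<close>

lemma card_image_cong_iff:
  assumes "\<And>x y. x \<in> S \<Longrightarrow> y \<in> S \<Longrightarrow> f x = f y \<longleftrightarrow> g x = g y"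
  shows "card (f ` S) = card (g ` S)"
proof -
  define h where "h z = g (SOME x. x \<in> S \<and> f x = z)" for z
  have h: "h (f x) = g x" if "x \<in> S" for x
  proof -
    have "(SOME y. y \<in> S \<and> f y = f x) \<in> S \<and> f (SOME y. y \<in> S \<and> f y = f x) = f x"
      by (rule someI[of _ x]) (use that in simp)
    then show ?thesis unfolding h_def using assms that by blast
  qed
  have "inj_on h (f ` S)"
    by (rule inj_onI) (auto simp: h assms)
  moreover have "h ` f ` S = g ` S"
    by (auto simp: image_image h)
  ultimately show ?thesis using card_image by metis
qed

section \<open>Consequences of a frame\<close>

lemma frameD:
  assumes "frame Z S E1 E2 M"
  shows "E1 *v y + E2 *v w = 0 \<Longrightarrow> y = 0 \<and> w = 0" "M *v y = 0 \<Longrightarrow> y = 0" "M *v y = y \<Longrightarrow> y = 0"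
    "c \<noteq> 0 \<Longrightarrow> c *s y \<in> S \<longleftrightarrow> y \<in> S" "0 \<notin> S" "card (point ` S) = 4"
    "M *v y \<in> S \<longleftrightarrow> y \<in> S" "y - M *v y \<in> S \<longleftrightarrow> y \<in> S"
  using assms unfolding frame_def by blast+

lemma frame_points:
  assumes "frame Z S E1 E2 M"
  shows "Z = (\<lambda>y. point (E1 *v y)) ` S \<union> (\<lambda>y. point (E2 *v y)) ` S \<union>
    (\<lambda>y. point (E1 *v y + E2 *v y)) ` S \<union> (\<lambda>y. point (E1 *v y + E2 *v (M *v y))) ` S"
  using assms unfolding frame_def by (elim conjE)

lemma frame_inj:
  assumes "frame Z S E1 E2 M" "E1 *v y + E2 *v w = E1 *v y' + E2 *v w'"
  shows "y = y' \<and> w = w'"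
proof -
  have "E1 *v (y - y') + E2 *v (w - w') = 0"
    using assms(2) by (simp add: matrix_vector_mult_diff_distrib algebra_simps)
  then have "y - y' = 0 \<and> w - w' = 0" by (rule frameD(1)[OF assms(1)])
  then show ?thesis by simp
qed

text \<open>A scalar \<open>M\<close> would make the lines joining \<open>E1 y\<close> and \<open>E2 y\<close> transversal to all four lines.\<close>

lemma frame_scalar_grid:
  assumes F: "frame Z S E1 E2 M" and M: "\<And>y. M *v y = c *s y"
  shows "grid 4 4 Z"
proof -
  note S0 = frameD(5)[OF F] and card = frameD(6)[OF F] and M0 = frameD(2)[OF F] and M1 = frameD(3)[OF F]
  define e :: "complex ^ 2" where "e = axis 1 1"
  have "e $ 1 \<noteq> 0" by (simp add: e_def)
  then have e: "e \<noteq> 0" by auto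
  have c: "c \<noteq> 0" "c \<noteq> 1" using M0[of e] M1[of e] e unfolding M by auto
  \<comment> \<open>\<open>g\<close> is the Segre parametrization of a quadric, the tensor product
    of \<open>k\<close> and \<open>y\<close>. Fixing \<open>k\<close> or \<open>y\<close> gives the
    two rulings, and \<open>K\<close> lists the parameters of the four given lines.\<close>
  define g where "g k y = fst k *s (E1 *v y) + snd k *s (E2 *v y)" for k :: "complex \<times> complex" and y
  define K :: "(complex \<times> complex) set" where "K = {(1, 0), (0, 1), (1, 1), (1, c)}"
  have K4: "card K = 4" using c by (simp add: K_def)
  have det: "fst k * snd k' - fst k' * snd k \<noteq> 0" if "k \<in> K" "k' \<in> K" "k \<noteq> k'" for k k'
    using that c by (auto simp: K_def)
  have k0: "fst k \<noteq> 0 \<or> snd k \<noteq> 0" if "k \<in> K" for k using that by (auto simp: K_def)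
  have g_alt: "g k y = E1 *v (fst k *s y) + E2 *v (snd k *s y)" for k y
    by (simp add: g_def vector_scalar_commute)
  have g_inj: "fst k *s y = fst k' *s y' \<and> snd k *s y = snd k' *s y'" if "g k y = g k' y'" for k k' y y'
    using frame_inj[OF F] that unfolding g_alt by blast
  have g_0: "g k 0 = 0" "g (0, 0) y = 0" for k y by (simp_all add: g_def)
  have g_ne: "g k y \<noteq> 0" if "k \<in> K" "y \<noteq> 0" for k y
  proof
    assume "g k y = 0"
    then have "g k y = g k 0" by (simp add: g_0)
    from g_inj[OF this] show False using k0[OF that(1)] that(2) by auto
  qed
  have g_scale: "g k (r *s y) = r *s g k y" for k r y
    by (simp add: g_def vector_scalar_commute vec_eq_iff algebra_simps)
  have g_lin: "g k (r *s y + t *s y') = r *s g k y + t *s g k y'" for k r t y y'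
    unfolding g_scale[symmetric]
    by (simp add: g_def matrix_vector_right_distrib vec.scale_right_distrib add_ac)
  define Ml where "Ml y = {g k y | k. True}" for y
  define Ll where "Ll k = range (g k)" for k
  have Ml: "Ml y = vec.span {E1 *v y, E2 *v y}" for y
    unfolding Ml_def span_pair g_def by (auto; force)
  have Ml_line: "proj_line (Ml y)" if "y \<noteq> 0" for y
    unfolding Ml
  proof (rule proj_line_span, unfold indep2_def, intro allI impI)
    fix s t assume "s *s (E1 *v y) + t *s (E2 *v y) = 0"
    then have "g (s, t) y = g (0, 0) y" by (simp add: g_def)
    from g_inj[OF this] show "s = 0 \<and> t = 0" using that by simp
  qed
  have Ll_line: "proj_line (Ll k)" if "k \<in> K" for k
  proof -
    define e' :: "complex ^ 2" where "e' = axis 2 1"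
    have "Ll k = vec.span {g k e, g k e'}"
    proof (intro equalityI subsetI)
      fix x assume "x \<in> Ll k"
      then obtain y where y: "x = g k y" by (auto simp: Ll_def)
      have "y = y $ 1 *s e + y $ 2 *s e'" by (simp add: e_def e'_def vec_eq_iff forall_2 axis_def)
      then have "g k y = y $ 1 *s g k e + y $ 2 *s g k e'" by (metis g_lin)
      then show "x \<in> vec.span {g k e, g k e'}" unfolding y span_pair by blast
    next
      fix x assume "x \<in> vec.span {g k e, g k e'}"
      then obtain s t where "x = s *s g k e + t *s g k e'" unfolding span_pair by blast
      then have "x = g k (s *s e + t *s e')" by (simp only: g_lin)
      then show "x \<in> Ll k" by (simp add: Ll_def)
    qed
    moreover have "indep2 (g k e) (g k e')"
      unfolding indep2_def
    proof (intro allI impI)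
      fix s t assume "s *s g k e + t *s g k e' = 0"
      then have "g k (s *s e + t *s e') = 0" by (simp only: g_lin)
      then have "s *s e + t *s e' = 0" using g_ne[OF that] by blast
      then show "s = 0 \<and> t = 0" by (simp add: e_def e'_def vec_eq_iff forall_2 axis_def)
    qed
    ultimately show ?thesis using proj_line_span by simp
  qed
  have zero_in: "0 \<in> Ll k" "0 \<in> Ml y" for k y
    unfolding Ll_def Ml_def using g_0 by (metis rangeI, metis (mono_tags, lifting) mem_Collect_eq)
  have Ll_skew: "skew (Ll k) (Ll k')" if kk: "k \<in> K" "k' \<in> K" "k \<noteq> k'" for k k'
  proof -
    have "x = 0" if mem: "x \<in> Ll k" "x \<in> Ll k'" for x
    proof -
      obtain y where y: "x = g k y" using mem(1) by (auto simp: Ll_def)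
      obtain y' where y': "x = g k' y'" using mem(2) by (auto simp: Ll_def)
      have eq: "fst k *s y = fst k' *s y'" "snd k *s y = snd k' *s y'" using g_inj y y' by blast+
      have "(fst k * snd k' - fst k' * snd k) *s y = snd k' *s (fst k *s y) - fst k' *s (snd k *s y)"
        by (simp add: vec_eq_iff algebra_simps)
      also have "\<dots> = 0" unfolding eq by (simp add: mult.commute)
      finally have "y = 0" using det[OF kk] by simp
      then show "x = 0" unfolding y by (simp add: g_0)
    qed
    then show ?thesis using zero_in(1)[of k] zero_in(1)[of k'] unfolding skew_def by blast
  qed
  have Ml_skew: "skew (Ml y) (Ml y')" if yy: "y \<noteq> 0" "y' \<noteq> 0" "point y \<noteq> point y'" for y y'
  proof -
    have ind: "indep2 y y'" using indep2_span_ne[OF yy] .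
    have z: "s = 0" if "s *s y = s' *s y'" for s s'
    proof -
      have "s *s y + (- s') *s y' = 0" using that by simp
      then show ?thesis using ind unfolding indep2_def by blast
    qed
    have "x = 0" if mem: "x \<in> Ml y" "x \<in> Ml y'" for x
    proof -
      obtain k where k: "x = g k y" using mem(1) by (auto simp: Ml_def)
      obtain k' where k': "x = g k' y'" using mem(2) by (auto simp: Ml_def)
      have "fst k = 0" "snd k = 0" using z g_inj k k' by blast+
      then show "x = 0" unfolding k g_def by simp
    qed
    then show ?thesis using zero_in(2)[of y] zero_in(2)[of y'] unfolding skew_def by blast
  qed
  have meet: "Ll k \<inter> Ml y = point (g k y)" if "k \<in> K" "y \<noteq> 0" for k y
  proof (intro equalityI subsetI)
    fix x assume "x \<in> Ll k \<inter> Ml y"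
    then obtain y' k' where x: "x = g k y'" "x = g k' y" unfolding Ll_def Ml_def by blast
    then have "g k y' = g k' y" by simp
    from g_inj[OF this] have eq: "fst k *s y' = fst k' *s y" "snd k *s y' = snd k' *s y" by blast+
    have "\<exists>r. y' = r *s y"
    proof (cases "fst k = 0")
      case False
      then have "y' = (fst k' / fst k) *s y" using eq(1) by (simp add: vec_eq_iff field_simps)
      then show ?thesis by blast
    next
      case True
      then have "y' = (snd k' / snd k) *s y" using eq(2) k0[OF that(1)] by (simp add: vec_eq_iff field_simps)
      then show ?thesis by blast
    qed
    then obtain r where "y' = r *s y" ..
    then have "x = r *s g k y" unfolding x(1) by (simp only: g_scale)
    then show "x \<in> point (g k y)" unfolding vec.span_singleton by blast
  next
    fix x assume "x \<in> point (g k y)"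
    then obtain r where r: "x = r *s g k y" by (auto simp: vec.span_singleton)
    have "x = g (r * fst k, r * snd k) y" unfolding r by (simp add: g_def vec_eq_iff algebra_simps)
    then have "x \<in> Ml y" unfolding Ml_def by blast
    moreover have "x \<in> Ll k" unfolding Ll_def r g_scale[symmetric] by (rule rangeI)
    ultimately show "x \<in> Ll k \<inter> Ml y" by blast
  qed
  have ne0: "N \<noteq> {0}" if "proj_line N" for N :: "(complex ^ 4) set" using that by (auto simp: proj_line_def)
  have skew_ne: "N \<noteq> N'" if "proj_line N" "skew N N'" for N N' :: "(complex ^ 4) set"
    using ne0[OF that(1)] that(2) by (auto simp: skew_def)
  have Ml_sub: "Ml (r *s y) \<subseteq> Ml y" for r y
  proof
    fix x assume "x \<in> Ml (r *s y)"
    then obtain k where "x = g k (r *s y)" unfolding Ml_def by blast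
    then have "x = g (r * fst k, r * snd k) y" by (simp add: g_def vector_scalar_commute mult.commute)
    then show "x \<in> Ml y" unfolding Ml_def by blast
  qed
  have Ml_eq: "Ml y = Ml y'" if h: "point y = point y'" "y' \<noteq> 0" for y y'
  proof -
    obtain r where r: "r \<noteq> 0" "y = r *s y'" using span_eq_iff[OF h(2), of y] h(1) by blast
    then have "y' = inverse r *s y" by simp
    then show ?thesis using Ml_sub r(2) by (metis subset_antisym)
  qed
  have Ml_iff: "Ml y = Ml y' \<longleftrightarrow> point y = point y'" if "y \<in> S" "y' \<in> S" for y y'
  proof -
    have "y \<noteq> 0" "y' \<noteq> 0" using that S0 by auto
    then show ?thesis using Ml_eq Ml_skew skew_ne[OF Ml_line] by blast
  qed
  have cardM: "card (Ml ` S) = 4" using card card_image_cong_iff[of S Ml point, OF Ml_iff] by simp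
  have "inj_on Ll K" by (rule inj_onI) (use Ll_skew Ll_line skew_ne in blast)
  then have cardL: "card (Ll ` K) = 4" using K4 by (simp add: card_image)
  have Z: "Z = {L \<inter> M | L M. L \<in> Ll ` K \<and> M \<in> Ml ` S}"
  proof -
    have "{L \<inter> M | L M. L \<in> Ll ` K \<and> M \<in> Ml ` S} = {Ll k \<inter> Ml y | k y. k \<in> K \<and> y \<in> S}" by blast
    also have "\<dots> = {point (g k y) | k y. k \<in> K \<and> y \<in> S}"
      using meet S0 by (intro Collect_cong) metis
    also have "\<dots> = (\<lambda>y. point (g (1, 0) y)) ` S \<union> (\<lambda>y. point (g (0, 1) y)) ` S \<union>
        (\<lambda>y. point (g (1, 1) y)) ` S \<union> (\<lambda>y. point (g (1, c) y)) ` S"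
      unfolding K_def by blast
    also have "\<dots> = Z" unfolding frame_points[OF F] g_def M by (simp add: vector_scalar_commute)
    finally show ?thesis ..
  qed
  have S_ne: "y \<noteq> 0" if "y \<in> S" for y using S0 that by auto
  show ?thesis
    unfolding grid_def
  proof (rule exI[of _ "Ll ` K"], rule exI[of _ "Ml ` S"], intro conjI)
    show "finite (Ll ` K)" "finite (Ml ` S)" using cardL cardM by (simp_all add: card_ge_0_finite)
    show "card (Ll ` K) = 4" "card (Ml ` S) = 4" by fact+
    show "\<forall>L\<in>Ll ` K. proj_line L" "\<forall>M\<in>Ml ` S. proj_line M" using Ll_line Ml_line S_ne by auto
    show "\<forall>L\<in>Ll ` K. \<forall>L'\<in>Ll ` K. L \<noteq> L' \<longrightarrow> skew L L'" using Ll_skew by blast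
    show "\<forall>M\<in>Ml ` S. \<forall>M'\<in>Ml ` S. M \<noteq> M' \<longrightarrow> skew M M'"
    proof (intro ballI impI)
      fix M M' assume "M \<in> Ml ` S" "M' \<in> Ml ` S" "M \<noteq> M'"
      then obtain y y' where y: "y \<in> S" "y' \<in> S" "M = Ml y" "M' = Ml y'" "Ml y \<noteq> Ml y'" by blast
      then have "point y \<noteq> point y'" using Ml_iff by blast
      then show "skew M M'" unfolding y(3,4) using Ml_skew S_ne y(1,2) by blast
    qed
    show "\<forall>L\<in>Ll ` K. \<forall>M\<in>Ml ` S. L \<inter> M \<in> proj_points"
    proof (intro ballI)
      fix L M assume "L \<in> Ll ` K" "M \<in> Ml ` S"
      then obtain k y where "k \<in> K" "y \<in> S" "L = Ll k" "M = Ml y" by blast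
      then have "L \<inter> M = point (g k y)" "g k y \<noteq> 0" using meet g_ne S_ne by blast+
      then show "L \<inter> M \<in> proj_points" unfolding proj_points_def by blast
    qed
    show "Z = {L \<inter> M | L M. L \<in> Ll ` K \<and> M \<in> Ml ` S}" by (rule Z)
  qed
qed

section \<open>The matrix \<open>M\<close>\<close>

lemma span_minus: "point (- x) = point x" for x :: "complex ^ 'n"
  using span_scale_eq[of "-1" x] by simp

text \<open>Exchanges the first and third lines. The fourth line is unchanged because
  \<open>E1 y + E2 (M y) = (E1 + E2) y - E2 (y - M y)\<close>.\<close>

lemma frame_swap_13:
  assumes "frame Z S E1 E2 M"
  shows "frame Z S (E1 + E2) (- E2) (mat 1 - M)"
proof -
  have mm: "(E1 + E2) *v y = E1 *v y + E2 *v y" "(mat 1 - M) *v w = w - M *v w" for y w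
    by (simp_all add: matrix_vector_mult_add_rdistrib matrix_vector_mult_diff_rdistrib)
  have inj: "y = 0 \<and> w = 0" if "E1 *v y + E2 *v y - E2 *v w = 0" for y w
  proof -
    have "E1 *v y + E2 *v (y - w) = 0" using that by (simp add: matrix_vector_mult_diff_distrib add_diff_eq)
    then have "y = 0 \<and> y - w = 0" by (rule frameD(1)[OF assms])
    then show ?thesis by auto
  qed
  have 4: "E1 *v y + E2 *v y - E2 *v (y - M *v y) = E1 *v y + E2 *v (M *v y)" for y
    by (simp add: matrix_vector_mult_diff_distrib)
  have M: "w = 0" if "w - M *v w = 0 \<or> w - M *v w = w" for w
  proof -
    have "M *v w = w \<or> M *v w = 0" using that by auto
    then show ?thesis using frameD(2,3)[OF assms] by blast
  qed
  show ?thesis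
    using assms inj M unfolding frame_def mm matrix_minus_mult
    by (simp add: 4 span_minus Un_ac)
qed

text \<open>Exchanges the first two lines. The fourth is reparametrized by \<open>M y\<close>, which
  preserves \<open>S\<close>, so \<open>M\<close> turns into its inverse.\<close>

lemma frame_swap_12:
  assumes "frame Z S E1 E2 M"
  obtains N where "M ** N = mat 1" "N ** M = mat 1" "frame Z S E2 E1 N"
proof -
  have "\<forall>y. M *v y = 0 \<longrightarrow> y = 0" using frameD(2)[OF assms] by blast
  then have "\<exists>N. N ** M = mat 1" by (simp only: matrix_left_invertible_ker)
  then obtain N where NM: "N ** M = mat 1" ..
  then have MN: "M ** N = mat 1" by (simp only: matrix_left_right_inverse)
  have inv: "M *v (N *v y) = y" "N *v (M *v y) = y" for y
    using NM MN by (simp_all add: matrix_vector_mul_assoc)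
  have inj: "y = 0 \<and> w = 0" if "E2 *v y + E1 *v w = 0" for y w
    using frameD(1)[OF assms, of w y] that by (simp add: add.commute)
  have N0: "y = 0" if "N *v y = 0" for y using inv(1)[of y] that by simp
  have N1: "y = 0" if "N *v y = y" for y
  proof -
    have "M *v y = y" using inv(1)[of y] that by simp
    then show ?thesis using frameD(2,3)[OF assms] by blast
  qed
  note SM = frameD(7,8)[OF assms] and Sc = frameD(4)[OF assms]
  have SN: "N *v y \<in> S \<longleftrightarrow> y \<in> S" for y using SM(1)[of "N *v y"] by (simp only: inv)
  have "y - N *v y \<in> S \<longleftrightarrow> y \<in> S" for y
  proof -
    have "y - N *v y = (-1) *s (N *v y - M *v (N *v y))" by (simp only: inv) simp
    moreover have "(-1) *s x \<in> S \<longleftrightarrow> x \<in> S" for x by (rule Sc) simp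
    ultimately have "y - N *v y \<in> S \<longleftrightarrow> N *v y - M *v (N *v y) \<in> S" by (simp only:)
    then show ?thesis using SM(2) SN by blast
  qed
  note SN' = this
  have four: "(\<lambda>y. point (E1 *v y + E2 *v (M *v y))) ` S = (\<lambda>y. point (E2 *v y + E1 *v (N *v y))) ` S"
  proof (intro equalityI subsetI)
    fix p assume "p \<in> (\<lambda>y. point (E1 *v y + E2 *v (M *v y))) ` S"
    then obtain y where "y \<in> S" "p = point (E1 *v y + E2 *v (M *v y))" by blast
    then have "M *v y \<in> S" "p = point (E2 *v (M *v y) + E1 *v (N *v (M *v y)))"
      by (simp_all only: inv SM add.commute)
    then show "p \<in> (\<lambda>y. point (E2 *v y + E1 *v (N *v y))) ` S" by blast
  next
    fix p assume "p \<in> (\<lambda>y. point (E2 *v y + E1 *v (N *v y))) ` S"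
    then obtain y where "y \<in> S" "p = point (E2 *v y + E1 *v (N *v y))" by blast
    then have "N *v y \<in> S" "p = point (E1 *v (N *v y) + E2 *v (M *v (N *v y)))"
      by (simp_all only: inv SN add.commute)
    then show "p \<in> (\<lambda>y. point (E1 *v y + E2 *v (M *v y))) ` S" by blast
  qed
  have "frame Z S E2 E1 N"
    unfolding frame_def
  proof (intro conjI)
    have "(\<lambda>y. point (E1 *v y + E2 *v y)) = (\<lambda>y. point (E2 *v y + E1 *v y))"
      by (simp only: add.commute)
    then show "Z = (\<lambda>y. point (E2 *v y)) ` S \<union> (\<lambda>y. point (E1 *v y)) ` S \<union>
        (\<lambda>y. point (E2 *v y + E1 *v y)) ` S \<union> (\<lambda>y. point (E2 *v y + E1 *v (N *v y))) ` S"
      unfolding frame_points[OF assms] four by (simp only: Un_ac)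
    show "0 \<notin> S" "card (point ` S) = 4" by (rule frameD[OF assms])+
  qed (use inj N0 N1 SN SN' Sc in blast)+
  then show ?thesis using that MN NM by blast
qed

lemma plane_coordinates:
  fixes x y z :: "complex ^ 2"
  assumes "indep2 x y"
  obtains s t where "z = s *s x + t *s y"
proof -
  have "proj_line (UNIV :: (complex ^ 2) set)"
    by (simp add: proj_line_def vec.dim_UNIV card_cart_basis)
  then have "UNIV = vec.span {x, y}" by (rule line_through_points) (use assms in auto)
  then have "z \<in> vec.span {x, y}" by blast
  then show ?thesis using that unfolding span_pair by blast
qed

lemma frame_finite_on_line:
  assumes "frame Z S E1 E2 M" "indep2 x y"
  shows "finite {t. x + t *s y \<in> S}" "card {t. x + t *s y \<in> S} \<le> 4"
proof -
  let ?T = "{t. x + t *s y \<in> S}" and ?D = "point ` S"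
  note card = frameD(6)[OF assms(1)]
  then have fin: "finite ?D" by (simp add: card_ge_0_finite)
  have inj: "inj_on (\<lambda>t. point (x + t *s y)) ?T" using span_line_inj[OF assms(2)] by (rule inj_onI)
  have sub: "(\<lambda>t. point (x + t *s y)) ` ?T \<subseteq> ?D" by blast
  show "finite ?T" by (rule inj_on_finite[OF inj sub fin])
  show "card ?T \<le> 4" using card_inj_on_le[OF inj sub fin] card by simp
qed

text \<open>A linear map of the plane with three eigenlines is scalar.\<close>

lemma frame_not_eigenvector:
  assumes F: "frame Z S E1 E2 M" and "\<not> (\<exists>c. \<forall>y. M *v y = c *s y)"
  shows "\<exists>u\<in>S. indep2 u (M *v u)"
proof (rule ccontr)
  assume n: "\<not> ?thesis"
  note S0 = frameD(5)[OF F] and card = frameD(6)[OF F]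
  have eig: "\<exists>a. M *v y = a *s y" if "y \<in> S" for y
  proof -
    have "y \<noteq> 0" using S0 that by auto
    then show ?thesis using n that indep2_iff[of y "M *v y"] by (auto simp: vec.span_singleton)
  qed
  have "3 \<le> card (point ` S)" using card by simp
  then obtain D where "D \<subseteq> point ` S" "card D = 3" using obtain_subset_with_card_n by metis
  then obtain P Q R where PQR: "{P, Q, R} \<subseteq> point ` S" "P \<noteq> Q" "Q \<noteq> R" "P \<noteq> R"
    by (metis card_3_iff)
  then have "P \<in> point ` S" "Q \<in> point ` S" "R \<in> point ` S"
    by simp_all
  then obtain x y z where xyz: "x \<in> S" "y \<in> S" "z \<in> S"
    and e: "P = point x" "Q = point y" "R = point z" by (elim imageE)
  have ne: "point x \<noteq> point y" "point y \<noteq> point z" "point x \<noteq> point z"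
    using PQR(2-4) unfolding e .
  have nz: "x \<noteq> 0" "y \<noteq> 0" "z \<noteq> 0" using xyz S0 by auto
  have ind: "indep2 x y" using indep2_span_ne nz ne by blast
  obtain s t where z: "z = s *s x + t *s y" using plane_coordinates[OF ind] .
  have st: "s \<noteq> 0" "t \<noteq> 0"
    using ne(2,3) nz(3) span_scale_eq[of s x] span_scale_eq[of t y] unfolding z by auto
  obtain a b c where abc: "M *v x = a *s x" "M *v y = b *s y" "M *v z = c *s z" using eig xyz by metis
  have "(s * (a - c)) *s x + (t * (b - c)) *s y = 0"
    using abc(3) unfolding z matrix_vector_mult_combination abc(1,2) by (simp add: vec_eq_iff algebra_simps)
  then have "s * (a - c) = 0 \<and> t * (b - c) = 0" using ind unfolding indep2_def by blast
  then have "a = c" "b = c" using st by auto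
  have "M *v v = c *s v" for v
  proof -
    obtain p q where v: "v = p *s x + q *s y" using plane_coordinates[OF ind] .
    show ?thesis
      unfolding v matrix_vector_mult_combination abc(1,2) \<open>a = c\<close> \<open>b = c\<close> by (simp add: vec_eq_iff algebra_simps)
  qed
  then show False using assms(2) by blast
qed

text \<open>Multiplication by \<open>a\<close> permutes \<open>U\<close>, so the nonzero product of
  all elements is multiplied by \<open>a ^ card U\<close> and stays the same.\<close>

lemma root_of_unity_of_invariant:
  fixes U :: "complex set"
  assumes "finite U" "0 \<notin> U" "\<And>t. t \<in> U \<Longrightarrow> a * t \<in> U" "a \<noteq> 0"
  shows "a ^ card U = 1"
proof -
  have inj: "inj_on ((*) a) U" using assms(4) by (auto intro: inj_onI)
  have "(*) a ` U = U" using assms(1,3) inj by (intro endo_inj_surj) auto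
  then have "\<Prod>U = (\<Prod>t\<in>U. a * t)" using prod.reindex[OF inj, of "\<lambda>t. t"] by simp
  also have "\<dots> = a ^ card U * \<Prod>U" by (simp add: prod.distrib)
  finally have "\<Prod>U = a ^ card U * \<Prod>U" .
  moreover have "\<Prod>U \<noteq> 0" using assms(1,2) by (simp add: prod_zero_iff)
  ultimately show ?thesis by (simp only: mult_cancel_right1) simp
qed

text \<open>If \<open>m1\<close>, \<open>m2\<close> are the eigenvalues of \<open>M\<close>, then \<open>M\<close> and \<open>1 - M\<close> act on the affine coordinate \<open>t\<close> of
  \<open>v1 + t v2\<close> as multiplication by \<open>a = m2 / m1\<close> and \<open>b = (1 - m2) / (1 - m1)\<close>. Both preserve the finite
  set \<open>U\<close> of nonzero coordinates of \<open>S\<close>, so both are roots of unity of order dividing \<open>card U\<close>.\<close>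

lemma frame_quadratic:
  assumes F: "frame Z S E1 E2 M" and u: "u \<in> S" "indep2 u (M *v u)"
  shows "\<exists>q p. (\<forall>y. M *v (M *v y) = q *s (M *v y) + p *s y) \<and>
    (q = 1 \<and> p = -1 \<and> (\<exists>w\<in>S. \<exists>m. M *v w = m *s w) \<or>
     q = 0 \<and> p = -1 \<or> q = 2 \<and> p = -2 \<or> q = 1 \<and> p = - 1 / 2)"
proof -
  define u' where "u' = M *v u"
  have uu: "indep2 u u'" using u(2) unfolding u'_def .
  note S0 = frameD(5)[OF F] and card = frameD(6)[OF F] and M0 = frameD(2)[OF F] and M1 = frameD(3)[OF F]
    and Sc = frameD(4)[OF F] and SM = frameD(7)[OF F] and SN = frameD(8)[OF F]
  \<comment> \<open>In the basis \<open>u\<close>, \<open>M u\<close> the matrix of \<open>M\<close>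
    is a companion matrix, and the quadratic relation is Cayley-Hamilton with trace \<open>q\<close>
    and determinant \<open>- p\<close>.\<close>
  obtain p q where Mu': "M *v u' = p *s u + q *s u'" using plane_coordinates[OF uu] .
  have quad: "M *v (M *v y) = q *s (M *v y) + p *s y" for y
  proof -
    obtain s t where y: "y = s *s u + t *s u'" using plane_coordinates[OF uu] .
    show ?thesis
      unfolding y matrix_vector_mult_combination u'_def[symmetric] Mu'
      by (simp add: vec_eq_iff algebra_simps)
  qed
  define d where "d = csqrt (q\<^sup>2 + 4 * p)"
  define m1 where "m1 = (q + d) / 2"
  define m2 where "m2 = (q - d) / 2"
  have d: "d\<^sup>2 = q\<^sup>2 + 4 * p" by (simp add: d_def)
  have m: "m1 + m2 = q" "m1 * m2 = - p"
  proof -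
    show "m1 + m2 = q" by (simp add: m1_def m2_def field_simps)
    have "m1 * m2 = (q\<^sup>2 - d\<^sup>2) / 4" by (simp add: m1_def m2_def field_simps power2_eq_square)
    then show "m1 * m2 = - p" unfolding d by simp
  qed
  define v1 where "v1 = u' - m2 *s u"
  define v2 where "v2 = u' - m1 *s u"
  have Mv: "M *v v1 = m1 *s v1" "M *v v2 = m2 *s v2"
  proof -
    have *: "M *v (u' - x *s u) = y *s (u' - x *s u)" if "x + y = q" "x * y = - p" for x y
    proof -
      have "M *v (u' - x *s u) = p *s u + q *s u' - x *s u'"
        by (simp add: matrix_vector_mult_diff_distrib vector_scalar_commute u'_def[symmetric] Mu')
      also have "\<dots> = y *s (u' - x *s u)"
      proof -
        have "p = - (x * y)" "q = x + y" using that by simp_all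
        then show ?thesis by (simp add: vec_eq_iff algebra_simps)
      qed
      finally show ?thesis .
    qed
    show "M *v v1 = m1 *s v1" unfolding v1_def by (rule *) (use m in \<open>simp_all add: ac_simps\<close>)
    show "M *v v2 = m2 *s v2" unfolding v2_def by (rule *) (use m in \<open>simp_all add: ac_simps\<close>)
  qed
  have ne: "u' - x *s u \<noteq> 0" for x
  proof
    assume "u' - x *s u = 0"
    then have "(- x) *s u + 1 *s u' = 0" by simp
    then have "(1 :: complex) = 0" using uu unfolding indep2_def by blast
    then show False by simp
  qed
  have v0: "v1 \<noteq> 0" "v2 \<noteq> 0" unfolding v1_def v2_def by (rule ne)+
  have m01: "m1 \<noteq> 0" "m1 \<noteq> 1" "m2 \<noteq> 0" "m2 \<noteq> 1"
    using Mv M0[of v1] M1[of v1] M0[of v2] M1[of v2] v0 by auto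
  \<comment> \<open>With a double eigenvalue \<open>M\<close> would translate the coordinate
    \<open>t\<close> of \<open>u + t v1\<close> by \<open>1 / m1\<close>, and the orbit of 0 would
    give infinitely many directions in \<open>S\<close>.\<close>
  have m12: "m1 \<noteq> m2"
  proof
    assume eq: "m1 = m2"
    have ind: "indep2 u v1"
      unfolding indep2_def
    proof (intro allI impI)
      fix s t assume "s *s u + t *s v1 = 0"
      then have "(s - t * m2) *s u + t *s u' = 0" unfolding v1_def by (simp add: vec_eq_iff algebra_simps)
      then have "s - t * m2 = 0 \<and> t = 0" using uu unfolding indep2_def by blast
      then show "s = 0 \<and> t = 0" by simp
    qed
    let ?T = "{t. u + t *s v1 \<in> S}"
    have step: "t + 1 / m1 \<in> ?T" if "t \<in> ?T" for t
    proof -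
      have "M *v (u + t *s v1) = u' + (t * m1) *s v1"
        using matrix_vector_mult_combination[of M 1 u t v1] by (simp add: u'_def Mv)
      also have "u' = v1 + m1 *s u" by (simp add: v1_def eq)
      also have "v1 + m1 *s u + (t * m1) *s v1 = m1 *s (u + (t + 1 / m1) *s v1)"
        using m01(1) by (simp add: vec_eq_iff field_simps)
      finally have eq: "M *v (u + t *s v1) = m1 *s (u + (t + 1 / m1) *s v1)" .
      have "u + t *s v1 \<in> S" using that by (simp only: mem_Collect_eq)
      then have "m1 *s (u + (t + 1 / m1) *s v1) \<in> S" by (simp only: SM flip: eq)
      then show ?thesis by (simp only: Sc[OF m01(1)] mem_Collect_eq)
    qed
    have "of_nat n / m1 \<in> ?T" for n
    proof (induction n)
      case 0
      show ?case using u(1) by simp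
    next
      case (Suc n)
      from step[OF this] show ?case by (simp add: add_divide_distrib add.commute)
    qed
    then have "range (\<lambda>n :: nat. of_nat n / m1) \<subseteq> ?T" by blast
    then have "finite (range (\<lambda>n :: nat. of_nat n / m1))"
      using frame_finite_on_line(1)[OF F ind] finite_subset by blast
    moreover have "inj (\<lambda>n :: nat. of_nat n / m1)" using m01(1) by (auto intro: injI)
    ultimately have "finite (UNIV :: nat set)" by (rule finite_imageD)
    then show False by simp
  qed
  have ind: "indep2 v1 v2"
    unfolding indep2_def
  proof (intro allI impI)
    fix s t assume "s *s v1 + t *s v2 = 0"
    then have "(- s * m2 - t * m1) *s u + (s + t) *s u' = 0"
      unfolding v1_def v2_def by (simp add: vec_eq_iff algebra_simps)
    then have e: "- s * m2 - t * m1 = 0 \<and> s + t = 0" using uu unfolding indep2_def by blast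
    then have t: "t = - s" by (simp add: eq_neg_iff_add_eq_0 add.commute)
    then have "s * (m1 - m2) = 0" using e by (simp add: algebra_simps)
    then show "s = 0 \<and> t = 0" using m12 t by simp
  qed
  define a where "a = m2 / m1"
  define b where "b = (1 - m2) / (1 - m1)"
  have ab: "m2 = a * m1" "1 - m2 = b * (1 - m1)" using m01 by (simp_all add: a_def b_def)
  have ab0: "a \<noteq> 0" "b \<noteq> 0" using m01 by (simp_all add: a_def b_def)
  have ab1: "a \<noteq> 1" "b \<noteq> 1" "a \<noteq> b"
  proof -
    show "a \<noteq> 1" "b \<noteq> 1" using m12 m01 by (simp_all add: a_def b_def)
    show "a \<noteq> b"
    proof
      assume "a = b"
      then have "m2 * (1 - m1) = (1 - m2) * m1" using m01 by (simp add: a_def b_def field_simps)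
      then show False using m12 by (simp add: algebra_simps)
    qed
  qed
  define U where "U = {t. v1 + t *s v2 \<in> S} - {0}"
  have finU: "finite U" and cardU: "card U \<le> 4"
    unfolding U_def using frame_finite_on_line[OF F ind] card_Diff1_le[of "{t. v1 + t *s v2 \<in> S}" 0]
    by auto
  have U0: "0 \<notin> U" by (simp add: U_def)
  have comb: "M *v (v1 + t *s v2) = m1 *s v1 + (t * m2) *s v2" for t
    using matrix_vector_mult_combination[of M 1 v1 t v2] by (simp add: Mv)
  have Ua: "a * t \<in> U" if "t \<in> U" for t
  proof -
    have t: "v1 + t *s v2 \<in> S" "t \<noteq> 0" using that unfolding U_def by blast+
    have "M *v (v1 + t *s v2) = m1 *s (v1 + (a * t) *s v2)"
      unfolding comb by (simp add: ab(1) vec_eq_iff algebra_simps)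
    then have "m1 *s (v1 + (a * t) *s v2) \<in> S" using t(1) SM by metis
    then have "v1 + (a * t) *s v2 \<in> S" by (simp only: Sc[OF m01(1)])
    moreover have "a * t \<noteq> 0" using t(2) ab0 by simp
    ultimately show ?thesis unfolding U_def by blast
  qed
  have Ub: "b * t \<in> U" if "t \<in> U" for t
  proof -
    have t: "v1 + t *s v2 \<in> S" "t \<noteq> 0" using that unfolding U_def by blast+
    have "v1 + t *s v2 - M *v (v1 + t *s v2) = (1 - m1) *s v1 + (t * (1 - m2)) *s v2"
      unfolding comb by (simp add: vec_eq_iff algebra_simps)
    also have "\<dots> = (1 - m1) *s (v1 + (b * t) *s v2)"
      unfolding ab(2) by (simp add: vec_eq_iff algebra_simps)
    finally have "(1 - m1) *s (v1 + (b * t) *s v2) \<in> S" using t(1) SN by metis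
    moreover have "1 - m1 \<noteq> 0" using m01 by simp
    ultimately have "v1 + (b * t) *s v2 \<in> S" using Sc by blast
    moreover have "b * t \<noteq> 0" using t(2) ab0 by simp
    ultimately show ?thesis unfolding U_def by blast
  qed
  define n where "n = card U"
  have an: "a ^ n = 1" and bn: "b ^ n = 1"
    unfolding n_def using root_of_unity_of_invariant[OF finU U0] Ua Ub ab0 by blast+
  \<comment> \<open>\<open>E\<close> collects the fixed directions that belong to \<open>S\<close>,
    at coordinates 0 and infinity. There are at most two, so \<open>U\<close> has at least two
    elements.\<close>
  define E where "E = (\<lambda>v. point v) ` ({v1, v2} \<inter> S)"
  have cardE: "card E \<le> card ({v1, v2} \<inter> S)" unfolding E_def by (rule card_image_le) simp
  also have "\<dots> \<le> card {v1, v2}" by (rule card_mono) auto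
  finally have cardE2: "card E \<le> 2" using card_insert_le_m1[of 2 "{v2}" v1] by simp
  have "point ` S \<subseteq> (\<lambda>t. point (v1 + t *s v2)) ` U \<union> E"
  proof
    fix P assume "P \<in> point ` S"
    then obtain y where y: "y \<in> S" "P = point y" by blast
    obtain s t where st: "y = s *s v1 + t *s v2" using plane_coordinates[OF ind] .
    consider "s = 0" "t \<noteq> 0" | "s \<noteq> 0" "t = 0" | "s \<noteq> 0" "t \<noteq> 0" using st y(1) S0 by fastforce
    then show "P \<in> (\<lambda>t. point (v1 + t *s v2)) ` U \<union> E"
    proof cases
      case 1
      then have "v2 \<in> S" "P = point v2" using y st Sc[of t v2] span_scale_eq[of t v2] by simp_all
      then show ?thesis unfolding E_def by blast
    next
      case 2
      then have "v1 \<in> S" "P = point v1" using y st Sc[of s v1] span_scale_eq[of s v1] by simp_all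
      then show ?thesis unfolding E_def by blast
    next
      case 3
      then have eq: "y = s *s (v1 + (t / s) *s v2)" unfolding st by (simp add: vec_eq_iff field_simps)
      then have "v1 + (t / s) *s v2 \<in> S" using Sc[OF 3(1)] y(1) by metis
      then have "t / s \<in> U" using 3 by (simp add: U_def)
      moreover have "P = point (v1 + (t / s) *s v2)" unfolding y(2) eq by (rule span_scale_eq[OF 3(1)])
      ultimately show ?thesis by blast
    qed
  qed
  then have "4 \<le> card ((\<lambda>t. point (v1 + t *s v2)) ` U \<union> E)"
    unfolding card[symmetric] by (rule card_mono[rotated]) (use finU in \<open>simp add: E_def\<close>)
  also have "\<dots> \<le> card ((\<lambda>t. point (v1 + t *s v2)) ` U) + card E" by (rule card_Un_le)
  also have "\<dots> \<le> n + card E" using card_image_le[OF finU] by (simp add: n_def)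
  finally have n4: "4 \<le> n + card E" .
  have cases: "n = 2 \<or> n = 3 \<or> n = 4" using n4 cardE2 cardU unfolding n_def by linarith
  \<comment> \<open>Trace and determinant are expressed by \<open>a\<close> and \<open>m1\<close>;
    \<open>rel\<close> then recovers \<open>m1\<close> from the two roots of unity.\<close>
  have pm: "p = - (a * m1 ^ 2)" using m(2) ab(1) by (simp add: power2_eq_square algebra_simps)
  have qm: "q = (1 + a) * m1" using m(1) ab(1) by (simp add: algebra_simps)
  have rel: "m1 * (b - a) = b - 1" using ab by (simp add: algebra_simps)
  show ?thesis
    using cases
  proof (elim disjE)
    \<comment> \<open>Two elements would force \<open>a = b = -1\<close>, but the rotations
      differ.\<close>
    assume "n = 2"
    then have "(a - 1) * (a + 1) = 0" "(b - 1) * (b + 1) = 0"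
      using an bn by (simp_all add: algebra_simps power2_eq_square)
    then have "a = -1" "b = -1" using ab1 by (auto simp: eq_neg_iff_add_eq_0)
    then show ?thesis using ab1 by simp
  next
    assume n: "n = 3"
    have "(a - 1) * (a\<^sup>2 + a + 1) = 0" "(b - 1) * (b\<^sup>2 + b + 1) = 0"
      using an bn n by (simp_all add: algebra_simps power2_eq_square power3_eq_cube)
    then have a3: "a\<^sup>2 + a + 1 = 0" and b3: "b\<^sup>2 + b + 1 = 0" using ab1 by auto
    \<comment> \<open>\<open>a\<close> and \<open>b\<close> are the two primitive cube roots of
      unity, so their sum is -1. The fourth direction of \<open>S\<close> is an eigenline of
      \<open>M\<close>.\<close>
    have "(a - b) * (a + b + 1) = 0" using a3 b3 by algebra
    then have "a + b + 1 = 0" using ab1 by simp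
    then have a: "a = - 1 - b" by algebra
    have r: "m1 * (2 * b + 1) = b - 1" using rel a by (simp add: algebra_simps)
    have b2: "2 * b + 1 \<noteq> 0"
    proof
      assume "2 * b + 1 = 0"
      then have "(3 :: complex) = 0" using b3 by algebra
      then show False by simp
    qed
    have "(2 * b + 1) * (q - 1) = 0" using qm a r b3 by algebra
    then have q: "q = 1" using b2 by simp
    have "(2 * b + 1) ^ 2 * (p + 1) = 0" using pm a r b3 by algebra
    then have p: "p = -1" using b2 by (simp add: eq_neg_iff_add_eq_0)
    have "card ({v1, v2} \<inter> S) \<noteq> 0" using n4 n cardE by linarith
    then have "v1 \<in> S \<or> v2 \<in> S" by auto
    then have "\<exists>w\<in>S. \<exists>m. M *v w = m *s w" using Mv by blast
    then show ?thesis using quad q p by blast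
  next
    assume n: "n = 4"
    have "(a - 1) * ((a + 1) * (a\<^sup>2 + 1)) = 0" "(b - 1) * ((b + 1) * (b\<^sup>2 + 1)) = 0"
      using an bn n by (simp_all add: algebra_simps power2_eq_square power4_eq_xxxx)
    then have a4: "a = -1 \<or> a\<^sup>2 = -1" and b4: "b = -1 \<or> b\<^sup>2 = -1"
      using ab1 by (auto simp: eq_neg_iff_add_eq_0)
    \<comment> \<open>In the three cases -1 equals \<open>a\<close>, \<open>b\<close> or
      \<open>b / a\<close>, the eigenvalue ratios of \<open>M\<close>, \<open>1 - M\<close> and 1
      minus the inverse of \<open>M\<close>.\<close>
    consider "a = -1" "b\<^sup>2 = -1" | "a\<^sup>2 = -1" "b = -1" | "a\<^sup>2 = -1" "b\<^sup>2 = -1"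
      using a4 b4 ab1 by auto
    then show ?thesis
    proof cases
      case 1
      have "q = 0" using qm 1 by simp
      moreover have "b * (p + 1) = 0" using pm rel 1 by algebra
      then have "p = -1" using ab0 by (simp add: eq_neg_iff_add_eq_0)
      ultimately show ?thesis using quad by blast
    next
      case 2
      have r: "m1 * (1 + a) = 2" using rel 2 by algebra
      then have "q = 2" using qm by (simp add: mult.commute)
      moreover have "2 * (p + 2) = 0" using pm r 2 by algebra
      then have "p + 2 = 0" by (simp only: mult_eq_0_iff) simp
      then have "p = -2" by algebra
      ultimately show ?thesis using quad by blast
    next
      case 3
      have "(a - b) * (a + b) = 0" using 3 by algebra
      then have "a + b = 0" using ab1 by simp
      then have b: "b = - a" by algebra
      have r: "2 * a * m1 = 1 + a" using rel b by algebra
      have "a * (q - 1) = 0" using qm r 3 by algebra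
      then have "q = 1" using ab0 by simp
      moreover have "2 * p + 1 = 0" using pm r 3 by algebra
      then have "2 * p = - 1" by algebra
      then have "p = - 1 / 2" by (simp add: field_simps)
      ultimately show ?thesis using quad by blast
    qed
  qed
qed

section \<open>Identification of the configurations\<close>

text \<open>Normal form for both cases: \<open>M\<close> has determinant 1 and trace
  \<open>l\<close>, and \<open>c\<close> is the cross-ratio parameter of the four directions
  \<open>u1\<close>, \<open>u2\<close>, \<open>u1 + u2\<close>, \<open>u1 + c u2\<close>.
  Coordinates 1 and 3 belong to \<open>E1\<close>, coordinates 2 and 4 to \<open>E2\<close>.\<close>

lemma frame_proj_equivalent:
  assumes F: "frame Z S E1 E2 M" and u: "indep2 u1 u2" and M: "M *v u1 = - u2" "M *v u2 = u1 + l *s u2"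
    and S: "u1 \<in> S" "u2 \<in> S" "u1 + u2 \<in> S" "u1 + c *s u2 \<in> S" and c: "c \<noteq> 0" "c \<noteq> 1"
  shows "proj_equivalent Z
    {pt 1 0 0 0, pt 0 0 1 0, pt 1 0 1 0, pt 1 0 c 0, pt 0 1 0 0, pt 0 0 0 1, pt 0 1 0 1, pt 0 1 0 c,
     pt 1 1 0 0, pt 0 0 1 1, pt 1 1 1 1, pt 1 1 c c,
     pt 1 0 0 (-1), pt 0 1 1 l, pt 1 1 1 (l - 1), pt 1 c c (c * l - 1)}" (is "proj_equivalent Z ?W")
proof -
  note inj = frameD(1)[OF F] and card = frameD(6)[OF F]
  have ind: "indep4 (E1 *v u1) (E2 *v u1) (E1 *v u2) (E2 *v u2)"
    unfolding indep4_def
  proof (intro allI impI)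
    fix p q r s
    assume "p *s (E1 *v u1) + q *s (E2 *v u1) + r *s (E1 *v u2) + s *s (E2 *v u2) = 0"
    then have "E1 *v (p *s u1 + r *s u2) + E2 *v (q *s u1 + s *s u2) = 0"
      unfolding matrix_vector_mult_combination by (simp add: add_ac)
    from inj[OF this] show "p = 0 \<and> q = 0 \<and> r = 0 \<and> s = 0" using u unfolding indep2_def by blast
  qed
  obtain T B :: "complex ^ 4 ^ 4" where T: "T ** B = mat 1" "B ** T = mat 1"
    "\<And>s. T *v s = s $ 1 *s (E1 *v u1) + s $ 2 *s (E2 *v u1) + s $ 3 *s (E1 *v u2) + s $ 4 *s (E2 *v u2)"
    using indep4_matrix[OF ind] by blast
  have B: "B *v (E1 *v (p *s u1 + r *s u2) + E2 *v (q *s u1 + s *s u2)) = vector [p, q, r, s]" for p q r s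
  proof -
    have "E1 *v (p *s u1 + r *s u2) + E2 *v (q *s u1 + s *s u2) = T *v vector [p, q, r, s]"
      unfolding T(3) matrix_vector_mult_combination by (simp add: vector_4 add_ac)
    then show ?thesis using T(2) by (simp add: matrix_vector_mul_assoc)
  qed
  let ?V = "{u1, u2, u1 + u2, u1 + c *s u2}"
  have ne: "point (s *s u1 + t *s u2) \<noteq> point (s' *s u1 + t' *s u2)" if h: "s * t' - s' * t \<noteq> 0" for s t s' t'
  proof
    assume eq: "point (s *s u1 + t *s u2) = point (s' *s u1 + t' *s u2)"
    have "s' *s u1 + t' *s u2 \<noteq> 0" using u h unfolding indep2_def by force
    then obtain k where "s *s u1 + t *s u2 = k *s (s' *s u1 + t' *s u2)" using eq span_eq_iff by blast
    then have "(s - k * s') *s u1 + (t - k * t') *s u2 = 0" by (simp add: vec_eq_iff) (simp add: algebra_simps)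
    then have "s - k * s' = 0 \<and> t - k * t' = 0" using u unfolding indep2_def by blast
    then show False using h by (simp add: algebra_simps)
  qed
  have "card (point ` ?V) = 4"
    using ne[of 1 1 0 0] ne[of 1 1 1 0] ne[of 1 c 1 0] ne[of 0 1 1 1] ne[of 0 c 1 1] ne[of 1 c 1 1] c by simp
  \<comment> \<open>Four distinct directions inside a set of four exhaust it; afterwards only these
    representatives matter.\<close>
  then have dirs: "point ` ?V = point ` S"
    using S card by (intro card_subset_eq) (auto intro: card_ge_0_finite)
  have img: "(\<lambda>y. point (A *v y)) ` S = (\<lambda>y. point (A *v y)) ` ?V" for A :: "complex ^ 2 ^ 4"
  proof -
    have "(\<lambda>y. point (A *v y)) ` X = (\<lambda>p. (\<lambda>v. A *v v) ` p) ` point ` X" for X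
      by (simp add: image_image matrix_line_image)
    then show ?thesis using dirs by metis
  qed
  have mm: "(E1 + E2) *v y = E1 *v y + E2 *v y" "(E1 + E2 ** M) *v y = E1 *v y + E2 *v (M *v y)" for y
    by (simp_all add: matrix_vector_mult_add_rdistrib matrix_vector_mul_assoc)
  have pB: "(\<lambda>v. B *v v) ` point (E1 *v y + E2 *v w) = pt p q r s"
    if "y = p *s u1 + r *s u2" "w = q *s u1 + s *s u2" for y w p q r s
    unfolding matrix_line_image pt_def that B ..
  have M': "M *v (u1 + u2) = 1 *s u1 + (l - 1) *s u2" "M *v (u1 + c *s u2) = c *s u1 + (c * l - 1) *s u2"
    using matrix_vector_mult_combination[of M 1 u1 1 u2] matrix_vector_mult_combination[of M 1 u1 c u2]
    by (simp_all add: M vec_eq_iff algebra_simps)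
  have imgB: "(\<lambda>p. (\<lambda>v. B *v v) ` p) ` (\<lambda>y. point (A *v y)) ` S = (\<lambda>y. (\<lambda>v. B *v v) ` point (A *v y)) ` ?V"
    for A :: "complex ^ 2 ^ 4"
    unfolding img by (rule image_image)
  have "proj_image B Z = (\<lambda>p. (\<lambda>v. B *v v) ` p) ` (\<lambda>y. point (E1 *v y)) ` S
      \<union> (\<lambda>p. (\<lambda>v. B *v v) ` p) ` (\<lambda>y. point (E2 *v y)) ` S
      \<union> (\<lambda>p. (\<lambda>v. B *v v) ` p) ` (\<lambda>y. point (E1 *v y + E2 *v y)) ` S
      \<union> (\<lambda>p. (\<lambda>v. B *v v) ` p) ` (\<lambda>y. point (E1 *v y + E2 *v (M *v y))) ` S"
    unfolding proj_image_def frame_points[OF F] by (simp only: image_Un)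
  also have "\<dots> = (\<lambda>y. (\<lambda>v. B *v v) ` point (E1 *v y + E2 *v 0)) ` ?V
      \<union> (\<lambda>y. (\<lambda>v. B *v v) ` point (E1 *v 0 + E2 *v y)) ` ?V
      \<union> (\<lambda>y. (\<lambda>v. B *v v) ` point (E1 *v y + E2 *v y)) ` ?V
      \<union> (\<lambda>y. (\<lambda>v. B *v v) ` point (E1 *v y + E2 *v (M *v y))) ` ?V"
    unfolding imgB[of E1] imgB[of E2] imgB[of "E1 + E2", unfolded mm] imgB[of "E1 + E2 ** M", unfolded mm]
    by (simp only: matrix_vector_mult_0_right add_0_left add_0_right)
  also have "(\<lambda>y. (\<lambda>v. B *v v) ` point (E1 *v y + E2 *v 0)) ` ?V = {pt 1 0 0 0, pt 0 0 1 0, pt 1 0 1 0, pt 1 0 c 0}"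
    unfolding image_insert image_empty
    by (intro arg_cong2[of _ _ _ _ insert] pB refl) simp_all
  also have "(\<lambda>y. (\<lambda>v. B *v v) ` point (E1 *v 0 + E2 *v y)) ` ?V = {pt 0 1 0 0, pt 0 0 0 1, pt 0 1 0 1, pt 0 1 0 c}"
    unfolding image_insert image_empty
    by (intro arg_cong2[of _ _ _ _ insert] pB refl) simp_all
  also have "(\<lambda>y. (\<lambda>v. B *v v) ` point (E1 *v y + E2 *v y)) ` ?V = {pt 1 1 0 0, pt 0 0 1 1, pt 1 1 1 1, pt 1 1 c c}"
    unfolding image_insert image_empty
    by (intro arg_cong2[of _ _ _ _ insert] pB refl) simp_all
  also have "(\<lambda>y. (\<lambda>v. B *v v) ` point (E1 *v y + E2 *v (M *v y))) ` ?V
      = {pt 1 0 0 (-1), pt 0 1 1 l, pt 1 1 1 (l - 1), pt 1 c c (c * l - 1)}"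
    unfolding image_insert image_empty M M'
    by (intro arg_cong2[of _ _ _ _ insert] pB refl) simp_all
  finally have "proj_image B Z = ?W" by (simp only: Un_insert_left Un_empty_left)
  moreover have "invertible B" unfolding invertible_def using T(1,2) by blast
  ultimately show ?thesis unfolding proj_equivalent_def by blast
qed

lemma indep2_uminus:
  assumes "indep2 u v"
  shows "indep2 u (- v)"
  unfolding indep2_def
proof (intro allI impI)
  fix s t assume "s *s u + t *s (- v) = 0"
  then have "s *s u + (- t) *s v = 0" by simp
  then have "s = 0 \<and> - t = 0" using assms unfolding indep2_def by blast
  then show "s = 0 \<and> t = 0" by simp
qed

text \<open>From \<open>u\<close> the invariance of \<open>S\<close> produces all four directions:
  \<open>u\<close>, \<open>w = - M u\<close>, \<open>u + w = u - M u\<close>, and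
  \<open>M (u + w) = u - w\<close>. So \<open>l = 0\<close> and \<open>c = -1\<close>.\<close>

lemma frame_harmonic:
  assumes F: "frame Z S E1 E2 M" and u: "u \<in> S" "indep2 u (M *v u)" and M: "\<And>y. M *v (M *v y) = - y"
  shows "proj_equivalent Z harmonic_points"
proof -
  note Sc = frameD(4)[OF F] and SM = frameD(7)[OF F] and SN = frameD(8)[OF F]
  have neg: "- y \<in> S \<longleftrightarrow> y \<in> S" for y using Sc[of "-1" y] by simp
  let ?w = "- (M *v u)"
  have Mw: "M *v ?w = u" by (simp add: vec.linear_neg M)
  have "u + ?w \<in> S" using SN[of u] u(1) by simp
  then have "M *v (u + ?w) \<in> S" by (simp only: SM)
  moreover have "M *v (u + ?w) = u + (-1) *s ?w" by (simp only: matrix_vector_right_distrib Mw) simp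
  ultimately have d: "u + (-1) *s ?w \<in> S" by metis
  from u(2) have "indep2 u ?w" by (rule indep2_uminus)
  then have "proj_equivalent Z
    {pt 1 0 0 0, pt 0 0 1 0, pt 1 0 1 0, pt 1 0 (-1) 0, pt 0 1 0 0, pt 0 0 0 1, pt 0 1 0 1, pt 0 1 0 (-1),
     pt 1 1 0 0, pt 0 0 1 1, pt 1 1 1 1, pt 1 1 (-1) (-1),
     pt 1 0 0 (-1), pt 0 1 1 0, pt 1 1 1 (0 - 1), pt 1 (-1) (-1) ((-1) * 0 - 1)}"
    by (rule frame_proj_equivalent[OF F])
      (use Mw u(1) d SM neg \<open>u + ?w \<in> S\<close> in simp_all)
  moreover have "pt 1 (-1) (-1) ((-1) * 0 - 1) = pt (-1) 1 1 1"
  proof -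
    have "(vector [-1, 1, 1, 1] :: complex ^ 4) = (-1) *s vector [1, -1, -1, -1]"
      by (simp add: vec_eq_iff forall_4 vector_4)
    then show ?thesis unfolding pt_def using span_scale_eq[of "-1" "vector [1, -1, -1, -1] :: complex ^ 4"] by simp
  qed
  ultimately show ?thesis
    unfolding harmonic_points_def by (simp add: insert_commute)
qed

text \<open>The orbit of \<open>u\<close> supplies \<open>u\<close>, \<open>v = - M u\<close> and
  \<open>u + v\<close>; the fourth direction is the eigenvector \<open>w\<close>, proportional to
  \<open>u + \<epsilon> v\<close>. So \<open>l = 1\<close> and
  \<open>c = \<epsilon>\<close>.\<close>

lemma frame_anharmonic:
  assumes F: "frame Z S E1 E2 M" and u: "u \<in> S" "indep2 u (M *v u)" and M: "\<And>y. M *v (M *v y) = M *v y - y"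
    and \<epsilon>: "\<epsilon>\<^sup>2 = \<epsilon> - 1" and w: "w \<in> S" "M *v w = \<epsilon> *s w"
  shows "proj_equivalent Z (anharmonic_points \<epsilon>)"
proof -
  note Sc = frameD(4)[OF F] and SM = frameD(7)[OF F] and SN = frameD(8)[OF F] and S0 = frameD(5)[OF F]
  have neg: "- y \<in> S \<longleftrightarrow> y \<in> S" for y using Sc[of "-1" y] by simp
  let ?v = "- (M *v u)"
  have Mv: "M *v ?v = u + 1 *s ?v" by (simp add: vec.linear_neg M)
  have \<epsilon>01: "\<epsilon> \<noteq> 0" "\<epsilon> \<noteq> 1" using \<epsilon> by auto
  obtain s t where st: "w = s *s u + t *s (M *v u)" using plane_coordinates[OF u(2)] .
  have "s *s (M *v u) + t *s (M *v u - u) = \<epsilon> *s (s *s u + t *s (M *v u))"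
    using w(2) unfolding st matrix_vector_mult_combination M .
  then have "(- t - \<epsilon> * s) *s u + (s + t - \<epsilon> * t) *s (M *v u) = 0"
    by (simp add: vec_eq_iff) (simp add: algebra_simps)
  then have "- t - \<epsilon> * s = 0 \<and> s + t - \<epsilon> * t = 0" using u(2) unfolding indep2_def by blast
  then have "- t - \<epsilon> * s = 0" ..
  then have t: "t = - (\<epsilon> * s)" by algebra
  have ws: "w = s *s (u + \<epsilon> *s ?v)" unfolding st t by (simp add: vec_eq_iff algebra_simps)
  then have "s \<noteq> 0" using w(1) S0 by auto
  then have d: "u + \<epsilon> *s ?v \<in> S" using w(1) ws Sc by metis
  from u(2) have "indep2 u ?v" by (rule indep2_uminus)
  then have "proj_equivalent Z
    {pt 1 0 0 0, pt 0 0 1 0, pt 1 0 1 0, pt 1 0 \<epsilon> 0, pt 0 1 0 0, pt 0 0 0 1, pt 0 1 0 1, pt 0 1 0 \<epsilon>,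
     pt 1 1 0 0, pt 0 0 1 1, pt 1 1 1 1, pt 1 1 \<epsilon> \<epsilon>,
     pt 1 0 0 (-1), pt 0 1 1 1, pt 1 1 1 (1 - 1), pt 1 \<epsilon> \<epsilon> (\<epsilon> * 1 - 1)}"
    by (rule frame_proj_equivalent[OF F _ _ Mv])
      (use u(1) d SM SN[of u] neg \<epsilon>01 in simp_all)
  then show ?thesis
    unfolding anharmonic_points_def by (simp add: insert_commute)
qed

text \<open>The relation is the sixth cyclotomic polynomial, left after removing the factors whose
  roots have order 1, 2 or 3.\<close>

lemma primitive_sixth_root:
  assumes "primitive_root_of_unity 6 \<epsilon>"
  shows "\<epsilon>\<^sup>2 = \<epsilon> - 1"
proof -
  have 6: "\<epsilon> ^ 6 = 1" and 3: "\<epsilon> ^ 3 \<noteq> 1" and 2: "\<epsilon> ^ 2 \<noteq> 1"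
    using assms unfolding primitive_root_of_unity_def by auto
  have "(\<epsilon> ^ 3 - 1) * (\<epsilon> ^ 3 + 1) = 0" using 6 by algebra
  then have "\<epsilon> ^ 3 + 1 = 0" using 3 by simp
  then have "(\<epsilon> + 1) * (\<epsilon>\<^sup>2 - \<epsilon> + 1) = 0" by algebra
  moreover have "\<epsilon> + 1 \<noteq> 0"
  proof
    assume "\<epsilon> + 1 = 0"
    then have "\<epsilon> ^ 2 = 1" by algebra
    then show False using 2 by simp
  qed
  ultimately have "\<epsilon>\<^sup>2 - \<epsilon> + 1 = 0" by simp
  then show ?thesis by algebra
qed

lemma frame_classification:
  assumes F: "frame Z S E1 E2 M" and nonscalar: "\<not> (\<exists>c. \<forall>y. M *v y = c *s y)" and \<epsilon>: "\<epsilon>\<^sup>2 = \<epsilon> - 1"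
  shows "proj_equivalent Z (anharmonic_points \<epsilon>) \<or> proj_equivalent Z harmonic_points"
proof -
  obtain u where u: "u \<in> S" "indep2 u (M *v u)" using frame_not_eigenvector[OF F nonscalar] by blast
  obtain q p where quad: "\<And>y. M *v (M *v y) = q *s (M *v y) + p *s y" and
    cases: "q = 1 \<and> p = -1 \<and> (\<exists>w\<in>S. \<exists>m. M *v w = m *s w) \<or>
     q = 0 \<and> p = -1 \<or> q = 2 \<and> p = -2 \<or> q = 1 \<and> p = - 1 / 2"
    using frame_quadratic[OF F u] by blast
  obtain N where N: "M ** N = mat 1" "N ** M = mat 1" and FN: "frame Z S E2 E1 N"
    using frame_swap_12[OF F] .
  have inv: "M *v (N *v y) = y" "N *v (M *v y) = y" for y
    using N by (simp_all add: matrix_vector_mul_assoc)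
  have uN: "indep2 u (N *v u)"
    unfolding indep2_def
  proof (intro allI impI)
    fix s t assume "s *s u + t *s (N *v u) = 0"
    then have "M *v (s *s u + t *s (N *v u)) = 0" by simp
    then have "t *s u + s *s (M *v u) = 0" unfolding matrix_vector_mult_combination inv by (simp add: add.commute)
    then show "s = 0 \<and> t = 0" using u(2) unfolding indep2_def by blast
  qed
  have minus: "indep2 u ((mat 1 - K) *v u)" if "indep2 u (K *v u)" for K :: "complex ^ 2 ^ 2"
    unfolding indep2_def
  proof (intro allI impI)
    fix s t assume "s *s u + t *s ((mat 1 - K) *v u) = 0"
    then have "(s + t) *s u + (- t) *s (K *v u) = 0"
      by (simp add: matrix_vector_mult_diff_rdistrib vec_eq_iff algebra_simps)
    then have "s + t = 0 \<and> - t = 0" using that unfolding indep2_def by blast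
    then show "s = 0 \<and> t = 0" by auto
  qed
  show ?thesis
    using cases
  proof (elim disjE conjE bexE exE)
    fix w m assume qp: "q = 1" "p = -1" and w: "w \<in> S" "M *v w = m *s w"
    have M2: "M *v (M *v y) = M *v y - y" for y using quad[of y] by (simp add: qp)
    have "w \<noteq> 0" using w(1) frameD(5)[OF F] by blast
    moreover have "(m * m - m + 1) *s w = 0"
      using M2[of w] by (simp add: w(2) vector_scalar_commute vec_eq_iff algebra_simps)
    ultimately have "m * m - m + 1 = 0" using vec.scale_eq_0_iff by blast
    then have "(m - \<epsilon>) * (m - (1 - \<epsilon>)) = 0" using \<epsilon> by algebra
    then consider "m = \<epsilon>" | "m = 1 - \<epsilon>" by auto
    then show ?thesis
    proof cases
      case 1
      then show ?thesis using frame_anharmonic[OF F u M2 \<epsilon> w(1)] w(2) by blast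
    next
      case 2
      have N2: "N *v (N *v y) = N *v y - y" for y
      proof -
        have "N *v (N *v (M *v (M *v y))) = N *v (N *v (M *v y - y))" unfolding M2 ..
        then have "y = N *v y - N *v (N *v y)"
          unfolding inv matrix_vector_mult_diff_distrib .
        then show ?thesis by (simp add: algebra_simps)
      qed
      \<comment> \<open>The eigenvalue \<open>1 - \<epsilon>\<close> is the inverse of
        \<open>\<epsilon>\<close>; passing to \<open>N\<close>, which satisfies the same quadratic
        equation, replaces it by \<open>\<epsilon>\<close>.\<close>
      have "\<epsilon> * m = 1" using 2 \<epsilon> by algebra
      then have "w = \<epsilon> *s (M *v w)" unfolding w(2) by simp
      then have "N *v w = \<epsilon> *s w" by (metis inv(2) vector_scalar_commute)
      then show ?thesis using frame_anharmonic[OF FN u(1) uN N2 \<epsilon> w(1)] by blast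
    qed
  next
    assume qp: "q = 0" "p = -1"
    have "M *v (M *v y) = - y" for y using quad[of y] by (simp add: qp)
    then show ?thesis using frame_harmonic[OF F u] by blast
  next
    assume qp: "q = 2" "p = -2"
    \<comment> \<open>Here \<open>b = -1\<close>: after exchanging the first and third lines, the
      new matrix \<open>1 - M\<close> squares to -1.\<close>
    have "(mat 1 - M) *v ((mat 1 - M) *v y) = - y" for y
    proof -
      have "(mat 1 - M) *v ((mat 1 - M) *v y) = y - M *v y - (M *v y - M *v (M *v y))"
        by (simp only: matrix_vector_mult_diff_rdistrib matrix_vector_mult_diff_distrib matrix_vector_mul_lid)
      then show ?thesis unfolding quad qp by (simp add: vec_eq_iff)
    qed
    then show ?thesis using frame_harmonic[OF frame_swap_13[OF F] u(1) minus[OF u(2)]] by blast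
  next
    assume qp: "q = 1" "p = - 1 / 2"
    \<comment> \<open>Here \<open>b = - a\<close>: the relation turns into
      \<open>N^2 = 2 N - 2\<close>, so \<open>1 - N\<close> squares to -1. Both exchanges of lines
      are applied.\<close>
    have "(mat 1 - N) *v ((mat 1 - N) *v y) = - y" for y
    proof -
      have "N *v (N *v (M *v (M *v y))) = N *v (N *v (q *s (M *v y) + p *s y))" unfolding quad ..
      then have e: "y = q *s (N *v y) + p *s (N *v (N *v y))"
        unfolding matrix_vector_mult_combination inv .
      have "(mat 1 - N) *v ((mat 1 - N) *v y) = y - N *v y - (N *v y - N *v (N *v y))"
        by (simp only: matrix_vector_mult_diff_rdistrib matrix_vector_mult_diff_distrib matrix_vector_mul_lid)
      moreover have "N *v (N *v y) = 2 *s (N *v y) - 2 *s y"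
        using e unfolding qp by (simp add: vec_eq_iff field_simps)
      ultimately show ?thesis by (simp add: vec_eq_iff)
    qed
    then show ?thesis using frame_harmonic[OF frame_swap_13[OF FN] u(1) minus[OF uN]] by blast
  qed
qed

theorem theorem1p5:
  fixes Z :: "(complex ^ 4) set set" and \<epsilon> :: complex
  assumes "half_grid 4 4 Z"
    and "primitive_root_of_unity 6 \<epsilon>"
  shows "proj_equivalent Z (anharmonic_points \<epsilon>) \<or> proj_equivalent Z harmonic_points"
proof -
  obtain f L where "quartic_lines f L" and Z: "Z = (\<Union>i<4. zero_points f (L i))"
    using half_grid_quartic_lines[OF assms(1)] by blast
  then interpret quartic_lines f L by simp
  have "\<not> (\<exists>H. proj_plane H \<and> (\<forall>i<4. L i \<subseteq> H))"
  proof
    assume "\<exists>H. proj_plane H \<and> (\<forall>i<4. L i \<subseteq> H)"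
    then obtain H where H: "proj_plane H" "\<forall>i<4. L i \<subseteq> H" by blast
    have "p \<subseteq> H" if p: "p \<in> Z" for p
    proof -
      obtain i where i: "i < 4" "p \<in> zero_points f (L i)" using p unfolding Z by blast
      then obtain x where "x \<in> L i" "p = point x" by (auto simp: zero_points_def)
      then have "p \<subseteq> L i" using span_subset[OF i(1), of "{x}"] by simp
      then show ?thesis using H(2) i(1) by blast
    qed
    then show False using assms(1) H(1) unfolding half_grid_def nontrivial_def by blast
  qed
  from frame_exists[OF this] obtain S E1 E2 M where F: "frame Z S E1 E2 M" unfolding Z by blast
  have "\<not> (\<exists>c. \<forall>y. M *v y = c *s y)"
  proof
    assume "\<exists>c. \<forall>y. M *v y = c *s y"
    then have "grid 4 4 Z" using frame_scalar_grid[OF F] by blast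
    then show False using assms(1) unfolding half_grid_def by blast
  qed
  then show ?thesis using frame_classification[OF F _ primitive_sixth_root[OF assms(2)]] by blast
qed

end
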